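(* Let $g\in L^2(\mathbb{H})$. The system $\{L_{(2k,l,m)}g:k,l,m\in\mathbb{Z}\}$ is a Riesz sequence in $L^2(\mathbb{H})$ if and only if there exist $A,B>0$ such that \begin{align*} A\|\{c_{k,l}\}\|_{\ell^2(\mathbb{Z}^2)}^2 &\leq\sum_{k,l,k',l'\in\mathbb{Z}}\ \sum_{r\in\mathbb{Z}}c_{k,l}\,\overline{c_{k',l'}}\,e^{2\pi i(\lambda-r)(lk'-kl')}\big\langle\big(T^t_{(2(k-k'),l-l')}\big)^{\lambda-r}g^{\lambda-r},g^{\lambda-r}\big\rangle_{L^2(\mathbb{R}^2)}\\ &\leq B\|\{c_{k,l}\}\|_{\ell^2(\mathbb{Z}^2)}^2 \end{align*} for a.e. $\lambda\in(0,1]$ and for all $\{c_{k,l}\}\in\ell^2(\mathbb{Z}^2)$.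
   Context: The Heisenberg group $\mathbb{H}$ is $\mathbb{R}\times\mathbb{R}\times\mathbb{R}$ with group law $(x,y,t)(x',y',t')=(x+x',y+y',t+t'+\tfrac12(x'y-y'x))$; its Haar measure is Lebesgue measure $dx\,dy\,dt$. For $(u,v,s)\in\mathbb{H}$ the left translation operator is $L_{(u,v,s)}f(x,y,t)=f((u,v,s)^{-1}(x,y,t))$, a unitary operator on $L^2(\mathbb{H})$. For $f\in L^2(\mathbb{H})$, $f^\lambda(x,y)=\int_{\mathbb{R}}f(x,y,t)e^{2\pi i\lambda t}\,dt$ is the inverse Fourier transform of $f$ in the variable $t$ (in the $L^2$ sense); $f^\lambda\in L^2(\mathbb{R}^2)$ for a.e. $\lambda$. For $(u,v)\in\mathbb{R}^2$ and $\lambda\in\mathbb{R}\setminus\{0\}$ the $\lambda$-twisted translation operator on $L^2(\mathbb{R}^2)$ is $(T^t_{(u,v)})^\lambda F(x,y)=e^{\pi i\lambda(vx-uy)}F(x-u,y-v)$ (the superscript $t$ is only part of the notation). Inner products are linear in the first variable. A countable family $\{f_j\}$ in a Hilbert space is a Riesz sequence if there are $A,B>0$ with $A\|\{c_j\}\|_{\ell^2}^2\le\|\sum_jc_jf_j\|^2\le B\|\{c_j\}\|_{\ell^2}^2$ for all finite sequences $\{c_j\}$. Meaning of the middle term: it is the quadratic form $\langle G(\lambda)\{c_{k,l}\},\{c_{k,l}\}\rangle_{\ell^2(\mathbb{Z}^2)}$ of the Gramian $G(\lambda)=H(\lambda)^*H(\lambda)$ on $\ell^2(\mathbb{Z}^2)$,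 where $H(\lambda):\ell^2(\mathbb{Z}^2)\to\ell^2(\mathbb{Z},\mathcal{B}_2)$, $H(\lambda)(\{c_{k,l}\})=\sum_{k,l\in\mathbb{Z}}c_{k,l}\,\tau(L_{(2k,l,0)}g)(\lambda)$. Here $\mathcal{B}_2$ is the Hilbert space of Hilbert–Schmidt operators on $L^2(\mathbb{R})$ with inner product $(T,S)=\mathrm{tr}(TS^* )$, $\tau f(\lambda)=\{|\lambda-r|^{1/2}\widehat f(\lambda-r)\}_{r\in\mathbb{Z}}$, and $\widehat f(\lambda)=\int_{\mathbb{R}^2}f^\lambda(x,y)\pi_\lambda(x,y,0)\,dx\,dy$ is the group Fourier transform (extended to $L^2(\mathbb{H})$ by Plancherel), with $\pi_\lambda(x,y,t)\varphi(\xi)=e^{2\pi i\lambda t}e^{2\pi i\lambda(x\xi+\frac12xy)}\varphi(\xi+y)$ for $\varphi\in L^2(\mathbb{R})$. *)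

theory Defs
  imports "HOL-Analysis.Analysis"
begin

(* Elements of L^2 spaces are represented by Borel functions; equality in L^2 is equality
   almost everywhere. Inner products are linear in the first variable. *)

definition L2 :: "'a measure \<Rightarrow> ('a \<Rightarrow> complex) set" where
  "L2 M = {f \<in> borel_measurable M. integrable M (\<lambda>x. (cmod (f x))\<^sup>2)}"

definition L2_inner :: "'a measure \<Rightarrow> ('a \<Rightarrow> complex) \<Rightarrow> ('a \<Rightarrow> complex) \<Rightarrow> complex" where
  "L2_inner M f h = (LINT x|M. f x * cnj (h x))"

definition L2_norm_sq :: "'a measure \<Rightarrow> ('a \<Rightarrow> complex) \<Rightarrow> real" where
  "L2_norm_sq M f = (LINT x|M. (cmod (f x))\<^sup>2)"

definition ell2 :: "('i \<Rightarrow> complex) set" where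
  "ell2 = {c. (\<lambda>j. (cmod (c j))\<^sup>2) summable_on UNIV}"

definition ell2_norm_sq :: "('i \<Rightarrow> complex) \<Rightarrow> real" where
  "ell2_norm_sq c = (\<Sum>\<^sub>\<infinity>j. (cmod (c j))\<^sup>2)"

definition riesz_sequence :: "'a measure \<Rightarrow> ('i \<Rightarrow> 'a \<Rightarrow> complex) \<Rightarrow> bool" where
  "riesz_sequence M f \<longleftrightarrow>
     (\<forall>j. f j \<in> L2 M) \<and>
     (\<exists>A>0. \<exists>B>0. \<forall>c. finite {j. c j \<noteq> 0} \<longrightarrow>
        A * ell2_norm_sq c \<le> L2_norm_sq M (\<lambda>x. \<Sum>j | c j \<noteq> 0. c j * f j x) \<and>
        L2_norm_sq M (\<lambda>x. \<Sum>j | c j \<noteq> 0. c j * f j x) \<le> B * ell2_norm_sq c)"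


type_synonym heis = "real \<times> real \<times> real"

fun heis_mult :: "heis \<Rightarrow> heis \<Rightarrow> heis" where
  "heis_mult (x, y, t) (x', y', t') = (x + x', y + y', t + t' + (x' * y - y' * x) / 2)"

fun heis_inv :: "heis \<Rightarrow> heis" where
  "heis_inv (x, y, t) = (- x, - y, - t)"

lemma heis_inv_left: "heis_mult (heis_inv p) p = (0, 0, 0)"
  by (cases p) simp

lemma heis_inv_right: "heis_mult p (heis_inv p) = (0, 0, 0)"
  by (cases p) simp

definition left_translate :: "heis \<Rightarrow> (heis \<Rightarrow> complex) \<Rightarrow> heis \<Rightarrow> complex" where
  "left_translate p f = (\<lambda>q. f (heis_mult (heis_inv p) q))"

(* F is f^lam as a function of lam and (x,y): the L^2 limit of the inverse Fourier integrals of f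
   in t, truncated to [-n,n]. Its values are determined for almost every lam, (x,y). *)

definition is_partial_ft :: "(heis \<Rightarrow> complex) \<Rightarrow> (real \<Rightarrow> real \<times> real \<Rightarrow> complex) \<Rightarrow> bool" where
  "is_partial_ft f F \<longleftrightarrow>
     (\<lambda>(x, y, lam). F lam (x, y)) \<in> L2 (lborel :: heis measure) \<and>
     (\<lambda>n. \<integral>\<^sup>+(x, y, lam). ennreal ((cmod (F lam (x, y)
            - (LINT t:{- real n..real n}|lborel. f (x, y, t) * cis (2 * pi * lam * t))))\<^sup>2)
          \<partial>(lborel :: heis measure)) \<longlonglongrightarrow> 0"

definition partial_ft :: "(heis \<Rightarrow> complex) \<Rightarrow> real \<Rightarrow> real \<times> real \<Rightarrow> complex" where
  "partial_ft f = (SOME F. is_partial_ft f F)"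

fun twisted_translate ::
    "real \<Rightarrow> real \<times> real \<Rightarrow> (real \<times> real \<Rightarrow> complex) \<Rightarrow> real \<times> real \<Rightarrow> complex" where
  "twisted_translate lam (u, v) F (x, y) = cis (pi * lam * (v * x - u * y)) * F (x - u, y - v)"


(* Operators on L^2(R) are represented as maps on representatives; their values are relevant
   only on L2 lborel and only up to null sets. *)

type_synonym l2op = "(real \<Rightarrow> complex) \<Rightarrow> real \<Rightarrow> complex"

definition bounded_l2op :: "l2op \<Rightarrow> bool" where
  "bounded_l2op T \<longleftrightarrow>
     (\<forall>\<phi>\<in>L2 lborel. T \<phi> \<in> L2 lborel) \<and>
     (\<forall>\<phi>\<in>L2 lborel. \<forall>\<psi>\<in>L2 lborel. \<forall>a b.
        AE \<xi> in lborel. T (\<lambda>x. a * \<phi> x + b * \<psi> x) \<xi> = a * T \<phi> \<xi> + b * T \<psi> \<xi>) \<and>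
     (\<exists>C. \<forall>\<phi>\<in>L2 lborel. L2_norm_sq lborel (T \<phi>) \<le> C * L2_norm_sq lborel \<phi>)"

definition orthonormal_basis :: "(nat \<Rightarrow> real \<Rightarrow> complex) \<Rightarrow> bool" where
  "orthonormal_basis e \<longleftrightarrow>
     (\<forall>j. e j \<in> L2 lborel) \<and>
     (\<forall>i j. L2_inner lborel (e i) (e j) = (if i = j then 1 else 0)) \<and>
     (\<forall>f\<in>L2 lborel. (\<forall>j. L2_inner lborel f (e j) = 0) \<longrightarrow> (AE x in lborel. f x = 0))"

(* The square of the Hilbert-Schmidt norm, tr (T T^* ) = sum_j ||T e_j||^2. For an operator on
   L^2(R) it does not depend on the basis; it is infinite if T is not Hilbert-Schmidt. *)

definition hs_norm_sq :: "l2op \<Rightarrow> ennreal" where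
  "hs_norm_sq T =
     (let e = (SOME e. orthonormal_basis e)
      in \<Sum>j. \<integral>\<^sup>+\<xi>. ennreal ((cmod (T (e j) \<xi>))\<^sup>2) \<partial>lborel)"

fun schroedinger :: "real \<Rightarrow> heis \<Rightarrow> l2op" where
  "schroedinger lam (x, y, t) \<phi> \<xi> =
     cis (2 * pi * lam * t) * cis (2 * pi * lam * (x * \<xi> + x * y / 2)) * \<phi> (\<xi> + y)"

(* The operator \<integral> F(x,y) schroedinger lam (x,y,0) dx dy, for integrable F. *)

definition weyl_integral :: "real \<Rightarrow> (real \<times> real \<Rightarrow> complex) \<Rightarrow> l2op" where
  "weyl_integral lam F \<phi> \<xi> = (LINT (x, y)|lborel. F (x, y) * schroedinger lam (x, y, 0) \<phi> \<xi>)"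

(* For lam \<noteq> 0 the Plancherel formula |lam| ||weyl_integral lam F||_HS^2 = ||F||^2 holds for F in the
   intersection of L^1 and L^2; T is the value at F of the continuous extension to L^2(R^2). *)

definition is_weyl_transform :: "real \<Rightarrow> (real \<times> real \<Rightarrow> complex) \<Rightarrow> l2op \<Rightarrow> bool" where
  "is_weyl_transform lam F T \<longleftrightarrow>
     F \<in> L2 lborel \<and> bounded_l2op T \<and>
     (\<exists>Fs. (\<forall>n. Fs n \<in> L2 lborel \<and> integrable lborel (Fs n)) \<and>
        (\<lambda>n. L2_norm_sq lborel (\<lambda>p. Fs n p - F p)) \<longlonglongrightarrow> 0 \<and>
        (\<lambda>n. hs_norm_sq (\<lambda>\<phi> \<xi>. weyl_integral lam (Fs n) \<phi> \<xi> - T \<phi> \<xi>)) \<longlonglongrightarrow> 0)"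

definition group_ft :: "(heis \<Rightarrow> complex) \<Rightarrow> real \<Rightarrow> l2op" where
  "group_ft f lam = (SOME T. is_weyl_transform lam (partial_ft f lam) T)"

definition tau :: "(heis \<Rightarrow> complex) \<Rightarrow> real \<Rightarrow> int \<Rightarrow> l2op" where
  "tau f lam r = (\<lambda>\<phi> \<xi>. complex_of_real (sqrt \<bar>lam - of_int r\<bar>) * group_ft f (lam - of_int r) \<phi> \<xi>)"

definition ell2_hs_norm_sq :: "(int \<Rightarrow> l2op) \<Rightarrow> ennreal" where
  "ell2_hs_norm_sq S = (\<Sum>\<^sub>\<infinity>r. hs_norm_sq (S r))"

(* H(lam) c is defined and equals S: the series over the pairs (k,l) converges unconditionally
   to S in the space of square-summable sequences of Hilbert-Schmidt operators. *)

definition has_synthesis ::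
    "(heis \<Rightarrow> complex) \<Rightarrow> real \<Rightarrow> (int \<times> int \<Rightarrow> complex) \<Rightarrow> (int \<Rightarrow> l2op) \<Rightarrow> bool" where
  "has_synthesis g lam c S \<longleftrightarrow>
     (\<forall>r. bounded_l2op (S r)) \<and> ell2_hs_norm_sq S < \<infinity> \<and>
     ((\<lambda>K. ell2_hs_norm_sq (\<lambda>r \<phi> \<xi>. S r \<phi> \<xi> -
         (\<Sum>(k, l)\<in>K. c (k, l) *
            tau (left_translate (2 * of_int k, of_int l, 0) g) lam r \<phi> \<xi>)))
       \<longlongrightarrow> 0) (finite_subsets_at_top UNIV)"

(* q is the value at c of the quadratic form of the Gramian G(lam) = H(lam)^* H(lam):
   <G(lam) c, c> = <H(lam) c, H(lam) c>. *)

definition has_gramian_form ::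
    "(heis \<Rightarrow> complex) \<Rightarrow> real \<Rightarrow> (int \<times> int \<Rightarrow> complex) \<Rightarrow> real \<Rightarrow> bool" where
  "has_gramian_form g lam c q \<longleftrightarrow>
     0 \<le> q \<and> (\<exists>S. has_synthesis g lam c S \<and> ell2_hs_norm_sq S = ennreal q)"

definition gramian_summand ::
    "(heis \<Rightarrow> complex) \<Rightarrow> real \<Rightarrow> (int \<times> int \<Rightarrow> complex) \<Rightarrow>
     int \<times> int \<Rightarrow> int \<times> int \<Rightarrow> int \<Rightarrow> complex" where
  "gramian_summand g lam c = (\<lambda>(k, l) (k', l') r.
     c (k, l) * cnj (c (k', l')) *
     cis (2 * pi * (lam - of_int r) * of_int (l * k' - k * l')) *
     L2_inner lborel
       (twisted_translate (lam - of_int r) (of_int (2 * (k - k')), of_int (l - l'))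
          (partial_ft g (lam - of_int r)))
       (partial_ft g (lam - of_int r)))"

(* The sum over (k,l), (k',l') and r of gramian_summand converges to q. For general
   square-summable c the sum over all four integers k, l, k', l' need not converge absolutely.
   As in <G c, c> = sum_(k',l') (G c)_(k',l') cnj (c (k',l')), it is an iterated sum: over r
   first, then over (k,l), then over (k',l'). *)

definition has_expanded_form ::
    "(heis \<Rightarrow> complex) \<Rightarrow> real \<Rightarrow> (int \<times> int \<Rightarrow> complex) \<Rightarrow> real \<Rightarrow> bool" where
  "has_expanded_form g lam c q \<longleftrightarrow>
     (\<exists>a d. (\<forall>j j'. (gramian_summand g lam c j j' has_sum a j j') UNIV) \<and>
        (\<forall>j'. ((\<lambda>j. a j j') has_sum d j') UNIV) \<and>
        (d has_sum complex_of_real q) UNIV)"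

end

theory Submission imports Defs begin

text \<open>
  The Fourier transform in the central variable \<open>t\<close> turns \<open>g\<close> into a field \<open>\<omega> \<mapsto> g\<^sup>\<omega>\<close> of functions on the
  plane. It is an isometry, it turns translation by \<open>(u, v, 0)\<close> into the twisted translation of each
  \<open>g\<^sup>\<omega>\<close>, and it turns translation by \<open>m\<close> in the centre into multiplication by the character \<open>exp (2 \<pi> i m \<omega>)\<close>
  (\<open>sqnorm_translate_combination\<close>). For integral \<open>m\<close> this character has period one, so the frequency
  axis can be folded onto \<open>(0, 1]\<close>. Over \<open>lam\<close> there is then the fibre of all square-summable families,
  indexed by \<open>r\<close>, of functions on the plane, and in it the vectors \<open>v\<^sub>j = (twisted translate of g at lam - r)\<^sub>r\<close>
  (\<open>fibre_translate\<close>). With \<open>P\<^sub>j (lam) = (\<Sum>m. c\<^sub>j\<^sub>m exp (2 \<pi> i m lam))\<close>, where \<open>j = (k, l)\<close>, the squared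
  norm of a finite combination of the translates of \<open>g\<close> is the integral over one period of \<open>\<parallel>\<Sum>P\<^sub>j (lam) v\<^sub>j\<parallel>\<^sup>2\<close> (\<open>sqnorm_translates_periodised\<close>).

  Uniform bounds of the form \<open>d \<mapsto> \<parallel>\<Sum>d\<^sub>j v\<^sub>j\<parallel>\<^sup>2\<close> in almost every fibre integrate to Riesz bounds. Conversely, Riesz
  bounds applied to coefficients \<open>d\<^sub>j b\<^sub>m\<close> bound the integrals of this form against the square of an arbitrary
  trigonometric polynomial. Such polynomials approximate indicator functions in the mean, which
  localises the bounds to almost every frequency (\<open>localise_bounds\<close>).

  It remains to see that the Gramian is the Gram operator of the vectors \<open>v\<^sub>j\<close>. The Weyl transform of \<open>F\<close> is an
  integral operator whose kernel is a partial Fourier transform of \<open>F\<close> in linearly changed coordinates whose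
  determinant has modulus \<open>|lam|\<close>. The Hilbert--Schmidt norm of an integral operator is the norm of its kernel, hence
  \<open>sqrt |lam|\<close> times the Weyl transform is an isometry (\<open>hs_norm_sq_weyl_lincomb\<close>). It maps \<open>v\<^sub>j\<close> to the image of the
  translate of \<open>g\<close> under \<open>\<tau>\<close>, so the synthesis \<open>H(lam) c\<close> exists exactly if \<open>\<Sum>c\<^sub>j v\<^sub>j\<close> converges unconditionally in the
  fibre, with equal norms (\<open>has_gramian_form_iff\<close>). The expanded form is the expansion of
  \<open>\<parallel>\<Sum>c\<^sub>j v\<^sub>j\<parallel>\<^sup>2\<close>, where the commutation rule of twisted translations reduces \<open>\<langle>v\<^sub>i, v\<^sub>j\<rangle>\<close> to a single
  translation and a phase (\<open>inner_twisted_translate\<close>).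

  The \<open>L\<^sup>2\<close> theory behind this rests on two facts: completeness (\<open>L2_complete\<close>), and totality of the
  exponentials on an interval (\<open>Fourier_coefficients_zero\<close>). Together they give Parseval's identity,
  a concrete orthonormal basis of \<open>L\<^sup>2(\<real>)\<close>, the density of trigonometric polynomials, and, by integrating
  Parseval's identity over the modulations of a function of bounded support, the Plancherel theorem.
\<close>

section \<open>Square-integrable functions\<close>

text \<open>The squared norm with values in \<open>[0, \<infinity>]\<close>. Unlike \<open>L2_norm_sq\<close>, which is \<open>0\<close> if the integral
  diverges, it satisfies Tonelli's theorem and Fatou's lemma without an integrability hypothesis.\<close>

definition sqnorm :: "'a measure \<Rightarrow> ('a \<Rightarrow> complex) \<Rightarrow> ennreal" where
  "sqnorm M f = (\<integral>\<^sup>+x. ennreal ((cmod (f x))\<^sup>2) \<partial>M)"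

lemma borel_measurable_cnj [measurable]: "cnj \<in> borel_measurable borel"
  by (intro borel_measurable_continuous_onI continuous_intros)

lemma L2_iff: "f \<in> L2 M \<longleftrightarrow> f \<in> borel_measurable M \<and> sqnorm M f < \<infinity>"
  unfolding L2_def sqnorm_def by (auto simp: integrable_iff_bounded)

lemma L2_measurable: "f \<in> L2 M \<Longrightarrow> f \<in> borel_measurable M"
  by (simp add: L2_def)

lemma L2_norm_sq_conv: "f \<in> borel_measurable M \<Longrightarrow> L2_norm_sq M f = enn2real (sqnorm M f)"
  unfolding L2_norm_sq_def sqnorm_def by (subst integral_eq_nn_integral) auto

lemma L2_norm_sq_nonneg: "0 \<le> L2_norm_sq M f"
  unfolding L2_norm_sq_def by simp

lemma sqnorm_conv: "f \<in> L2 M \<Longrightarrow> sqnorm M f = ennreal (L2_norm_sq M f)"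
  by (simp add: L2_norm_sq_conv L2_iff)

lemma sqnorm_cong_AE: "AE x in M. f x = g x \<Longrightarrow> sqnorm M f = sqnorm M g"
  unfolding sqnorm_def by (rule nn_integral_cong_AE) auto

lemma sqnorm_cong: "(\<And>x. x \<in> space M \<Longrightarrow> f x = g x) \<Longrightarrow> sqnorm M f = sqnorm M g"
  unfolding sqnorm_def by (rule nn_integral_cong) auto

lemma sqnorm_zero [simp]: "sqnorm M (\<lambda>x. 0) = 0"
  by (simp add: sqnorm_def)

lemma sqnorm_eq_0_iff: "f \<in> borel_measurable M \<Longrightarrow> sqnorm M f = 0 \<longleftrightarrow> (AE x in M. f x = 0)"
  unfolding sqnorm_def by (subst nn_integral_0_iff_AE) (auto simp: ennreal_eq_0_iff)

lemma sqnorm_cmult: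
  assumes [measurable]: "f \<in> borel_measurable M"
  shows "sqnorm M (\<lambda>x. c * f x) = ennreal ((cmod c)\<^sup>2) * sqnorm M f"
  unfolding sqnorm_def
  by (subst nn_integral_cmult[symmetric]) (auto simp: norm_mult power_mult_distrib ennreal_mult)

lemma norm_add_sq_le: "(norm (x + y))\<^sup>2 \<le> 2 * (norm x)\<^sup>2 + 2 * (norm (y :: 'a :: real_normed_vector))\<^sup>2"
proof -
  have "(norm (x + y))\<^sup>2 \<le> (norm x + norm y)\<^sup>2"
    by (intro power_mono norm_triangle_ineq) auto
  also have "\<dots> \<le> 2 * (norm x)\<^sup>2 + 2 * (norm y)\<^sup>2"
    using sum_squares_bound[of "norm x" "norm y"] by (simp add: power2_sum)
  finally show ?thesis .
qed

lemma sqnorm_add_le: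
  assumes [measurable]: "f \<in> borel_measurable M" "g \<in> borel_measurable M"
  shows "sqnorm M (\<lambda>x. f x + g x) \<le> 2 * sqnorm M f + 2 * sqnorm M g"
proof -
  have "sqnorm M (\<lambda>x. f x + g x)
      \<le> (\<integral>\<^sup>+x. 2 * ennreal ((cmod (f x))\<^sup>2) + 2 * ennreal ((cmod (g x))\<^sup>2) \<partial>M)"
    unfolding sqnorm_def
  proof (intro nn_integral_mono)
    fix x
    have "ennreal ((cmod (f x + g x))\<^sup>2) \<le> ennreal (2 * (cmod (f x))\<^sup>2 + 2 * (cmod (g x))\<^sup>2)"
      by (intro ennreal_leI norm_add_sq_le)
    also have "\<dots> = 2 * ennreal ((cmod (f x))\<^sup>2) + 2 * ennreal ((cmod (g x))\<^sup>2)"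
      by (simp add: ennreal_mult ennreal_plus)
    finally show "ennreal ((cmod (f x + g x))\<^sup>2) \<le> \<dots>" .
  qed
  also have "\<dots> = 2 * sqnorm M f + 2 * sqnorm M g"
    unfolding sqnorm_def by (simp add: nn_integral_add nn_integral_cmult)
  finally show ?thesis .
qed

lemma sqnorm_diff_le:
  assumes [measurable]: "f \<in> borel_measurable M" "g \<in> borel_measurable M"
  shows "sqnorm M (\<lambda>x. f x - g x) \<le> 2 * sqnorm M f + 2 * sqnorm M g"
proof -
  have "sqnorm M (\<lambda>x. - g x) = sqnorm M g"
    by (simp add: sqnorm_def)
  then show ?thesis
    using sqnorm_add_le[of f M "\<lambda>x. - g x"] by simp
qed

lemma sqnorm_diff_triangle:
  assumes "f \<in> borel_measurable M" "g \<in> borel_measurable M" "h \<in> borel_measurable M"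
  shows "sqnorm M (\<lambda>x. f x - h x) \<le> 2 * sqnorm M (\<lambda>x. f x - g x) + 2 * sqnorm M (\<lambda>x. g x - h x)"
  using sqnorm_add_le[of "\<lambda>x. f x - g x" M "\<lambda>x. g x - h x"] assms by simp

lemma sqnorm_diff_commute: "sqnorm M (\<lambda>x. f x - g x) = sqnorm M (\<lambda>x. g x - f x)"
  by (simp add: sqnorm_def norm_minus_commute)

lemma L2_zero [simp]: "(\<lambda>x. 0) \<in> L2 M"
  by (simp add: L2_iff)

lemma L2_add: "f \<in> L2 M \<Longrightarrow> g \<in> L2 M \<Longrightarrow> (\<lambda>x. f x + g x) \<in> L2 M"
  using sqnorm_add_le[of f M g]
  by (auto simp: L2_iff ennreal_mult_less_top ennreal_mult_eq_top_iff less_top[symmetric] top_unique)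

lemma L2_diff: "f \<in> L2 M \<Longrightarrow> g \<in> L2 M \<Longrightarrow> (\<lambda>x. f x - g x) \<in> L2 M"
  using sqnorm_diff_le[of f M g]
  by (auto simp: L2_iff ennreal_mult_less_top ennreal_mult_eq_top_iff less_top[symmetric] top_unique)

lemma L2_cmult: "f \<in> L2 M \<Longrightarrow> (\<lambda>x. c * f x) \<in> L2 M"
  using sqnorm_cmult[of f M c] by (auto simp: L2_iff ennreal_mult_less_top)

lemma L2_sum: "(\<And>i. i \<in> I \<Longrightarrow> f i \<in> L2 M) \<Longrightarrow> (\<lambda>x. \<Sum>i\<in>I. f i x) \<in> L2 M"
  by (induction I rule: infinite_finite_induct) (auto intro: L2_add)

lemma L2_dominated:
  assumes "f \<in> borel_measurable M" "g \<in> L2 M" "AE x in M. cmod (f x) \<le> cmod (g x)"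
  shows "f \<in> L2 M"
proof -
  have "sqnorm M f \<le> sqnorm M g"
    unfolding sqnorm_def using assms(3)
    by (intro nn_integral_mono_AE) (auto intro!: ennreal_leI power_mono)
  then show ?thesis
    using assms by (auto simp: L2_iff)
qed

lemma L2_cnj: "f \<in> L2 M \<Longrightarrow> (\<lambda>x. cnj (f x)) \<in> L2 M"
  by (auto simp: L2_iff sqnorm_def)

text \<open>Integrability of \<open>f * cnj g\<close> and the bound on its integral both come from the
  Cauchy--Schwarz inequality for nonnegative integrals.\<close>

lemma L2_nn_integral_mult:
  assumes "f \<in> borel_measurable M" "g \<in> borel_measurable M"
  shows "(\<integral>\<^sup>+x. ennreal (cmod (f x * cnj (g x))) \<partial>M)\<^sup>2 \<le> sqnorm M f * sqnorm M g"
proof -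
  have [measurable]: "f \<in> borel_measurable M" "g \<in> borel_measurable M"
    using assms by (auto simp: L2_measurable)
  have "(\<integral>\<^sup>+x. ennreal (cmod (f x)) * ennreal (cmod (g x)) \<partial>M)\<^sup>2
      \<le> (\<integral>\<^sup>+x. (ennreal (cmod (f x)))\<^sup>2 \<partial>M) * (\<integral>\<^sup>+x. (ennreal (cmod (g x)))\<^sup>2 \<partial>M)"
    by (rule Cauchy_Schwarz_nn_integral) auto
  then show ?thesis
    by (simp add: sqnorm_def norm_mult ennreal_mult ennreal_power)
qed

lemma L2_integrable_mult:
  assumes "f \<in> L2 M" "g \<in> L2 M"
  shows "integrable M (\<lambda>x. f x * cnj (g x))"
proof -
  have [measurable]: "f \<in> borel_measurable M" "g \<in> borel_measurable M"
    using assms by (auto simp: L2_measurable)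
  have "(\<integral>\<^sup>+x. ennreal (cmod (f x * cnj (g x))) \<partial>M)\<^sup>2 < \<infinity>"
    using L2_nn_integral_mult[of f M g] assms
    by (auto simp: L2_iff ennreal_mult_less_top intro: le_less_trans)
  then show ?thesis
    by (auto simp: integrable_iff_bounded power2_eq_square ennreal_mult_less_top)
qed

lemma L2_inner_Cauchy_Schwarz:
  assumes "f \<in> L2 M" "g \<in> L2 M"
  shows "(cmod (L2_inner M f g))\<^sup>2 \<le> L2_norm_sq M f * L2_norm_sq M g"
proof -
  have int: "integrable M (\<lambda>x. f x * cnj (g x))"
    by (rule L2_integrable_mult[OF assms])
  have "ennreal (cmod (L2_inner M f g)) \<le> (\<integral>\<^sup>+x. ennreal (cmod (f x * cnj (g x))) \<partial>M)"
    unfolding L2_inner_def by (rule integral_norm_bound_ennreal[OF int])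
  then have "(ennreal (cmod (L2_inner M f g)))\<^sup>2 \<le> (\<integral>\<^sup>+x. ennreal (cmod (f x * cnj (g x))) \<partial>M)\<^sup>2"
    by (rule power_mono) simp
  also have "\<dots> \<le> sqnorm M f * sqnorm M g"
    using assms by (intro L2_nn_integral_mult L2_measurable)
  also have "\<dots> = ennreal (L2_norm_sq M f * L2_norm_sq M g)"
    using assms by (simp add: sqnorm_conv ennreal_mult L2_norm_sq_nonneg)
  finally show ?thesis
    by (simp add: ennreal_power L2_norm_sq_nonneg)
qed

lemma L2_inner_add_left:
  assumes "f \<in> L2 M" "g \<in> L2 M" "h \<in> L2 M"
  shows "L2_inner M (\<lambda>x. f x + g x) h = L2_inner M f h + L2_inner M g h"
  unfolding L2_inner_def using L2_integrable_mult[of f M h] L2_integrable_mult[of g M h] assms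
  by (simp add: distrib_right)

lemma L2_inner_diff_left:
  assumes "f \<in> L2 M" "g \<in> L2 M" "h \<in> L2 M"
  shows "L2_inner M (\<lambda>x. f x - g x) h = L2_inner M f h - L2_inner M g h"
  unfolding L2_inner_def using L2_integrable_mult[of f M h] L2_integrable_mult[of g M h] assms
  by (simp add: left_diff_distrib)

lemma L2_inner_cmult_left: "L2_inner M (\<lambda>x. c * f x) h = c * L2_inner M f h"
  unfolding L2_inner_def by (simp add: mult.assoc)

lemma L2_inner_commute: "L2_inner M g f = cnj (L2_inner M f g)"
  unfolding L2_inner_def using Bochner_Integration.integral_cnj[of M "\<lambda>x. f x * cnj (g x)"] by (simp add: mult.commute)

lemma L2_inner_cmult_right: "L2_inner M f (\<lambda>x. c * h x) = cnj c * L2_inner M f h"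
  using L2_inner_cmult_left[of M c h f] L2_inner_commute[of M f "\<lambda>x. c * h x"]
    L2_inner_commute[of M h f] by simp

lemma L2_inner_zero_left [simp]: "L2_inner M (\<lambda>x. 0) h = 0"
  by (simp add: L2_inner_def)

lemma L2_inner_sum_left:
  assumes "\<And>i. i \<in> I \<Longrightarrow> f i \<in> L2 M" "h \<in> L2 M"
  shows "L2_inner M (\<lambda>x. \<Sum>i\<in>I. f i x) h = (\<Sum>i\<in>I. L2_inner M (f i) h)"
  using assms(1)
  by (induction I rule: infinite_finite_induct)
     (auto simp: L2_inner_add_left L2_sum assms(2))

lemma L2_inner_add_right:
  assumes "f \<in> L2 M" "g \<in> L2 M" "h \<in> L2 M"
  shows "L2_inner M h (\<lambda>x. f x + g x) = L2_inner M h f + L2_inner M h g"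
  using L2_inner_add_left[OF assms] L2_inner_commute[of M h] by (metis complex_cnj_add)

lemma L2_inner_sum_right:
  assumes "\<And>i. i \<in> I \<Longrightarrow> f i \<in> L2 M" "h \<in> L2 M"
  shows "L2_inner M h (\<lambda>x. \<Sum>i\<in>I. f i x) = (\<Sum>i\<in>I. L2_inner M h (f i))"
  using L2_inner_sum_left[of I f M h, OF assms] L2_inner_commute[of M h] by (simp add: cnj_sum)

lemma L2_inner_self: "L2_inner M f f = complex_of_real (L2_norm_sq M f)"
  unfolding L2_inner_def L2_norm_sq_def
  by (simp add: complex_norm_square[symmetric] del: of_real_power flip: integral_complex_of_real)

lemma L2_norm_sq_cmult: "L2_norm_sq M (\<lambda>x. c * f x) = (cmod c)\<^sup>2 * L2_norm_sq M f"
  unfolding L2_norm_sq_def by (simp add: norm_mult power_mult_distrib)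

lemma L2_norm_sq_zero [simp]: "L2_norm_sq M (\<lambda>x. 0) = 0"
  by (simp add: L2_norm_sq_def)

lemma L2_norm_sq_diff_commute: "L2_norm_sq M (\<lambda>x. f x - g x) = L2_norm_sq M (\<lambda>x. g x - f x)"
  by (simp add: L2_norm_sq_def norm_minus_commute)

lemma L2_norm_sq_cong_AE:
  "AE x in M. f x = g x \<Longrightarrow> f \<in> borel_measurable M \<Longrightarrow> g \<in> borel_measurable M
    \<Longrightarrow> L2_norm_sq M f = L2_norm_sq M g"
  by (simp add: L2_norm_sq_conv cong: sqnorm_cong_AE)

lemma L2_norm_sq_add:
  assumes "f \<in> L2 M" "g \<in> L2 M"
  shows "L2_norm_sq M (\<lambda>x. f x + g x) = L2_norm_sq M f + L2_norm_sq M g + 2 * Re (L2_inner M f g)"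
proof -
  have "complex_of_real (L2_norm_sq M (\<lambda>x. f x + g x))
     = of_real (L2_norm_sq M f) + of_real (L2_norm_sq M g) + (L2_inner M f g + cnj (L2_inner M f g))"
    using assms
    by (simp add: L2_inner_self[symmetric] L2_inner_add_left L2_inner_add_right L2_add
                  L2_inner_commute[of M g f])
  also have "\<dots> = of_real (L2_norm_sq M f + L2_norm_sq M g + 2 * Re (L2_inner M f g))"
    by (simp add: complex_add_cnj)
  finally show ?thesis
    using of_real_eq_iff by blast
qed

lemma L2_norm_sq_diff:
  assumes "f \<in> L2 M" "g \<in> L2 M"
  shows "L2_norm_sq M (\<lambda>x. f x - g x) = L2_norm_sq M f + L2_norm_sq M g - 2 * Re (L2_inner M f g)"
  using L2_norm_sq_add[OF assms(1) L2_cmult[OF assms(2), of "-1"]]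
  by (simp only: L2_inner_cmult_right L2_norm_sq_cmult) simp

lemma L2_norm_triangle:
  assumes "f \<in> L2 M" "g \<in> L2 M"
  shows "sqrt (L2_norm_sq M (\<lambda>x. f x + g x)) \<le> sqrt (L2_norm_sq M f) + sqrt (L2_norm_sq M g)"
proof (rule real_le_lsqrt)
  have "cmod (L2_inner M f g) \<le> sqrt (L2_norm_sq M f * L2_norm_sq M g)"
    by (rule real_le_rsqrt[OF L2_inner_Cauchy_Schwarz[OF assms]])
  then have "Re (L2_inner M f g) \<le> sqrt (L2_norm_sq M f) * sqrt (L2_norm_sq M g)"
    using complex_Re_le_cmod[of "L2_inner M f g"] by (simp add: real_sqrt_mult)
  then show "L2_norm_sq M (\<lambda>x. f x + g x) \<le> (sqrt (L2_norm_sq M f) + sqrt (L2_norm_sq M g))\<^sup>2"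
    by (simp add: L2_norm_sq_add[OF assms] power2_sum L2_norm_sq_nonneg)
qed (simp_all add: L2_norm_sq_nonneg)

lemma L2_norm_triangle_diff:
  assumes "f \<in> L2 M" "g \<in> L2 M"
  shows "\<bar>sqrt (L2_norm_sq M f) - sqrt (L2_norm_sq M g)\<bar> \<le> sqrt (L2_norm_sq M (\<lambda>x. f x - g x))"
  using L2_norm_triangle[OF L2_diff[OF assms] assms(2)]
    L2_norm_triangle[OF L2_diff[OF assms(2) assms(1)] assms(1)]
  by (simp add: L2_norm_sq_diff_commute[of M g f])

lemma tendsto_L2_inner:
  assumes "\<And>i. f i \<in> L2 M" "f' \<in> L2 M" "h \<in> L2 M"
    and lim: "((\<lambda>i. L2_norm_sq M (\<lambda>x. f i x - f' x)) \<longlongrightarrow> 0) F"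
  shows "((\<lambda>i. L2_inner M (f i) h) \<longlongrightarrow> L2_inner M f' h) F"
proof -
  have "((\<lambda>i. sqrt (L2_norm_sq M (\<lambda>x. f i x - f' x) * L2_norm_sq M h)) \<longlongrightarrow> sqrt (0 * L2_norm_sq M h)) F"
    by (intro tendsto_intros lim)
  then have lim': "((\<lambda>i. sqrt (L2_norm_sq M (\<lambda>x. f i x - f' x) * L2_norm_sq M h)) \<longlongrightarrow> 0) F"
    by simp
  have "cmod (L2_inner M (f i) h - L2_inner M f' h)
      \<le> sqrt (L2_norm_sq M (\<lambda>x. f i x - f' x) * L2_norm_sq M h)" for i
    using L2_inner_Cauchy_Schwarz[OF L2_diff[OF assms(1) assms(2)] assms(3), of i] assms
    by (intro real_le_rsqrt) (simp add: L2_inner_diff_left)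
  then have "((\<lambda>i. L2_inner M (f i) h - L2_inner M f' h) \<longlongrightarrow> 0) F"
    by (intro Lim_null_comparison[OF _ lim'] always_eventually) auto
  then show ?thesis
    by (simp add: LIM_zero_iff)
qed

lemma tendsto_L2_norm_sq:
  assumes "\<And>i. f i \<in> L2 M" "f' \<in> L2 M"
    and lim: "((\<lambda>i. L2_norm_sq M (\<lambda>x. f i x - f' x)) \<longlongrightarrow> 0) F"
  shows "((\<lambda>i. L2_norm_sq M (f i)) \<longlongrightarrow> L2_norm_sq M f') F"
proof -
  have "((\<lambda>i. sqrt (L2_norm_sq M (\<lambda>x. f i x - f' x))) \<longlongrightarrow> sqrt 0) F"
    by (intro tendsto_intros lim)
  then have lim': "((\<lambda>i. sqrt (L2_norm_sq M (\<lambda>x. f i x - f' x))) \<longlongrightarrow> 0) F"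
    by simp
  have "((\<lambda>i. sqrt (L2_norm_sq M (f i)) - sqrt (L2_norm_sq M f')) \<longlongrightarrow> 0) F"
    using L2_norm_triangle_diff[OF assms(1) assms(2)]
    by (intro Lim_null_comparison[OF _ lim'] always_eventually) auto
  then have "((\<lambda>i. (sqrt (L2_norm_sq M (f i)))\<^sup>2) \<longlongrightarrow> (sqrt (L2_norm_sq M f'))\<^sup>2) F"
    by (intro tendsto_power) (simp add: LIM_zero_iff)
  then show ?thesis
    by (simp add: L2_norm_sq_nonneg)
qed

lemma sqnorm_tendsto_0_iff:
  assumes "\<And>i. f i \<in> L2 M"
  shows "((\<lambda>i. sqnorm M (f i)) \<longlongrightarrow> 0) F \<longleftrightarrow> ((\<lambda>i. L2_norm_sq M (f i)) \<longlongrightarrow> 0) F"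
  using tendsto_ennreal_iff[of "\<lambda>i. L2_norm_sq M (f i)" F 0]
  by (auto simp: sqnorm_conv[OF assms] L2_norm_sq_nonneg)

lemma L2_AE_subseq:
  fixes f :: "nat \<Rightarrow> 'a \<Rightarrow> complex"
  assumes "\<And>i. f i \<in> L2 M" "f' \<in> L2 M"
    and lim: "(\<lambda>i. L2_norm_sq M (\<lambda>x. f i x - f' x)) \<longlonglongrightarrow> 0"
  obtains r where "strict_mono r" "AE x in M. (\<lambda>i. f (r i) x) \<longlonglongrightarrow> f' x"
proof -
  have "\<exists>r. strict_mono r \<and> (AE x in M. (\<lambda>i. (cmod (f (r i) x - f' x))\<^sup>2) \<longlonglongrightarrow> 0)"
  proof (rule tendsto_L1_AE_subseq)
    show "integrable M (\<lambda>x. (cmod (f n x - f' x))\<^sup>2)" for n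
      using L2_diff[OF assms(1) assms(2), of n] by (simp add: L2_def)
    show "(\<lambda>n. \<integral>x. norm ((cmod (f n x - f' x))\<^sup>2) \<partial>M) \<longlonglongrightarrow> 0"
      using lim by (simp add: L2_norm_sq_def)
  qed
  then obtain r where r: "strict_mono r" "AE x in M. (\<lambda>i. (cmod (f (r i) x - f' x))\<^sup>2) \<longlonglongrightarrow> 0"
    by blast
  have "AE x in M. (\<lambda>i. f (r i) x) \<longlonglongrightarrow> f' x"
    using r(2)
  proof eventually_elim
    case (elim x)
    then have "(\<lambda>i. sqrt ((cmod (f (r i) x - f' x))\<^sup>2)) \<longlonglongrightarrow> sqrt 0"
      by (intro tendsto_intros)
    then have "(\<lambda>i. f (r i) x - f' x) \<longlonglongrightarrow> 0"
      by (simp add: tendsto_norm_zero_iff)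
    then show ?case
      by (simp add: LIM_zero_iff)
  qed
  with r(1) show thesis ..
qed

text \<open>Riesz--Fischer. Along a subsequence with \<open>\<parallel>f (r (Suc k)) - f (r k)\<parallel>\<^sup>2 \<le> 4 ^ (- k)\<close> the weighted
  sum \<open>\<Sum>k. 2 ^ k * |f (r (Suc k)) - f (r k)|\<^sup>2\<close> has a finite integral, hence is finite almost
  everywhere; this forces geometric decay of the increments and so pointwise convergence.
  Fatou's lemma turns the pointwise limit into a limit in the mean.\<close>

theorem L2_complete:
  fixes f :: "nat \<Rightarrow> 'a \<Rightarrow> complex"
  assumes L2: "\<And>n. f n \<in> L2 M"
    and Cauchy: "\<And>e. e > 0 \<Longrightarrow> \<exists>N. \<forall>m\<ge>N. \<forall>n\<ge>N. L2_norm_sq M (\<lambda>x. f m x - f n x) < e"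
  obtains f' where "f' \<in> L2 M" "(\<lambda>n. L2_norm_sq M (\<lambda>x. f n x - f' x)) \<longlonglongrightarrow> 0"
proof -
  have [measurable]: "f n \<in> borel_measurable M" for n
    using L2 by (rule L2_measurable)
  have "\<exists>r. strict_mono r \<and> (\<forall>k. \<forall>m\<ge>r k. \<forall>n\<ge>r k. L2_norm_sq M (\<lambda>x. f m x - f n x) < (1/4) ^ k)"
  proof -
    have ex: "\<exists>N. N > p \<and> (\<forall>m\<ge>N. \<forall>n\<ge>N. L2_norm_sq M (\<lambda>x. f m x - f n x) < (1/4) ^ k)" for k p
    proof -
      obtain N where "\<forall>m\<ge>N. \<forall>n\<ge>N. L2_norm_sq M (\<lambda>x. f m x - f n x) < (1/4) ^ k"
        using Cauchy[of "(1/4) ^ k"] by auto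
      then show ?thesis
        by (intro exI[of _ "max N (Suc p)"]) auto
    qed
    have "\<exists>r. \<forall>k. (\<forall>m\<ge>r k. \<forall>n\<ge>r k. L2_norm_sq M (\<lambda>x. f m x - f n x) < (1/4) ^ k) \<and> r k < r (Suc k)"
      using ex by (intro dependent_nat_choice) (blast, metis)
    then show ?thesis
      by (auto simp: strict_mono_Suc_iff)
  qed
  then obtain r where r: "strict_mono r"
    and rC: "\<And>k m n. m \<ge> r k \<Longrightarrow> n \<ge> r k \<Longrightarrow> L2_norm_sq M (\<lambda>x. f m x - f n x) < (1/4) ^ k"
    by blast
  define d where "d k x = f (r (Suc k)) x - f (r k) x" for k x
  have [measurable]: "d k \<in> borel_measurable M" for k
    unfolding d_def by simp
  have dL2: "d k \<in> L2 M" for k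
    unfolding d_def by (intro L2_diff L2)
  have "(\<integral>\<^sup>+x. (\<Sum>k. ennreal (2 ^ k * (cmod (d k x))\<^sup>2)) \<partial>M) = (\<Sum>k. \<integral>\<^sup>+x. ennreal (2 ^ k * (cmod (d k x))\<^sup>2) \<partial>M)"
    by (rule nn_integral_suminf) simp
  also have "\<dots> = (\<Sum>k. ennreal (2 ^ k * L2_norm_sq M (d k)))"
    by (simp add: ennreal_mult nn_integral_cmult sqnorm_def[symmetric] sqnorm_conv[OF dL2] L2_norm_sq_nonneg)
  also have "\<dots> \<le> (\<Sum>k. ennreal ((1/2) ^ k))"
  proof (intro suminf_le ennreal_leI)
    fix k
    have "2 ^ k * L2_norm_sq M (d k) \<le> 2 ^ k * (1/4) ^ k"
      unfolding d_def using rC[of k "r (Suc k)" "r k"] r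
      by (intro mult_left_mono less_imp_le) (auto simp: strict_mono_less_eq)
    also have "\<dots> = (1/2) ^ k"
      by (simp flip: power_mult_distrib)
    finally show "2 ^ k * L2_norm_sq M (d k) \<le> (1/2) ^ k" .
  qed auto
  also have "\<dots> < \<infinity>"
    by (subst suminf_ennreal2) (auto intro: summable_geometric)
  finally have "AE x in M. (\<Sum>k. ennreal (2 ^ k * (cmod (d k x))\<^sup>2)) \<noteq> \<infinity>"
    by (intro nn_integral_PInf_AE) auto
  then have conv: "AE x in M. convergent (\<lambda>k. f (r k) x)"
  proof eventually_elim
    case (elim x)
    then have sm: "summable (\<lambda>k. 2 ^ k * (cmod (d k x))\<^sup>2)"
      by (intro summable_suminf_not_top) auto
    then obtain C where C: "\<And>k. 2 ^ k * (cmod (d k x))\<^sup>2 \<le> C"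
      using summable_imp_Bseq[OF sm] by (auto simp: Bseq_def)
    have C0: "C \<ge> 0"
      using C[of 0] by (meson order_trans zero_le_mult_iff zero_le_power zero_le_power2 zero_le_numeral)
    have bound: "norm (d k x) \<le> sqrt C * (sqrt (1/2)) ^ k" for k
    proof (rule power2_le_imp_le)
      have "(cmod (d k x))\<^sup>2 = (1/2) ^ k * (2 ^ k * (cmod (d k x))\<^sup>2)"
        by (simp add: power_divide)
      also have "\<dots> \<le> (1/2) ^ k * C"
        by (intro mult_left_mono C) auto
      also have "\<dots> = (sqrt C * (sqrt (1/2)) ^ k)\<^sup>2"
        using C0 by (simp add: power_mult_distrib flip: power_mult)
          (simp add: power_mult mult.commute[of k 2] real_sqrt_divide power_divide)
      finally show "(norm (d k x))\<^sup>2 \<le> (sqrt C * (sqrt (1/2)) ^ k)\<^sup>2" .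
    qed (simp add: C0)
    have "summable (\<lambda>k. d k x)"
      by (rule summable_comparison_test'[OF _ bound])
         (intro summable_mult summable_geometric, simp add: real_sqrt_divide)
    then have "convergent (\<lambda>n. \<Sum>k<n. d k x)"
      by (simp add: summable_iff_convergent)
    then have "convergent (\<lambda>n. f (r n) x - f (r 0) x)"
      unfolding d_def by (subst (asm) sum_lessThan_telescope)
    then show ?case
      using convergent_add_const_iff[of "- f (r 0) x" "\<lambda>n. f (r n) x"] by simp
  qed
  define f' where "f' x = lim (\<lambda>k. f (r k) x)" for x
  have [measurable]: "f' \<in> borel_measurable M"
    unfolding f'_def by (rule borel_measurable_lim_metric) simp
  have lim: "AE x in M. (\<lambda>k. f (r k) x) \<longlonglongrightarrow> f' x"
    using conv by eventually_elim (simp add: f'_def convergent_LIMSEQ_iff)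
  have Fatou: "sqnorm M (\<lambda>x. f n x - f' x) \<le> ennreal ((1/4) ^ k)" if "n \<ge> r k" for n k
  proof -
    have "sqnorm M (\<lambda>x. f n x - f' x) \<le> (\<integral>\<^sup>+x. liminf (\<lambda>j. ennreal ((cmod (f n x - f (r j) x))\<^sup>2)) \<partial>M)"
      unfolding sqnorm_def
    proof (intro nn_integral_mono_AE, use lim in eventually_elim)
      case (elim x)
      have "(\<lambda>j. ennreal ((cmod (f n x - f (r j) x))\<^sup>2)) \<longlonglongrightarrow> ennreal ((cmod (f n x - f' x))\<^sup>2)"
        by (intro tendsto_intros elim)
      from lim_imp_Liminf[OF trivial_limit_sequentially this] show ?case
        by simp
    qed
    also have "\<dots> \<le> liminf (\<lambda>j. sqnorm M (\<lambda>x. f n x - f (r j) x))"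
      unfolding sqnorm_def by (rule nn_integral_liminf) simp
    also have "\<dots> \<le> ennreal ((1/4) ^ k)"
    proof (rule Liminf_le)
      show "\<forall>\<^sub>F j in sequentially. sqnorm M (\<lambda>x. f n x - f (r j) x) \<le> ennreal ((1/4) ^ k)"
        using eventually_ge_at_top[of k]
      proof eventually_elim
        case (elim j)
        then show ?case
          using rC[of k n "r j"] that r by (simp add: sqnorm_conv[OF L2_diff[OF L2 L2]] strict_mono_less_eq)
      qed
    qed simp
    finally show ?thesis .
  qed
  have "(\<lambda>x. f (r 0) x - f' x) \<in> L2 M"
    using Fatou[of 0 "r 0"] by (auto simp: L2_iff intro: le_less_trans)
  from L2_diff[OF L2[of "r 0"] this] have f'L2: "f' \<in> L2 M"
    by simp
  have "(\<lambda>n. L2_norm_sq M (\<lambda>x. f n x - f' x)) \<longlonglongrightarrow> 0"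
  proof (rule LIMSEQ_I)
    fix e :: real assume "e > 0"
    then obtain k where k: "(1/4) ^ k < e"
      using real_arch_pow_inv[of e "1/4"] by auto
    have "norm (L2_norm_sq M (\<lambda>x. f n x - f' x) - 0) < e" if "n \<ge> r k" for n
      using Fatou[OF that] k by (simp add: sqnorm_conv[OF L2_diff[OF L2 f'L2]] L2_norm_sq_nonneg)
    then show "\<exists>n0. \<forall>n\<ge>n0. norm (L2_norm_sq M (\<lambda>x. f n x - f' x) - 0) < e"
      by blast
  qed
  with f'L2 show thesis ..
qed

lemma L2_norm_sq_diff_triangle:
  assumes "f \<in> L2 M" "g \<in> L2 M" "h \<in> L2 M"
  shows "L2_norm_sq M (\<lambda>x. f x - h x)
    \<le> 2 * L2_norm_sq M (\<lambda>x. f x - g x) + 2 * L2_norm_sq M (\<lambda>x. g x - h x)"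
proof -
  have "ennreal (L2_norm_sq M (\<lambda>x. f x - h x))
    \<le> 2 * ennreal (L2_norm_sq M (\<lambda>x. f x - g x)) + 2 * ennreal (L2_norm_sq M (\<lambda>x. g x - h x))"
    using sqnorm_diff_triangle[of f M g h] assms
    by (simp add: sqnorm_conv L2_diff L2_measurable)
  also have "\<dots> = ennreal (2 * L2_norm_sq M (\<lambda>x. f x - g x) + 2 * L2_norm_sq M (\<lambda>x. g x - h x))"
    by (simp add: ennreal_mult ennreal_plus L2_norm_sq_nonneg)
  finally show ?thesis
    by (subst (asm) ennreal_le_iff) (auto simp: L2_norm_sq_nonneg)
qed

section \<open>Orthonormal systems and unconditional sums\<close>

lemma L2_norm_sq_lincomb:
  assumes "\<And>i. i \<in> I \<Longrightarrow> e i \<in> L2 M"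
    and "\<And>i j. i \<in> I \<Longrightarrow> j \<in> I \<Longrightarrow> L2_inner M (e i) (e j) = (if i = j then 1 else 0)"
  shows "L2_norm_sq M (\<lambda>x. \<Sum>i\<in>I. c i * e i x) = (\<Sum>i\<in>I. (cmod (c i))\<^sup>2)"
proof (cases "finite I")
  case True
  have "complex_of_real (L2_norm_sq M (\<lambda>x. \<Sum>i\<in>I. c i * e i x))
      = (\<Sum>i\<in>I. \<Sum>j\<in>I. c i * cnj (c j) * L2_inner M (e i) (e j))"
    using assms(1)
    by (simp add: L2_inner_self[symmetric] L2_inner_sum_left L2_inner_sum_right L2_sum L2_cmult
          L2_inner_cmult_left L2_inner_cmult_right sum_distrib_left mult.assoc)
  also have "\<dots> = (\<Sum>i\<in>I. \<Sum>j\<in>I. if i = j then c i * cnj (c j) else 0)"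
    using assms(2) by (intro sum.cong refl) auto
  also have "\<dots> = (\<Sum>i\<in>I. c i * cnj (c i))"
    using True by simp
  also have "\<dots> = of_real (\<Sum>i\<in>I. (cmod (c i))\<^sup>2)"
    by (simp add: complex_norm_square[symmetric] del: of_real_power)
  finally show ?thesis
    using of_real_eq_iff by blast
qed simp

text \<open>For a total orthonormal system, the partial sums of the Fourier expansion are Cauchy by Bessel's
  inequality; their limit has the same Fourier coefficients as \<open>f\<close> and therefore equals \<open>f\<close>.\<close>

proposition Fourier_expansion:
  fixes e :: "nat \<Rightarrow> 'a \<Rightarrow> complex"
  assumes e: "\<And>i. e i \<in> L2 M"
    and orth: "\<And>i j. L2_inner M (e i) (e j) = (if i = j then 1 else 0)"
    and total: "\<And>f. f \<in> L2 M \<Longrightarrow> (\<And>i. L2_inner M f (e i) = 0) \<Longrightarrow> AE x in M. f x = 0"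
    and f: "f \<in> L2 M"
  shows "(\<lambda>n. L2_norm_sq M (\<lambda>x. f x - (\<Sum>i<n. L2_inner M f (e i) * e i x))) \<longlonglongrightarrow> 0"
    and "(\<lambda>i. (cmod (L2_inner M f (e i)))\<^sup>2) sums L2_norm_sq M f"
proof -
  define s where "s n x = (\<Sum>i<n. L2_inner M f (e i) * e i x)" for n x
  have sL2: "s n \<in> L2 M" for n
    unfolding s_def by (intro L2_sum L2_cmult e)
  have norm_s: "L2_norm_sq M (s n) = (\<Sum>i<n. (cmod (L2_inner M f (e i)))\<^sup>2)" for n
    unfolding s_def by (rule L2_norm_sq_lincomb) (auto simp: e orth)
  have inner_fs: "L2_inner M f (s n) = of_real (\<Sum>i<n. (cmod (L2_inner M f (e i)))\<^sup>2)" for n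
    unfolding s_def
    by (subst L2_inner_sum_right)
       (auto simp: L2_cmult e f L2_inner_cmult_right mult.commute[of "cnj _"]
             complex_norm_square[symmetric] simp del: of_real_power)
  have dist: "L2_norm_sq M (\<lambda>x. f x - s n x) = L2_norm_sq M f - (\<Sum>i<n. (cmod (L2_inner M f (e i)))\<^sup>2)" for n
    by (simp add: L2_norm_sq_diff[OF f sL2] norm_s inner_fs)
  have summable: "summable (\<lambda>i. (cmod (L2_inner M f (e i)))\<^sup>2)"
  proof (rule bounded_imp_summable)
    show "(\<Sum>i\<le>n. (cmod (L2_inner M f (e i)))\<^sup>2) \<le> L2_norm_sq M f" for n
      using dist[of "Suc n"] L2_norm_sq_nonneg[of M "\<lambda>x. f x - s (Suc n) x"]
      by (simp add: lessThan_Suc_atMost)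
  qed simp
  have Cauchy: "\<exists>N. \<forall>m\<ge>N. \<forall>n\<ge>N. L2_norm_sq M (\<lambda>x. s m x - s n x) < \<epsilon>" if eps: "\<epsilon> > 0" for \<epsilon>
  proof -
    have "\<exists>N. \<forall>m\<ge>N. \<forall>n. norm (\<Sum>i=m..<n. (cmod (L2_inner M f (e i)))\<^sup>2) < \<epsilon>"
      using summable eps unfolding summable_Cauchy by simp
    then obtain N where N: "\<And>m n. m \<ge> N \<Longrightarrow> norm (\<Sum>i=m..<n. (cmod (L2_inner M f (e i)))\<^sup>2) < \<epsilon>"
      by blast
    have *: "L2_norm_sq M (\<lambda>x. s m x - s n x) < \<epsilon>" if "n \<ge> N" "m \<ge> n" for m n
    proof -
      have "s m x - s n x = (\<Sum>i=n..<m. L2_inner M f (e i) * e i x)" for x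
        unfolding s_def using sum_diff_nat_ivl[of 0 n m] that(2) by (simp add: atLeast0LessThan)
      then have "L2_norm_sq M (\<lambda>x. s m x - s n x) = (\<Sum>i=n..<m. (cmod (L2_inner M f (e i)))\<^sup>2)"
        by (simp add: L2_norm_sq_lincomb e orth)
      with N[OF that(1), of m] show ?thesis
        by (simp add: sum_nonneg)
    qed
    show ?thesis
    proof (intro exI[of _ N] allI impI)
      fix m n assume "m \<ge> N" "n \<ge> N"
      then show "L2_norm_sq M (\<lambda>x. s m x - s n x) < \<epsilon>"
        using *[of n m] *[of m n] L2_norm_sq_diff_commute[of M "s m" "s n"]
        by (cases "m \<le> n") auto
    qed
  qed
  obtain s' where s': "s' \<in> L2 M" and lim: "(\<lambda>n. L2_norm_sq M (\<lambda>x. s n x - s' x)) \<longlonglongrightarrow> 0"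
    using L2_complete[of s M] sL2 Cauchy by blast
  have "L2_inner M (\<lambda>x. f x - s' x) (e i) = 0" for i
  proof -
    have "(\<lambda>n. L2_inner M (s n) (e i)) \<longlonglongrightarrow> L2_inner M s' (e i)"
      by (rule tendsto_L2_inner[OF sL2 s' e lim])
    moreover have "L2_inner M (s n) (e i) = L2_inner M f (e i)" if "n > i" for n
    proof -
      have "L2_inner M (s n) (e i) = (\<Sum>j<n. L2_inner M f (e j) * L2_inner M (e j) (e i))"
        unfolding s_def by (subst L2_inner_sum_left) (auto simp: L2_cmult e L2_inner_cmult_left)
      then show ?thesis
        using that by (simp add: orth if_distrib cong: if_cong)
    qed
    then have "(\<lambda>n. L2_inner M (s n) (e i)) \<longlonglongrightarrow> L2_inner M f (e i)"
      by (intro tendsto_eventually) (auto simp: eventually_sequentially intro!: exI[of _ "Suc i"])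
    ultimately have "L2_inner M s' (e i) = L2_inner M f (e i)"
      by (rule LIMSEQ_unique)
    then show ?thesis
      by (simp add: L2_inner_diff_left f s' e)
  qed
  then have "AE x in M. f x - s' x = 0"
    by (intro total L2_diff f s')
  then have "L2_norm_sq M (\<lambda>x. s n x - s' x) = L2_norm_sq M (\<lambda>x. f x - s n x)" for n
    using f s' sL2[of n]
    by (subst (2) L2_norm_sq_diff_commute, intro L2_norm_sq_cong_AE L2_measurable L2_diff) auto
  with lim show "(\<lambda>n. L2_norm_sq M (\<lambda>x. f x - (\<Sum>i<n. L2_inner M f (e i) * e i x))) \<longlonglongrightarrow> 0"
    by (simp add: s_def)
  then have "(\<lambda>n. L2_norm_sq M f - L2_norm_sq M (\<lambda>x. f x - s n x)) \<longlonglongrightarrow> L2_norm_sq M f - 0"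
    unfolding s_def by (intro tendsto_intros)
  then show "(\<lambda>i. (cmod (L2_inner M f (e i)))\<^sup>2) sums L2_norm_sq M f"
    by (simp add: sums_def dist)
qed

lemma ell2_finite_support:
  assumes "finite K" "\<And>j. j \<notin> K \<Longrightarrow> c j = 0"
  shows "c \<in> ell2" "ell2_norm_sq c = (\<Sum>j\<in>K. (cmod (c j))\<^sup>2)"
proof -
  have "((\<lambda>j. (cmod (c j))\<^sup>2) has_sum (\<Sum>j\<in>K. (cmod (c j))\<^sup>2)) UNIV"
    by (rule has_sum_finiteI[THEN has_sum_cong_neutral[THEN iffD1, rotated -1]])
       (use assms in auto)
  then show "c \<in> ell2" "ell2_norm_sq c = (\<Sum>j\<in>K. (cmod (c j))\<^sup>2)"
    unfolding ell2_def ell2_norm_sq_def by (auto simp: infsumI summable_on_def)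
qed

lemma ell2_norm_sq_tendsto:
  assumes "c \<in> ell2"
  shows "((\<lambda>K. \<Sum>j\<in>K. (cmod (c j))\<^sup>2) \<longlongrightarrow> ell2_norm_sq c) (finite_subsets_at_top UNIV)"
  using assms has_sum_infsum[of "\<lambda>j. (cmod (c j))\<^sup>2" UNIV]
  unfolding ell2_def ell2_norm_sq_def has_sum_def by auto

lemma ell2_norm_sq_nonneg: "0 \<le> ell2_norm_sq c"
  unfolding ell2_norm_sq_def by (intro infsum_nonneg) auto

text \<open>The limit is first taken along a sequence of finite
  index sets beyond which the net moves little.\<close>

lemma L2_net_complete:
  fixes f :: "'i set \<Rightarrow> 'a \<Rightarrow> complex"
  assumes f: "\<And>K. f K \<in> L2 M"
    and Cauchy: "\<And>e. e > 0 \<Longrightarrow> \<exists>X. finite X \<and> (\<forall>K. finite K \<longrightarrow> X \<subseteq> K \<longrightarrow> L2_norm_sq M (\<lambda>x. f K x - f X x) < e)"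
  obtains s where "s \<in> L2 M" "((\<lambda>K. L2_norm_sq M (\<lambda>x. s x - f K x)) \<longlongrightarrow> 0) (finite_subsets_at_top UNIV)"
proof -
  have "\<forall>n. \<exists>X. finite X \<and> (\<forall>K. finite K \<longrightarrow> X \<subseteq> K \<longrightarrow> L2_norm_sq M (\<lambda>x. f K x - f X x) < 1 / Suc n)"
    using Cauchy by simp
  then obtain X where fin: "\<And>n. finite (X n)"
    and near: "\<And>n K. finite K \<Longrightarrow> X n \<subseteq> K \<Longrightarrow> L2_norm_sq M (\<lambda>x. f K x - f (X n) x) < 1 / Suc n"
    by metis
  have "\<exists>N. \<forall>m\<ge>N. \<forall>n\<ge>N. L2_norm_sq M (\<lambda>x. f (X m) x - f (X n) x) < \<epsilon>" if "\<epsilon> > 0" for \<epsilon>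
  proof -
    have "(\<lambda>n. 4 * (1 / Suc n)) \<longlonglongrightarrow> 4 * 0"
      by (intro tendsto_intros LIMSEQ_Suc[OF lim_const_over_n])
    then have "\<forall>\<^sub>F n in sequentially. 4 * (1 / Suc n) < \<epsilon>"
      using that by (intro order_tendstoD) auto
    then obtain N where N: "\<And>n. n \<ge> N \<Longrightarrow> 4 * (1 / Suc n) < \<epsilon>"
      by (auto simp: eventually_sequentially)
    have "L2_norm_sq M (\<lambda>x. f (X m) x - f (X n) x) < \<epsilon>" if mn: "m \<ge> N" "n \<ge> N" for m n
    proof -
      have fin': "finite (X m \<union> X n)"
        using fin by simp
      have "L2_norm_sq M (\<lambda>x. f (X m) x - f (X m \<union> X n) x) < 1 / Suc m"
        using near[OF fin', of m] by (subst L2_norm_sq_diff_commute) blast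
      moreover have "L2_norm_sq M (\<lambda>x. f (X m \<union> X n) x - f (X n) x) < 1 / Suc n"
        using near[OF fin', of n] by blast
      ultimately show ?thesis
        using L2_norm_sq_diff_triangle[OF f[of "X m"] f[of "X m \<union> X n"] f[of "X n"]]
          N[OF mn(1)] N[OF mn(2)] by linarith
    qed
    then show ?thesis
      by blast
  qed
  then obtain s where s: "s \<in> L2 M" and lim: "(\<lambda>n. L2_norm_sq M (\<lambda>x. f (X n) x - s x)) \<longlonglongrightarrow> 0"
    using L2_complete[of "\<lambda>n. f (X n)" M] f by blast
  have "((\<lambda>K. L2_norm_sq M (\<lambda>x. s x - f K x)) \<longlongrightarrow> 0) (finite_subsets_at_top UNIV)"
  proof (rule tendstoI)
    fix \<epsilon> :: real assume "\<epsilon> > 0"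
    have "(\<lambda>n. 2 * L2_norm_sq M (\<lambda>x. f (X n) x - s x) + 2 * (1 / Suc n)) \<longlonglongrightarrow> 2 * 0 + 2 * 0"
      by (intro tendsto_intros LIMSEQ_Suc[OF lim_const_over_n] lim)
    then have "\<forall>\<^sub>F n in sequentially. 2 * L2_norm_sq M (\<lambda>x. f (X n) x - s x) + 2 * (1 / Suc n) < \<epsilon>"
      using \<open>\<epsilon> > 0\<close> by (intro order_tendstoD) auto
    then obtain n where n: "2 * L2_norm_sq M (\<lambda>x. f (X n) x - s x) + 2 * (1 / Suc n) < \<epsilon>"
      by (auto simp: eventually_sequentially)
    have "dist (L2_norm_sq M (\<lambda>x. s x - f K x)) 0 < \<epsilon>" if K: "finite K" "X n \<subseteq> K" for K
    proof -
      have "L2_norm_sq M (\<lambda>x. f (X n) x - f K x) < 1 / Suc n"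
        using near[OF K] by (subst L2_norm_sq_diff_commute)
      moreover have "L2_norm_sq M (\<lambda>x. s x - f (X n) x) = L2_norm_sq M (\<lambda>x. f (X n) x - s x)"
        by (rule L2_norm_sq_diff_commute)
      ultimately have "L2_norm_sq M (\<lambda>x. s x - f K x) < \<epsilon>"
        using L2_norm_sq_diff_triangle[OF s f[of "X n"] f[of K]] n by linarith
      then show ?thesis
        by (simp add: L2_norm_sq_nonneg)
    qed
    then show "\<forall>\<^sub>F K in finite_subsets_at_top UNIV. dist (L2_norm_sq M (\<lambda>x. s x - f K x)) 0 < \<epsilon>"
      using fin by (auto simp: eventually_finite_subsets_at_top)
  qed
  with s show thesis ..
qed

text \<open>Square-summable coefficients have small tails, so an upper Riesz bound makes the partial sums
  a Cauchy net.\<close>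

proposition Bessel_synthesis:
  fixes v :: "'i \<Rightarrow> 'a \<Rightarrow> complex"
  assumes v: "\<And>j. v j \<in> L2 M"
    and B: "\<And>K c. finite K \<Longrightarrow> L2_norm_sq M (\<lambda>x. \<Sum>j\<in>K. c j * v j x) \<le> B * (\<Sum>j\<in>K. (cmod (c j))\<^sup>2)"
    and "B > 0"
    and c: "c \<in> ell2"
  obtains s where "s \<in> L2 M"
    "((\<lambda>K. L2_norm_sq M (\<lambda>x. s x - (\<Sum>j\<in>K. c j * v j x))) \<longlongrightarrow> 0) (finite_subsets_at_top UNIV)"
proof (rule L2_net_complete[of "\<lambda>K x. \<Sum>j\<in>K. c j * v j x" M])
  show "(\<lambda>x. \<Sum>j\<in>K. c j * v j x) \<in> L2 M" for K
    by (intro L2_sum L2_cmult v)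
  fix e :: real assume "e > 0"
  have "\<forall>\<^sub>F K in finite_subsets_at_top UNIV. ell2_norm_sq c - e / B < (\<Sum>j\<in>K. (cmod (c j))\<^sup>2)"
    using \<open>e > 0\<close> \<open>B > 0\<close> by (intro order_tendstoD(1)[OF ell2_norm_sq_tendsto[OF c]]) (simp add: divide_pos_pos)
  then obtain X where X: "finite X" "ell2_norm_sq c - e / B < (\<Sum>j\<in>X. (cmod (c j))\<^sup>2)"
    by (auto simp: eventually_finite_subsets_at_top)
  have "L2_norm_sq M (\<lambda>x. (\<Sum>j\<in>K. c j * v j x) - (\<Sum>j\<in>X. c j * v j x)) < e" if K: "finite K" "X \<subseteq> K" for K
  proof -
    have "(\<Sum>j\<in>K. c j * v j x) - (\<Sum>j\<in>X. c j * v j x) = (\<Sum>j\<in>K - X. c j * v j x)" for x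
      using K by (simp add: sum_diff)
    then have "L2_norm_sq M (\<lambda>x. (\<Sum>j\<in>K. c j * v j x) - (\<Sum>j\<in>X. c j * v j x)) \<le> B * (\<Sum>j\<in>K - X. (cmod (c j))\<^sup>2)"
      using B[of "K - X" c] K by simp
    also have "(\<Sum>j\<in>K - X. (cmod (c j))\<^sup>2) = (\<Sum>j\<in>K. (cmod (c j))\<^sup>2) - (\<Sum>j\<in>X. (cmod (c j))\<^sup>2)"
      using K X(1) by (simp add: sum_diff)
    also have "(\<Sum>j\<in>K. (cmod (c j))\<^sup>2) \<le> ell2_norm_sq c"
      unfolding ell2_norm_sq_def using c K
      by (intro finite_sum_le_infsum) (auto simp: ell2_def)
    then have "B * ((\<Sum>j\<in>K. (cmod (c j))\<^sup>2) - (\<Sum>j\<in>X. (cmod (c j))\<^sup>2)) < e"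
      using X(2) \<open>B > 0\<close> by (simp add: less_divide_eq[symmetric] mult.commute[of B] pos_less_divide_eq[symmetric])
    finally show ?thesis .
  qed
  with X(1) show "\<exists>X. finite X \<and> (\<forall>K. finite K \<longrightarrow> X \<subseteq> K \<longrightarrow>
      L2_norm_sq M (\<lambda>x. (\<Sum>j\<in>K. c j * v j x) - (\<Sum>j\<in>X. c j * v j x)) < e)"
    by blast
qed (use that in blast)

text \<open>By continuity of the inner product, the squared norm of an unconditional sum may be expanded
  into the iterated double sum of the Gram matrix.\<close>

lemma Gram_expansion:
  fixes w :: "'i \<Rightarrow> 'a \<Rightarrow> complex"
  assumes w: "\<And>j. w j \<in> L2 M" and s: "s \<in> L2 M"
    and lim: "((\<lambda>K. L2_norm_sq M (\<lambda>x. s x - (\<Sum>j\<in>K. c j * w j x))) \<longlongrightarrow> 0) (finite_subsets_at_top UNIV)"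
  shows "((\<lambda>j. c j * cnj (c i) * L2_inner M (w j) (w i)) has_sum (cnj (c i) * L2_inner M s (w i))) UNIV"
    and "((\<lambda>i. cnj (c i) * L2_inner M s (w i)) has_sum of_real (L2_norm_sq M s)) UNIV"
proof -
  let ?S = "\<lambda>K x. \<Sum>j\<in>K. c j * w j x"
  have SL2: "?S K \<in> L2 M" for K
    by (intro L2_sum L2_cmult w)
  have lim': "((\<lambda>K. L2_norm_sq M (\<lambda>x. ?S K x - s x)) \<longlongrightarrow> 0) (finite_subsets_at_top UNIV)"
    using lim by (subst L2_norm_sq_diff_commute)
  have left: "L2_inner M (?S K) h = (\<Sum>j\<in>K. c j * L2_inner M (w j) h)" if "h \<in> L2 M" for K h
    using that by (subst L2_inner_sum_left) (auto simp: L2_cmult w L2_inner_cmult_left)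
  have "((\<lambda>K. L2_inner M (?S K) (w i)) \<longlongrightarrow> L2_inner M s (w i)) (finite_subsets_at_top UNIV)"
    by (rule tendsto_L2_inner[OF SL2 s w lim'])
  then have "((\<lambda>j. c j * L2_inner M (w j) (w i)) has_sum L2_inner M s (w i)) UNIV"
    by (simp add: left w has_sum_def)
  from has_sum_cmult_right[OF this, of "cnj (c i)"]
  show "((\<lambda>j. c j * cnj (c i) * L2_inner M (w j) (w i)) has_sum (cnj (c i) * L2_inner M s (w i))) UNIV"
    by (simp add: mult_ac)
  have "((\<lambda>K. cnj (L2_inner M (?S K) s)) \<longlongrightarrow> cnj (L2_inner M s s)) (finite_subsets_at_top UNIV)"
    by (intro tendsto_cnj tendsto_L2_inner[OF SL2 s s lim'])
  then show "((\<lambda>i. cnj (c i) * L2_inner M s (w i)) has_sum of_real (L2_norm_sq M s)) UNIV"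
    by (simp add: left s L2_inner_self has_sum_def cnj_sum L2_inner_commute[of M s])
qed

section \<open>The trigonometric system\<close>

lemma measurable_cis [measurable]: "cis \<in> borel_measurable borel"
  by (intro borel_measurable_continuous_onI continuous_intros)

text \<open>The inductive form gives closure under products by two inductions, without convolving
  coefficient sequences.\<close>

inductive trig_poly :: "(real \<Rightarrow> complex) \<Rightarrow> bool" where
  exponential: "trig_poly (\<lambda>t. cis (of_int n * t))"
| add: "trig_poly p \<Longrightarrow> trig_poly q \<Longrightarrow> trig_poly (\<lambda>t. p t + q t)"
| scale: "trig_poly p \<Longrightarrow> trig_poly (\<lambda>t. c * p t)"

lemma trig_poly_const: "trig_poly (\<lambda>t. c)"
  using trig_poly.scale[OF trig_poly.exponential[of 0], of c] by simp

lemma trig_poly_exponential_mult: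
  "trig_poly p \<Longrightarrow> trig_poly (\<lambda>t. cis (of_int n * t) * p t)"
proof (induction rule: trig_poly.induct)
  case (exponential m)
  then show ?case
    using trig_poly.exponential[of "n + m"] by (simp add: cis_mult distrib_right)
next
  case (add p q)
  then show ?case
    using trig_poly.add by (simp add: distrib_left)
next
  case (scale p c)
  then show ?case
    using trig_poly.scale[of _ c] by (simp add: mult.left_commute)
qed

lemma trig_poly_mult: "trig_poly p \<Longrightarrow> trig_poly q \<Longrightarrow> trig_poly (\<lambda>t. p t * q t)"
proof (induction rule: trig_poly.induct)
  case (exponential m)
  then show ?case
    by (rule trig_poly_exponential_mult)
next
  case (add p q)
  then show ?case
    using trig_poly.add by (simp add: distrib_right)
next
  case (scale p c)
  then show ?case
    using trig_poly.scale[of _ c] by (simp add: mult.assoc)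
qed

lemma trig_poly_of_polynomial:
  fixes q :: "complex \<Rightarrow> real"
  assumes "real_polynomial_function q"
  shows "trig_poly (\<lambda>t. complex_of_real (q (cis t)))"
  using assms
proof (induction rule: real_polynomial_function.induct)
  case (linear f)
  interpret bounded_linear f by fact
  have "f (cis t) = cos t * f 1 + sin t * f \<i>" for t
  proof -
    have "cis t = cos t *\<^sub>R 1 + sin t *\<^sub>R \<i>"
      by (simp add: complex_eq_iff)
    then have "f (cis t) = f (cos t *\<^sub>R 1 + sin t *\<^sub>R \<i>)"
      by simp
    also have "\<dots> = cos t * f 1 + sin t * f \<i>"
      by (simp only: add scaleR) simp
    finally show ?thesis .
  qed
  moreover have "complex_of_real (cos t) = (1/2) * cis (of_int 1 * t) + (1/2) * cis (of_int (-1) * t)" for t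
    by (simp add: complex_eq_iff)
  moreover have "complex_of_real (sin t) = (- \<i>/2) * cis (of_int 1 * t) + (\<i>/2) * cis (of_int (-1) * t)" for t
    by (simp add: complex_eq_iff)
  ultimately have "complex_of_real (f (cis t))
      = of_real (f 1) * ((1/2) * cis (of_int 1 * t) + (1/2) * cis (of_int (-1) * t))
      + of_real (f \<i>) * ((- \<i>/2) * cis (of_int 1 * t) + (\<i>/2) * cis (of_int (-1) * t))" for t
    by (simp add: mult.commute)
  then show ?case
    by (simp only:) (intro trig_poly.intros)
qed (auto intro: trig_poly_const trig_poly.add trig_poly_mult)

lemma integrable_mult_bounded:
  fixes h u :: "'a \<Rightarrow> complex"
  assumes "integrable M h" "u \<in> borel_measurable M" "\<And>x. cmod (u x) \<le> C"
  shows "integrable M (\<lambda>x. h x * u x)"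
proof (rule Bochner_Integration.integrable_bound[of M "\<lambda>x. of_real C * h x"])
  show "AE x in M. norm (h x * u x) \<le> norm (of_real C * h x)"
    using assms(3) by (auto simp: norm_mult mult.commute[of "cmod (h _)"] intro!: mult_right_mono order_trans[OF assms(3)])
qed (use assms in auto)

text \<open>The interval is wrapped around the unit circle by \<open>w\<close>. By the Stone--Weierstrass theorem the function
  is orthogonal to all continuous functions on the circle, then by dominated convergence
  to indicators of open sets, then by Dynkin's argument to indicators of Borel sets; the argument
  function translates these back to Borel sets of the interval.\<close>

proposition Fourier_coefficients_zero:
  fixes h :: "real \<Rightarrow> complex"
  assumes "a < b" and h: "integrable lborel h"
    and off: "\<And>x. x \<notin> {a<..b} \<Longrightarrow> h x = 0"
    and zero: "\<And>n::int. (LINT x|lborel. h x * cis (2 * pi * of_int n * x / (b - a))) = 0"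
  shows "AE x in lborel. h x = 0"
proof -
  have [measurable]: "h \<in> borel_measurable borel"
    using h by auto
  define \<theta> where "\<theta> x = 2 * pi * (x - (a + b) / 2) / (b - a)" for x
  define w where "w x = cis (\<theta> x)" for x
  have [measurable]: "\<theta> \<in> borel_measurable borel" "w \<in> borel_measurable borel"
    unfolding \<theta>_def w_def by measurable
  have ortho_trig: "(LINT x|lborel. h x * p (\<theta> x)) = 0 \<and> integrable lborel (\<lambda>x. h x * p (\<theta> x))"
    if "trig_poly p" for p
    using that
  proof (induction rule: trig_poly.induct)
    case (exponential n)
    let ?c = "cis (- (of_int n * (2 * pi * ((a + b) / 2) / (b - a))))"
    have "(\<lambda>x. h x * cis (of_int n * \<theta> x)) = (\<lambda>x. ?c * (h x * cis (2 * pi * of_int n * x / (b - a))))"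
      by (intro ext) (simp add: \<theta>_def cis_mult mult_ac right_diff_distrib diff_divide_distrib)
    then have "(LINT x|lborel. h x * cis (of_int n * \<theta> x)) = 0"
      by (simp only: integral_mult_right_zero zero mult_zero_right)
    moreover have "integrable lborel (\<lambda>x. h x * cis (of_int n * \<theta> x))"
      by (rule integrable_mult_bounded[OF h, of _ 1]) auto
    ultimately show ?case ..
  next
    case (add p q)
    then show ?case by (simp add: distrib_left)
  next
    case (scale p c)
    then show ?case by (simp add: mult.left_commute)
  qed
  have ortho_cont: "(LINT x|lborel. h x * of_real (q (w x))) = 0"
    if q: "continuous_on UNIV q" for q :: "complex \<Rightarrow> real"
  proof -
    have qb: "\<bar>q (w x)\<bar> \<le> (SUP z\<in>sphere 0 1. \<bar>q z\<bar>)" for x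
    proof (rule cSUP_upper)
      show "bdd_above ((\<lambda>z. \<bar>q z\<bar>) ` sphere 0 1)"
        by (intro bounded_imp_bdd_above compact_imp_bounded compact_continuous_image continuous_intros
              continuous_on_subset[OF q]) auto
    qed (simp add: w_def)
    have [measurable]: "q \<in> borel_measurable borel"
      by (rule borel_measurable_continuous_onI[OF q])
    have int_q: "integrable lborel (\<lambda>x. h x * of_real (q (w x)))"
      by (rule integrable_mult_bounded[OF h]) (use qb in auto)
    have "cmod (LINT x|lborel. h x * of_real (q (w x))) \<le> 0 + \<epsilon> * (LINT x|lborel. cmod (h x))"
      if "\<epsilon> > 0" for \<epsilon>
    proof -
      obtain g where g: "real_polynomial_function g" "\<And>z. z \<in> sphere (0::complex) 1 \<Longrightarrow> \<bar>q z - g z\<bar> < \<epsilon>"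
        using Stone_Weierstrass_real_polynomial_function[of "sphere 0 1" q \<epsilon>] \<open>\<epsilon> > 0\<close>
          continuous_on_subset[OF q] by auto
      have g0: "(LINT x|lborel. h x * of_real (g (w x))) = 0" "integrable lborel (\<lambda>x. h x * of_real (g (w x)))"
        using ortho_trig[OF trig_poly_of_polynomial[OF g(1)]] by (auto simp: w_def)
      have "cmod (LINT x|lborel. h x * of_real (q (w x)))
         = cmod (LINT x|lborel. h x * of_real (q (w x)) - h x * of_real (g (w x)))"
        using int_q g0 by simp
      also have "\<dots> \<le> (LINT x|lborel. cmod (h x * of_real (q (w x)) - h x * of_real (g (w x))))"
        by (rule integral_norm_bound)
      also have "\<dots> \<le> (LINT x|lborel. \<epsilon> * cmod (h x))"
      proof (rule integral_mono)
        show "cmod (h x * of_real (q (w x)) - h x * of_real (g (w x))) \<le> \<epsilon> * cmod (h x)" for x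
          using g(2)[of "w x"]
          by (simp add: right_diff_distrib[symmetric] norm_mult mult.commute[of \<epsilon>] w_def
               flip: of_real_diff) (intro mult_left_mono, auto)
      qed (use int_q g0 h in auto)
      finally show ?thesis
        by simp
    qed
    note small = this
    have "cmod (LINT x|lborel. h x * of_real (q (w x))) \<le> 0 + e" if "e > 0" for e
    proof -
      let ?C = "LINT x|lborel. cmod (h x)"
      have *: "e / (C + 1) * C \<le> e \<and> e / (C + 1) > 0" if "C \<ge> 0" for C
        using that \<open>e > 0\<close> by (auto simp: field_simps)
      have C: "?C \<ge> 0"
        by simp
      show ?thesis
        using order_trans[OF small[OF *[OF C, THEN conjunct2]]] *[OF C, THEN conjunct1]
        by (metis add_left_mono)
    qed
    then have "cmod (LINT x|lborel. h x * of_real (q (w x))) \<le> 0"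
      by (rule field_le_epsilon)
    then show ?thesis
      by simp
  qed
  have int_ind: "integrable lborel (\<lambda>x. h x * of_real (indicator A (w x)))" if "A \<in> sets borel" for A
    using that by (intro integrable_mult_bounded[OF h, of _ 1]) (auto simp: indicator_def)
  have ortho_open: "(LINT x|lborel. h x * of_real (indicator U (w x))) = 0" if U: "open U" for U
  proof (cases "U = UNIV")
    case True
    then show ?thesis
      using ortho_cont[of "\<lambda>_. 1"] by simp
  next
    case False
    \<comment> \<open>Continuous functions that increase to the indicator of \<open>U\<close>.\<close>
    define q where "q k z = min 1 (real k * infdist z (- U))" for k z
    have qc: "continuous_on UNIV (q k)" for k
      unfolding q_def by (intro continuous_intros)
    have [measurable]: "q k \<in> borel_measurable borel" for k
      by (rule borel_measurable_continuous_onI[OF qc])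
    have "(\<lambda>k. LINT x|lborel. h x * of_real (q k (w x))) \<longlonglongrightarrow> (LINT x|lborel. h x * of_real (indicator U (w x)))"
    proof (rule integral_dominated_convergence[where w="\<lambda>x. cmod (h x)"])
      show "AE x in lborel. (\<lambda>k. h x * of_real (q k (w x))) \<longlonglongrightarrow> h x * of_real (indicator U (w x))"
      proof (intro AE_I2 tendsto_intros)
        fix x
        show "(\<lambda>k. q k (w x)) \<longlonglongrightarrow> indicator U (w x)"
        proof (cases "w x \<in> U")
          case True
          then have "infdist (w x) (- U) > 0"
            using U False by (intro infdist_pos_not_in_closed) auto
          then obtain k0 where k0: "real k0 * infdist (w x) (- U) > 1"
            using reals_Archimedean3 by blast
          have "q k (w x) = 1" if "k \<ge> k0" for k
            using order_trans[OF less_imp_le[OF k0] mult_right_mono[of "real k0" "real k"]] that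
            by (auto simp: q_def infdist_nonneg)
          then show ?thesis
            using True by (intro tendsto_eventually) (auto simp: eventually_sequentially)
        qed (simp add: q_def)
      qed
      show "AE x in lborel. norm (h x * of_real (q k (w x))) \<le> cmod (h x)" for k
        by (intro AE_I2) (auto simp: norm_mult q_def infdist_nonneg intro!: mult_right_le_one_le)
      show "(\<lambda>x. h x * complex_of_real (indicat_real U (w x))) \<in> borel_measurable lborel"
        using int_ind[of U] U by auto
    qed (use h in auto)
    then show ?thesis
      using ortho_cont[OF qc] by (simp add: LIMSEQ_const_iff)
  qed
  have ortho_Borel: "(LINT x|lborel. h x * of_real (indicator A (w x))) = 0" if "A \<in> sets borel" for A
  proof -
    have "Int_stable {S :: complex set. open S}" "{S :: complex set. open S} \<subseteq> Pow UNIV"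
      by (auto simp: Int_stable_def)
    moreover have "A \<in> sigma_sets UNIV {S. open S}"
      using that by (simp add: borel_def)
    ultimately show ?thesis
    proof (induction A rule: sigma_sets_induct_disjoint)
      case (basic A)
      then show ?case using ortho_open by auto
    next
      case (compl A)
      then have A: "A \<in> sets borel"
        by (simp add: borel_def)
      have "h x * of_real (indicator (UNIV - A) (w x))
          = h x * of_real (indicator UNIV (w x)) - h x * of_real (indicator A (w x))" for x
        by (simp add: indicator_def)
      then show ?case
        using compl ortho_open[of UNIV] int_ind[OF A] h by simp
    next
      case (union A)
      have A: "A i \<in> sets borel" for i
        using union(2) by (auto simp: borel_def)
      have A': "w -` A i \<in> sets borel" for i
        using measurable_sets[of w borel borel "A i"] A by simp
      have eq: "(LINT x:w -` S|lborel. h x) = (LINT x|lborel. h x * of_real (indicator S (w x)))" for S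
        unfolding set_lebesgue_integral_def
        by (intro Bochner_Integration.integral_cong) (auto simp: indicator_def)
      have UA: "(\<Union>i. w -` A i) = w -` (\<Union>i. A i)"
        by auto
      have "(LINT x:(\<Union>i. w -` A i)|lborel. h x) = (\<Sum>i. (LINT x:w -` A i|lborel. h x))"
      proof (rule lebesgue_integral_countable_add)
        show "set_integrable lborel (\<Union>i. w -` A i) h"
          by (rule set_integrable_subset[where A=UNIV]) (use A' h in \<open>auto simp: set_integrable_def\<close>)
      qed (use A' union(1) in \<open>auto simp: disjoint_family_on_def\<close>)
      then show ?case
        using union(3) by (simp add: eq UA)
    qed auto
  qed
  \<comment> \<open>On the circle this is the argument; the value \<open>pi\<close> on the whole cut makes it piecewise continuous.\<close>
  define arg where "arg z = (if z \<in> - \<real>\<^sub>\<le>\<^sub>0 then Arg z else pi)" for z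
  have "(- \<real>\<^sub>\<le>\<^sub>0 :: complex set) \<in> sets borel"
    by (intro borel_open open_Compl closed_nonpos_Reals_complex)
  then have [measurable]: "arg \<in> borel_measurable borel"
    unfolding arg_def by (intro borel_measurable_continuous_on_if continuous_on_Arg continuous_intros)
  have arg: "(a + b) / 2 + (b - a) * arg (w x) / (2 * pi) = x" if x: "x \<in> {a<..b}" for x
  proof -
    have \<theta>: "- pi < \<theta> x" "\<theta> x \<le> pi"
      using x \<open>a < b\<close> by (auto simp: \<theta>_def field_simps) 
    have "arg (w x) = \<theta> x"
    proof (cases "w x \<in> \<real>\<^sub>\<le>\<^sub>0")
      case True
      then have "w x = -1"
        by (auto simp: w_def complex_nonpos_Reals_iff complex_eq_iff sin_zero_norm_cos_one)
           (metis abs_of_nonpos minus_equation_iff real_norm_def sin_zero_norm_cos_one)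
      then have "Arg (w x) = pi"
        by (simp add: Arg_eq_pi)
      then show ?thesis
        using True \<theta> by (simp add: arg_def w_def Arg_cis)
    qed (use \<theta> in \<open>simp add: arg_def w_def Arg_cis\<close>)
    then show ?thesis
      using \<open>a < b\<close> by (simp add: \<theta>_def)
  qed
  show ?thesis
  proof (rule sigma_finite_measure.density_zero[OF _ h])
    fix B :: "real set" assume "B \<in> sets lborel"
    then have [measurable]: "B \<in> sets borel"
      by simp
    define A where "A = {z. (a + b) / 2 + (b - a) * arg z / (2 * pi) \<in> B}"
    have "A \<in> sets borel"
      unfolding A_def by measurable
    have "indicator B x *\<^sub>R h x = h x * of_real (indicator A (w x))" for x
      using off[of x] arg[of x] by (cases "x \<in> {a<..b}") (auto simp: A_def indicator_def)
    then show "set_lebesgue_integral lborel B h = 0"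
      using ortho_Borel[OF \<open>A \<in> sets borel\<close>] by (simp add: set_lebesgue_integral_def)
  qed (rule sigma_finite_lborel)
qed

lemma integral_exponential:
  assumes "L > 0"
  shows "(LINT x|lborel. of_real (indicator {a<..a + L} x) * cis (2 * pi * of_int n * x / L))
    = (if n = 0 then of_real L else 0)"
proof (cases "n = 0")
  case True
  have "(LINT x|lborel. complex_of_real (indicator {a<..a + L} x)) = of_real L"
    using \<open>L > 0\<close> by (subst integral_complex_of_real) simp
  with True show ?thesis
    by simp
next
  case False
  define k where "k = 2 * pi * of_int n / L"
  have "k \<noteq> 0"
    using False \<open>L > 0\<close> by (simp add: k_def)
  define F where "F x = - \<i> / of_real k * cis (k * x)" for x
  have "(LINT x|lborel. indicator {a..a + L} x *\<^sub>R cis (k * x)) = F (a + L) - F a"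
  proof (rule integral_FTC_Icc)
    fix x
    have "(F has_vector_derivative (- \<i> / of_real k * (of_real k * (\<i> * cis (k * x))))) (at x within {a..a + L})"
      unfolding F_def cis_conv_exp
      by (rule has_vector_derivative_real_field[where f="\<lambda>z. - \<i> / of_real k * exp (\<i> * (of_real k * z))", THEN has_vector_derivative_at_within, unfolded of_real_mult[symmetric]])
         (auto intro!: derivative_eq_intros)
    then show "(F has_vector_derivative cis (k * x)) (at x within {a..a + L})"
      using \<open>k \<noteq> 0\<close> by simp
  qed (use \<open>L > 0\<close> in \<open>auto intro!: continuous_intros\<close>)
  also have "k * (a + L) = k * a + 2 * pi * of_int n"
    using \<open>L > 0\<close> by (simp add: k_def field_simps)
  then have "F (a + L) = F a"
    by (simp add: F_def cis_mult[symmetric] cis_multiple_2pi)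
  also have "(LINT x|lborel. indicator {a..a + L} x *\<^sub>R cis (k * x))
      = (LINT x|lborel. of_real (indicator {a<..a + L} x) * cis (2 * pi * of_int n * x / L))"
    using AE_lborel_singleton[of a]
    by (intro integral_cong_AE) (auto simp: k_def indicator_def scaleR_conv_of_real elim!: eventually_mono)
  finally show ?thesis
    using False by simp
qed

text \<open>The index \<open>(n, m)\<close> stands for the exponential of frequency \<open>n / L\<close>, normalised and cut off
  to the \<open>m\<close>-th interval of length \<open>L\<close> counted from \<open>a\<close>. For \<open>a = 0\<close>, \<open>L = 1\<close> this provides an orthonormal basis of
  \<open>L\<^sup>2(\<real>)\<close>; with other parameters the functions with \<open>m = 0\<close> expand functions supported in a given interval.\<close>

definition trig_fun :: "real \<Rightarrow> real \<Rightarrow> int \<times> int \<Rightarrow> real \<Rightarrow> complex" where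
  "trig_fun a L i x = of_real (indicator {a + of_int (snd i) * L<..a + of_int (snd i) * L + L} x / sqrt L)
     * cis (2 * pi * of_int (fst i) * x / L)"

lemma translates_disjoint:
  assumes "x \<in> {a + of_int m * L<..a + of_int m * L + L}" "x \<in> {a + of_int n * L<..a + of_int n * L + L}"
    "L > (0::real)"
  shows "m = n"
proof -
  have "of_int m * L < (of_int n + 1) * L" "of_int n * L < (of_int m + 1) * L"
    using assms by (auto simp: distrib_right)
  then have "(of_int m :: real) < of_int n + 1" "(of_int n :: real) < of_int m + 1"
    using \<open>L > 0\<close> by (simp_all only: mult_less_cancel_right_pos)
  then show ?thesis
    by linarith
qed

lemma translates_cover:
  assumes "L > (0::real)"
  obtains m :: int where "x \<in> {a + of_int m * L<..a + of_int m * L + L}"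
proof
  define m where "m = \<lceil>(x - a) / L\<rceil> - 1"
  have "of_int m < (x - a) / L" "(x - a) / L \<le> of_int m + 1"
    unfolding m_def by linarith+
  then show "x \<in> {a + of_int m * L<..a + of_int m * L + L}"
    using assms by (simp add: field_simps)
qed

lemma trig_fun_L2:
  assumes "L > 0"
  shows "trig_fun a L i \<in> L2 lborel"
proof -
  have "trig_fun a L i \<in> borel_measurable lborel"
    unfolding trig_fun_def by measurable
  moreover have "sqnorm lborel (trig_fun a L i)
      = (\<integral>\<^sup>+x. ennreal (1 / L) * indicator {a + of_int (snd i) * L<..a + of_int (snd i) * L + L} x \<partial>lborel)"
    unfolding sqnorm_def trig_fun_def using assms
    by (intro nn_integral_cong) (auto simp: norm_mult norm_divide power_divide indicator_def)
  then have "sqnorm lborel (trig_fun a L i) < \<infinity>"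
    using assms by (simp add: nn_integral_cmult ennreal_mult_less_top)
  ultimately show ?thesis
    by (simp add: L2_iff)
qed

lemma trig_fun_orthonormal:
  assumes "L > 0"
  shows "L2_inner lborel (trig_fun a L i) (trig_fun a L j) = (if i = j then 1 else 0)"
proof (cases "snd i = snd j")
  case True
  have "trig_fun a L i x * cnj (trig_fun a L j x)
     = of_real (1 / L) * (of_real (indicator {a + of_int (snd j) * L<..a + of_int (snd j) * L + L} x)
       * cis (2 * pi * of_int (fst i - fst j) * x / L))" for x
    using assms True
    by (simp add: trig_fun_def cis_cnj cis_mult indicator_def diff_divide_distrib
        left_diff_distrib right_diff_distrib flip: of_real_mult)
  then show ?thesis
    using assms True
    by (simp only: L2_inner_def integral_mult_right_zero integral_exponential) (auto simp: prod_eq_iff)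
next
  case False
  then have "trig_fun a L i x * cnj (trig_fun a L j x) = 0" for x
    using translates_disjoint[OF _ _ assms, of x a "snd i" "snd j"]
    by (auto simp: trig_fun_def indicator_def)
  then have "L2_inner lborel (trig_fun a L i) (trig_fun a L j) = 0"
    by (simp only: L2_inner_def) simp
  then show ?thesis
    using False by auto
qed

lemma sqnorm_indicator:
  "A \<in> sets M \<Longrightarrow> sqnorm M (\<lambda>x. complex_of_real (indicator A x)) = emeasure M A"
  unfolding sqnorm_def
  by (subst nn_integral_indicator[symmetric], assumption, rule nn_integral_cong) (simp add: indicator_def)

lemma indicator_L2:
  "A \<in> sets M \<Longrightarrow> emeasure M A < \<infinity> \<Longrightarrow> (\<lambda>x. complex_of_real (indicator A x)) \<in> L2 M"
  by (simp add: L2_iff sqnorm_indicator)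

lemma trig_fun_total:
  assumes "L > 0" and f: "f \<in> L2 lborel"
    and zero: "\<And>i. L2_inner lborel f (trig_fun a L i) = 0"
  shows "AE x in lborel. f x = 0"
proof -
  have [measurable]: "f \<in> borel_measurable borel"
    using L2_measurable[OF f] by simp
  define J where "J m = {a + of_int m * L<..a + of_int m * L + L}" for m :: int
  have [measurable]: "J m \<in> sets borel" for m
    by (simp add: J_def)
  have "AE x in lborel. of_real (indicator (J m) x) * f x = 0" for m
  proof (rule Fourier_coefficients_zero[of "a + of_int m * L" "a + of_int m * L + L"])
    have "(\<lambda>x. complex_of_real (indicator (J m) x)) \<in> L2 lborel"
      using \<open>L > 0\<close> by (intro indicator_L2) (auto simp: J_def)
    from L2_integrable_mult[OF f this] show "integrable lborel (\<lambda>x. of_real (indicator (J m) x) * f x)"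
      by (simp add: mult.commute)
    fix n :: int
    have "0 = of_real (sqrt L) * L2_inner lborel f (trig_fun a L (- n, m))"
      by (simp add: zero)
    also have "\<dots> = (LINT x|lborel. of_real (sqrt L) * (f x * cnj (trig_fun a L (- n, m) x)))"
      by (simp add: L2_inner_def)
    also have "\<dots> = (LINT x|lborel. of_real (indicator (J m) x) * f x
        * cis (2 * pi * of_int n * x / (a + of_int m * L + L - (a + of_int m * L))))"
      using \<open>L > 0\<close> by (intro Bochner_Integration.integral_cong refl)
        (simp add: trig_fun_def J_def indicator_def cis_cnj)
    finally show "\<dots> = 0" ..
  qed (use \<open>L > 0\<close> in \<open>auto simp: J_def\<close>)
  then have "AE x in lborel. \<forall>m. of_real (indicator (J m) x) * f x = 0"
    by (intro AE_all_countable[THEN iffD2] allI)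
  then show ?thesis
  proof eventually_elim
    case (elim x)
    obtain m where "x \<in> J m"
      using translates_cover[OF \<open>L > 0\<close>] unfolding J_def by blast
    then show ?case
      using elim[rule_format, of m] by simp
  qed
qed

lemma bij_enum_int2: "bij (from_nat_into (UNIV :: (int \<times> int) set))"
  by (intro bij_betw_from_nat_into) (auto simp: finite_prod infinite_UNIV_int)

lemma trig_fun_total_enum:
  assumes "L > 0" "f \<in> L2 lborel" "\<And>n. L2_inner lborel f (trig_fun a L (from_nat_into UNIV n)) = 0"
  shows "AE x in lborel. f x = 0"
proof (rule trig_fun_total[OF assms(1,2)])
  fix i :: "int \<times> int"
  obtain n where "i = from_nat_into UNIV n"
    using bij_is_surj[OF bij_enum_int2] by (rule surjE)
  then show "L2_inner lborel f (trig_fun a L i) = 0"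
    using assms(3) by simp
qed

text \<open>The Hilbert--Schmidt norm refers to a chosen orthonormal basis, so a basis has to be exhibited.\<close>

proposition orthonormal_basis_exists: "\<exists>e. orthonormal_basis e"
proof
  let ?i = "from_nat_into (UNIV :: (int \<times> int) set)"
  have "inj ?i"
    using bij_enum_int2 by (rule bij_is_inj)
  then have "L2_inner lborel (trig_fun 0 1 (?i m)) (trig_fun 0 1 (?i n)) = (if m = n then 1 else 0)" for m n
    by (simp add: trig_fun_orthonormal inj_eq)
  moreover have "AE x in lborel. f x = 0"
    if "f \<in> L2 lborel" "\<forall>n. L2_inner lborel f (trig_fun 0 1 (?i n)) = 0" for f
    using that by (intro trig_fun_total_enum[of 1 f 0]) auto
  ultimately show "orthonormal_basis (\<lambda>n. trig_fun 0 1 (?i n))"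
    by (auto simp: orthonormal_basis_def trig_fun_L2)
qed

proposition Parseval_trig:
  assumes "L > 0" "f \<in> L2 lborel"
  shows "(\<integral>\<^sup>+i. ennreal ((cmod (L2_inner lborel f (trig_fun a L i)))\<^sup>2) \<partial>count_space UNIV) = sqnorm lborel f"
proof -
  let ?i = "from_nat_into (UNIV :: (int \<times> int) set)"
  have "inj ?i"
    using bij_enum_int2 by (rule bij_is_inj)
  have "(\<lambda>n. (cmod (L2_inner lborel f (trig_fun a L (?i n))))\<^sup>2) sums L2_norm_sq lborel f"
  proof (rule Fourier_expansion(2))
    show "L2_inner lborel (trig_fun a L (?i m)) (trig_fun a L (?i n)) = (if m = n then 1 else 0)" for m n
      using \<open>inj ?i\<close> assms by (simp add: trig_fun_orthonormal inj_eq)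
    show "AE x in lborel. h x = 0"
      if "h \<in> L2 lborel" "\<And>n. L2_inner lborel h (trig_fun a L (?i n)) = 0" for h
      using that assms(1) by (intro trig_fun_total_enum[of L h a]) auto
  qed (use assms trig_fun_L2 in auto)
  then have "(\<Sum>n. ennreal ((cmod (L2_inner lborel f (trig_fun a L (?i n))))\<^sup>2)) = ennreal (L2_norm_sq lborel f)"
    by (intro suminf_ennreal_eq) auto
  then show ?thesis
    using assms(2) nn_integral_bij_count_space[OF bij_enum_int2, of "\<lambda>i. ennreal ((cmod (L2_inner lborel f (trig_fun a L i)))\<^sup>2)"]
    by (simp add: nn_integral_count_space_nat sqnorm_conv)
qed

text \<open>The Fourier expansion of the indicator of \<open>E\<close> in the basis \<open>trig_fun 0 1\<close> involves only the
  functions on the interval \<open>(0, 1]\<close>; its partial sums are the required trigonometric polynomials.\<close>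

lemma trig_density:
  assumes E: "E \<in> sets borel" "E \<subseteq> {0<..1}"
  obtains b :: "int \<Rightarrow> complex" and I :: "nat \<Rightarrow> int set" where "\<And>k. finite (I k)"
    "(\<lambda>k. L2_norm_sq lborel (\<lambda>x. of_real (indicator {0<..1} x) * (\<Sum>n\<in>I k. b n * cis (2 * pi * of_int n * x))
        - of_real (indicator E x))) \<longlonglongrightarrow> 0"
proof -
  let ?i = "from_nat_into (UNIV :: (int \<times> int) set)"
  have "inj ?i"
    using bij_enum_int2 by (rule bij_is_inj)
  define f where "f x = complex_of_real (indicator E x)" for x
  have f: "f \<in> L2 lborel"
    unfolding f_def[abs_def]
  proof (rule indicator_L2)
    have "emeasure lborel E \<le> emeasure lborel {0<..1::real}"
      using E by (intro emeasure_mono) auto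
    also have "\<dots> < \<infinity>"
      by simp
    finally show "emeasure lborel E < \<infinity>" .
  qed (use E in simp)
  define c where "c i = L2_inner lborel f (trig_fun 0 1 i)" for i
  have c0: "c (n, m) = 0" if "m \<noteq> 0" for n m
  proof -
    have "f x * cnj (trig_fun 0 1 (n, m) x) = 0" for x
      using E(2) translates_disjoint[of x 0 m 1 0] that
      by (auto simp: f_def trig_fun_def indicator_def)
    then show ?thesis
      by (simp only: c_def L2_inner_def) simp
  qed
  define I where "I k = {n. (n, 0) \<in> ?i ` {..<k}}" for k
  have fin: "finite (I k)" for k
  proof (rule finite_subset)
    show "I k \<subseteq> fst ` ?i ` {..<k}"
    proof
      fix n assume "n \<in> I k"
      then have "(n, 0) \<in> ?i ` {..<k}"
        by (simp add: I_def)
      then show "n \<in> fst ` ?i ` {..<k}"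
        by (rule rev_image_eqI) simp
    qed
  qed simp
  have "(\<Sum>j<k. c (?i j) * trig_fun 0 1 (?i j) x)
      = of_real (indicator {0<..1} x) * (\<Sum>n\<in>I k. c (n, 0) * cis (2 * pi * of_int n * x))" for k x
  proof -
    have "(\<Sum>j<k. c (?i j) * trig_fun 0 1 (?i j) x) = (\<Sum>i\<in>?i ` {..<k}. c i * trig_fun 0 1 i x)"
      using \<open>inj ?i\<close> by (subst sum.reindex) (auto intro: inj_on_subset)
    also have "\<dots> = (\<Sum>i\<in>(\<lambda>n. (n, 0)) ` I k. c i * trig_fun 0 1 i x)"
    proof (rule sum.mono_neutral_right)
      show "\<forall>i\<in>?i ` {..<k} - (\<lambda>n. (n, 0)) ` I k. c i * trig_fun 0 1 i x = 0"
      proof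
        fix i assume i: "i \<in> ?i ` {..<k} - (\<lambda>n. (n, 0)) ` I k"
        obtain n m where nm: "i = (n, m)"
          by fastforce
        with i have "m \<noteq> 0"
          by (auto simp: I_def)
        then show "c i * trig_fun 0 1 i x = 0"
          by (simp add: nm c0)
      qed
    qed (auto simp: I_def)
    also have "\<dots> = (\<Sum>n\<in>I k. c (n, 0) * trig_fun 0 1 (n, 0) x)"
      by (subst sum.reindex) (auto simp: inj_on_def)
    finally show ?thesis
      by (simp add: trig_fun_def sum_distrib_left mult_ac)
  qed
  moreover have "(\<lambda>k. L2_norm_sq lborel (\<lambda>x. f x - (\<Sum>j<k. c (?i j) * trig_fun 0 1 (?i j) x))) \<longlonglongrightarrow> 0"
    unfolding c_def
  proof (rule Fourier_expansion(1))
    show "L2_inner lborel (trig_fun 0 1 (?i m)) (trig_fun 0 1 (?i n)) = (if m = n then 1 else 0)" for m n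
      using \<open>inj ?i\<close> by (simp add: trig_fun_orthonormal inj_eq)
    show "AE x in lborel. h x = 0"
      if "h \<in> L2 lborel" "\<And>n. L2_inner lborel h (trig_fun 0 1 (?i n)) = 0" for h
      using that by (intro trig_fun_total_enum[of 1 h 0]) auto
  qed (use f trig_fun_L2 in auto)
  ultimately show thesis
    using that[of I "\<lambda>n. c (n, 0)"] fin by (simp add: f_def L2_norm_sq_diff_commute[of _ "\<lambda>x. of_real (indicator E x)"])
qed

section \<open>Folding and the Plancherel theorem on the line\<close>

text \<open>The translates of \<open>(0, P]\<close> by multiples of \<open>P\<close> tile the line.\<close>

lemma nn_integral_fold:
  fixes h :: "real \<Rightarrow> ennreal"
  assumes [measurable]: "h \<in> borel_measurable borel" and "P > 0"
  shows "(\<integral>\<^sup>+x. h x \<partial>lborel)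
    = (\<integral>\<^sup>+x. indicator {0<..P} x * (\<integral>\<^sup>+n. h (x - of_int n * P) \<partial>count_space (UNIV :: int set)) \<partial>lborel)"
proof -
  have "h x = (\<integral>\<^sup>+n. h x * indicator {0 - of_int n * P<..0 - of_int n * P + P} x \<partial>count_space (UNIV :: int set))" for x
  proof -
    obtain m where m: "x \<in> {0 + of_int m * P<..0 + of_int m * P + P}"
      using translates_cover[OF \<open>P > 0\<close>] by blast
    have "(\<integral>\<^sup>+n. h x * indicator {0 - of_int n * P<..0 - of_int n * P + P} x \<partial>count_space (UNIV :: int set))
        = (\<Sum>n\<in>{-m}. h x * indicator {0 - of_int n * P<..0 - of_int n * P + P} x)"
    proof (rule nn_integral_count_space')
      fix n assume n: "n \<notin> {- m}"
      have "x \<notin> {0 - of_int n * P<..0 - of_int n * P + P}"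
        using translates_disjoint[OF m _ \<open>P > 0\<close>, of "-n"] n by auto
      then show "h x * indicator {0 - of_int n * P<..0 - of_int n * P + P} x = 0"
        by simp
    qed auto
    also have "\<dots> = h x"
      using m by simp
    finally show ?thesis ..
  qed
  then have "(\<integral>\<^sup>+x. h x \<partial>lborel)
      = (\<integral>\<^sup>+x. \<integral>\<^sup>+n. h x * indicator {0 - of_int n * P<..0 - of_int n * P + P} x \<partial>count_space (UNIV :: int set) \<partial>lborel)"
    by (intro nn_integral_cong)
  also have "\<dots> = (\<integral>\<^sup>+n. \<integral>\<^sup>+x. h x * indicator {0 - of_int n * P<..0 - of_int n * P + P} x \<partial>lborel \<partial>count_space (UNIV :: int set))"
    by (rule nn_integral_count_space_nn_integral) auto
  also have "\<dots> = (\<integral>\<^sup>+n. \<integral>\<^sup>+x. indicator {0<..P} x * h (x - of_int n * P) \<partial>lborel \<partial>count_space (UNIV :: int set))"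
  proof (rule nn_integral_cong)
    fix n :: int
    show "(\<integral>\<^sup>+x. h x * indicator {0 - of_int n * P<..0 - of_int n * P + P} x \<partial>lborel)
        = (\<integral>\<^sup>+x. indicator {0<..P} x * h (x - of_int n * P) \<partial>lborel)"
      by (subst nn_integral_real_affine[where c=1 and t="- of_int n * P"])
         (auto intro!: nn_integral_cong simp: indicator_def)
  qed
  also have "\<dots> = (\<integral>\<^sup>+x. \<integral>\<^sup>+n. indicator {0<..P} x * h (x - of_int n * P) \<partial>count_space (UNIV :: int set) \<partial>lborel)"
    by (rule nn_integral_count_space_nn_integral[symmetric]) auto
  finally show ?thesis
    by (simp add: nn_integral_cmult)
qed

text \<open>A countable union of translates of a null set is a null set.\<close>

lemma AE_fold:
  assumes "AE x in lborel. Q (x :: real)"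
  shows "AE x in lborel. \<forall>n::int. Q (x - of_int n)"
proof -
  obtain N where N: "N \<in> null_sets lborel" "{x. \<not> Q x} \<subseteq> N"
    using assms by (auto simp: eventually_ae_filter)
  have "AE x in lborel. x - of_int n \<notin> N" for n :: int
  proof -
    have "emeasure lborel ((\<lambda>x. - of_int n + x) -` N \<inter> space lborel) = emeasure (distr lborel borel ((+) (- of_int n))) N"
      using N(1) by (subst emeasure_distr) auto
    also have "\<dots> = 0"
      using N(1) by (auto simp: lborel_distr_plus)
    finally have "(\<lambda>x. - of_int n + x) -` N \<in> null_sets lborel"
      using null_setsD2[OF N(1)] measurable_sets[of "\<lambda>x. - of_int n + x" borel borel N]
      by (intro null_setsI) auto
    from AE_not_in[OF this] show ?thesis
      by eventually_elim auto
  qed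
  then have "AE x in lborel. \<forall>n::int. x - of_int n \<notin> N"
    by (simp add: AE_all_countable)
  then show ?thesis
  proof eventually_elim
    case (elim x)
    then show ?case
      using N(2) by blast
  qed
qed

definition fourier :: "(real \<Rightarrow> complex) \<Rightarrow> real \<Rightarrow> complex" where
  "fourier f \<omega> = (LINT t|lborel. f t * cis (2 * pi * \<omega> * t))"

lemma measurable_fourier:
  assumes [measurable]: "f \<in> borel_measurable lborel"
  shows "fourier f \<in> borel_measurable lborel"
  unfolding fourier_def by measurable

text \<open>For \<open>f\<close> supported in an interval of length \<open>L\<close>, the values of its transform along \<open>\<omega> + \<int> / L\<close> are, up to
  the factor \<open>sqrt L\<close>, the Fourier coefficients of \<open>f\<close> modulated by \<open>\<omega>\<close>. Parseval's identity
  thus evaluates the sum of their squares independently of \<open>\<omega>\<close>, and integration over one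
  period gives the Plancherel formula.\<close>

lemma Plancherel_bounded_support:
  assumes "L > 0" and f: "f \<in> L2 lborel" and off: "\<And>x. x \<notin> {a<..a + L} \<Longrightarrow> f x = 0"
  shows "sqnorm lborel (fourier f) = sqnorm lborel f"
proof -
  have [measurable]: "f \<in> borel_measurable borel"
    using L2_measurable[OF f] by simp
  have [measurable]: "fourier f \<in> borel_measurable borel"
    using measurable_fourier[of f] by simp
  have periodic_sum: "(\<integral>\<^sup>+n. ennreal ((cmod (fourier f (\<omega> - of_int n * (1 / L))))\<^sup>2) \<partial>count_space (UNIV :: int set))
      = ennreal L * sqnorm lborel f" for \<omega>
  proof -
    \<comment> \<open>Modulation by \<open>\<omega>\<close> shifts the Fourier coefficients of \<open>f\<close> off the lattice of frequencies \<open>n / L\<close>.\<close>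
    define h where "h x = f x * cis (2 * pi * \<omega> * x)" for x
    have [measurable]: "h \<in> borel_measurable borel"
      unfolding h_def[abs_def] by measurable
    have h: "h \<in> L2 lborel"
      by (rule L2_dominated[OF _ f]) (auto simp: h_def norm_mult)
    have coeff: "ennreal ((cmod (L2_inner lborel h (trig_fun a L (n, m))))\<^sup>2)
      = (if m = 0 then ennreal (1 / L) * ennreal ((cmod (fourier f (\<omega> - of_int n * (1 / L))))\<^sup>2) else 0)" for n m
    proof (cases "m = 0")
      case True
      have "h x * cnj (trig_fun a L (n, m) x) = of_real (1 / sqrt L) * (f x * cis (2 * pi * (\<omega> - of_int n * (1 / L)) * x))" for x
        using off[of x] True
        by (auto simp: h_def trig_fun_def indicator_def cis_cnj cis_mult right_diff_distrib left_diff_distrib)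
      then have "L2_inner lborel h (trig_fun a L (n, m)) = of_real (1 / sqrt L) * fourier f (\<omega> - of_int n * (1 / L))"
        by (simp only: L2_inner_def fourier_def integral_mult_right_zero)
      then show ?thesis
        using True \<open>L > 0\<close> by (simp add: norm_mult norm_divide power_mult_distrib power_divide flip: ennreal_mult)
    next
      case False
      have "h x * cnj (trig_fun a L (n, m) x) = 0" for x
        using off[of x] False translates_disjoint[OF _ _ \<open>L > 0\<close>, of x a m 0]
        by (auto simp: h_def trig_fun_def indicator_def)
      then have "L2_inner lborel h (trig_fun a L (n, m)) = 0"
        by (simp only: L2_inner_def) simp
      then show ?thesis
        using False by simp
    qed
    have "sqnorm lborel f = sqnorm lborel h"
      by (simp add: sqnorm_def h_def norm_mult)
    also have "\<dots> = (\<integral>\<^sup>+i. ennreal ((cmod (L2_inner lborel h (trig_fun a L i)))\<^sup>2) \<partial>count_space UNIV)"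
      by (rule Parseval_trig[OF \<open>L > 0\<close> h, symmetric])
    also have "\<dots> = (\<integral>\<^sup>+n. \<integral>\<^sup>+m. ennreal ((cmod (L2_inner lborel h (trig_fun a L (n, m))))\<^sup>2)
        \<partial>count_space (UNIV :: int set) \<partial>count_space (UNIV :: int set))"
      by (rule nn_integral_fst_count_space[symmetric])
    also have "\<dots> = (\<integral>\<^sup>+n. ennreal (1 / L) * ennreal ((cmod (fourier f (\<omega> - of_int n * (1 / L))))\<^sup>2)
        \<partial>count_space (UNIV :: int set))"
    proof (intro nn_integral_cong)
      fix n :: int
      show "(\<integral>\<^sup>+m. ennreal ((cmod (L2_inner lborel h (trig_fun a L (n, m))))\<^sup>2) \<partial>count_space (UNIV :: int set))
          = ennreal (1 / L) * ennreal ((cmod (fourier f (\<omega> - of_int n * (1 / L))))\<^sup>2)"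
        by (subst nn_integral_count_space'[of "{0}"]) (auto simp: coeff)
    qed
    also have "\<dots> = ennreal (1 / L) * (\<integral>\<^sup>+n. ennreal ((cmod (fourier f (\<omega> - of_int n * (1 / L))))\<^sup>2)
        \<partial>count_space (UNIV :: int set))"
      by (rule nn_integral_cmult) simp
    finally show ?thesis
      using \<open>L > 0\<close> by (simp add: mult.assoc[symmetric] flip: ennreal_mult)
  qed
  have "sqnorm lborel (fourier f) = (\<integral>\<^sup>+\<omega>. indicator {0<..1 / L} \<omega> *
      (\<integral>\<^sup>+n. ennreal ((cmod (fourier f (\<omega> - of_int n * (1 / L))))\<^sup>2) \<partial>count_space (UNIV :: int set)) \<partial>lborel)"
    unfolding sqnorm_def using \<open>L > 0\<close> by (intro nn_integral_fold) auto
  also have "\<dots> = (\<integral>\<^sup>+\<omega>. (ennreal L * sqnorm lborel f) * indicator {0<..1 / L} \<omega> \<partial>lborel)"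
    by (simp only: periodic_sum mult.commute)
  also have "\<dots> = sqnorm lborel f"
  proof -
    have "ennreal L * ennreal (1 / L) = 1"
      using \<open>L > 0\<close> by (simp flip: ennreal_mult)
    then show ?thesis
      using \<open>L > 0\<close>
      by (subst nn_integral_cmult_indicator) (auto simp: mult.assoc mult.left_commute[of "ennreal L"])
  qed
  finally show ?thesis .
qed

lemma L2_truncate:
  assumes f: "f \<in> L2 M" and A: "\<And>n::nat. A n \<in> sets M"
    and ev: "\<And>x. x \<in> space M \<Longrightarrow> eventually (\<lambda>n. x \<in> A n) sequentially"
  shows "(\<lambda>x. of_real (indicator (A n) x) * f x) \<in> L2 M"
    and "(\<lambda>n. L2_norm_sq M (\<lambda>x. of_real (indicator (A n) x) * f x - f x)) \<longlonglongrightarrow> 0"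
proof -
  have [measurable]: "f \<in> borel_measurable M" "\<And>n. A n \<in> sets M"
    using L2_measurable[OF f] A by auto
  show "(\<lambda>x. of_real (indicator (A n) x) * f x) \<in> L2 M"
    by (rule L2_dominated[OF _ f]) (auto simp: indicator_def)
  have "(\<lambda>n. LINT x|M. (cmod (of_real (indicator (A n) x) * f x - f x))\<^sup>2) \<longlonglongrightarrow> (LINT x|M. 0)"
  proof (rule integral_dominated_convergence[where w="\<lambda>x. (cmod (f x))\<^sup>2"])
    show "integrable M (\<lambda>x. (cmod (f x))\<^sup>2)"
      using f by (simp add: L2_def)
    show "AE x in M. (\<lambda>n. (cmod (of_real (indicator (A n) x) * f x - f x))\<^sup>2) \<longlonglongrightarrow> 0"
    proof (rule AE_I2)
      fix x assume "x \<in> space M"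
      then show "(\<lambda>n. (cmod (of_real (indicator (A n) x) * f x - f x))\<^sup>2) \<longlonglongrightarrow> 0"
        by (intro tendsto_eventually, elim eventually_mono[OF ev]) simp
    qed
    show "AE x in M. norm ((cmod (of_real (indicator (A n) x) * f x - f x))\<^sup>2) \<le> (cmod (f x))\<^sup>2" for n
      by (intro AE_I2) (auto simp: indicator_def)
  qed auto
  then show "(\<lambda>n. L2_norm_sq M (\<lambda>x. of_real (indicator (A n) x) * f x - f x)) \<longlonglongrightarrow> 0"
    by (simp add: L2_norm_sq_def)
qed

lemma integrable_mult_cis:
  assumes "integrable lborel f"
  shows "integrable lborel (\<lambda>t. f t * cis (c * t))"
  using assms by (rule integrable_mult_bounded[of _ _ _ 1]) auto

lemma fourier_diff:
  assumes "integrable lborel f" "integrable lborel g"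
  shows "fourier (\<lambda>t. f t - g t) \<omega> = fourier f \<omega> - fourier g \<omega>"
  using integrable_mult_cis[OF assms(1), of "2 * pi * \<omega>"] integrable_mult_cis[OF assms(2), of "2 * pi * \<omega>"]
  by (simp add: fourier_def left_diff_distrib)

text \<open>The restriction to bounded support is removed by cut-offs \<open>tr f n\<close>. Their transforms converge
  pointwise to that of \<open>f\<close> because \<open>f\<close> is integrable, so Fatou's lemma gives the inequality \<open>\<le>\<close>;
  applied to \<open>tr f n - f\<close> it shows convergence in the mean, and the equality passes to the limit.\<close>

theorem Plancherel:
  assumes int: "integrable lborel f" and f: "f \<in> L2 lborel"
  shows "sqnorm lborel (fourier f) = sqnorm lborel f"
proof -
  define I where "I n = {- real (Suc n)<..real (Suc n)}" for n
  have [measurable]: "I n \<in> sets borel" for n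
    by (simp add: I_def)
  have ev: "eventually (\<lambda>n. x \<in> I n) sequentially" for x
  proof -
    obtain n0 where n0: "\<bar>x\<bar> < real n0"
      using reals_Archimedean2 by blast
    show ?thesis
      using eventually_ge_at_top[of n0] by eventually_elim (use n0 in \<open>auto simp: I_def\<close>)
  qed
  define tr where "tr h n x = of_real (indicator (I n) x) * h x" for h :: "real \<Rightarrow> complex" and n x
  have trI: "integrable lborel (tr h n)" if "integrable lborel h" for h n
    using integrable_mult_bounded[OF that, of "\<lambda>x. of_real (indicator (I n) x)" 1]
    by (simp add: tr_def[abs_def] mult.commute)
  have tr2: "tr h n \<in> L2 lborel" "(\<lambda>n. L2_norm_sq lborel (\<lambda>x. tr h n x - h x)) \<longlonglongrightarrow> 0" if "h \<in> L2 lborel" for h n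
    unfolding tr_def[abs_def] using L2_truncate[OF that, of I] ev by auto
  have tr_eq: "sqnorm lborel (fourier (tr h n)) = sqnorm lborel (tr h n)" if "h \<in> L2 lborel" for h n
    using that by (intro Plancherel_bounded_support[of "2 * real (Suc n)" _ "- real (Suc n)"] tr2)
      (auto simp: tr_def I_def)
  have le: "sqnorm lborel (fourier h) \<le> sqnorm lborel h" if h: "integrable lborel h" "h \<in> L2 lborel" for h
  proof -
    have [measurable]: "h \<in> borel_measurable borel" "\<And>n. fourier (tr h n) \<in> borel_measurable borel"
      using L2_measurable[OF h(2)] measurable_fourier L2_measurable[OF tr2(1)[OF h(2)]] by auto
    have conv: "(\<lambda>n. fourier (tr h n) \<omega>) \<longlonglongrightarrow> fourier h \<omega>" for \<omega>
      unfolding fourier_def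
    proof (rule integral_dominated_convergence[where w="\<lambda>x. cmod (h x)"])
      show "AE x in lborel. (\<lambda>n. tr h n x * cis (2 * pi * \<omega> * x)) \<longlonglongrightarrow> h x * cis (2 * pi * \<omega> * x)"
      proof (rule AE_I2)
        fix x
        show "(\<lambda>n. tr h n x * cis (2 * pi * \<omega> * x)) \<longlonglongrightarrow> h x * cis (2 * pi * \<omega> * x)"
          by (rule tendsto_eventually, rule eventually_mono[OF ev[of x]]) (simp add: tr_def)
      qed
    qed (use h in \<open>auto simp: tr_def norm_mult indicator_def\<close>)
    have "sqnorm lborel (fourier h) = (\<integral>\<^sup>+\<omega>. liminf (\<lambda>n. ennreal ((cmod (fourier (tr h n) \<omega>))\<^sup>2)) \<partial>lborel)"
      unfolding sqnorm_def
    proof (intro nn_integral_cong)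
      fix \<omega>
      have "(\<lambda>n. ennreal ((cmod (fourier (tr h n) \<omega>))\<^sup>2)) \<longlonglongrightarrow> ennreal ((cmod (fourier h \<omega>))\<^sup>2)"
        by (intro tendsto_intros conv)
      from lim_imp_Liminf[OF trivial_limit_sequentially this]
      show "ennreal ((cmod (fourier h \<omega>))\<^sup>2) = liminf (\<lambda>n. ennreal ((cmod (fourier (tr h n) \<omega>))\<^sup>2))"
        by simp
    qed
    also have "\<dots> \<le> liminf (\<lambda>n. sqnorm lborel (fourier (tr h n)))"
      unfolding sqnorm_def by (rule nn_integral_liminf) simp
    also have "\<dots> \<le> sqnorm lborel h"
      using tr_eq[OF h(2)]
      by (intro Liminf_le always_eventually allI)
         (auto simp: sqnorm_def tr_def indicator_def intro!: nn_integral_mono)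
    finally show ?thesis .
  qed
  have F: "fourier f \<in> L2 lborel" "fourier (tr f n) \<in> L2 lborel" for n
    using le[OF int f] le[OF trI[OF int] tr2(1)[OF f], of n] f tr2(1)[OF f, of n] measurable_fourier
    by (auto simp: L2_iff intro: le_less_trans)
  have "(\<lambda>n. L2_norm_sq lborel (\<lambda>x. fourier (tr f n) x - fourier f x)) \<longlonglongrightarrow> 0"
  proof (rule tendsto_sandwich[OF _ _ tendsto_const tr2(2)[OF f]])
    have "L2_norm_sq lborel (\<lambda>x. fourier (tr f n) x - fourier f x) \<le> L2_norm_sq lborel (\<lambda>x. tr f n x - f x)" for n
      using le[of "\<lambda>x. tr f n x - f x"] trI[OF int, of n] tr2(1)[OF f, of n] int f F
      by (simp add: fourier_diff[OF trI[OF int] int, abs_def] sqnorm_conv L2_diff L2_norm_sq_nonneg)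
    then show "\<forall>\<^sub>F n in sequentially. L2_norm_sq lborel (\<lambda>x. fourier (tr f n) x - fourier f x)
        \<le> L2_norm_sq lborel (\<lambda>x. tr f n x - f x)"
      by simp
  qed (simp add: L2_norm_sq_nonneg)
  then have "(\<lambda>n. L2_norm_sq lborel (fourier (tr f n))) \<longlonglongrightarrow> L2_norm_sq lborel (fourier f)"
    by (intro tendsto_L2_norm_sq F)
  moreover have "(\<lambda>n. L2_norm_sq lborel (tr f n)) \<longlonglongrightarrow> L2_norm_sq lborel f"
    by (intro tendsto_L2_norm_sq tr2 f)
  moreover have "L2_norm_sq lborel (fourier (tr f n)) = L2_norm_sq lborel (tr f n)" for n
    using L2_norm_sq_conv[OF L2_measurable[OF F(2)[of n]]] L2_norm_sq_conv[OF L2_measurable[OF tr2(1)[OF f]], of n]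
    by (simp only: tr_eq[OF f, of n])
  ultimately have "L2_norm_sq lborel (fourier f) = L2_norm_sq lborel f"
    using LIMSEQ_unique by simp
  then show ?thesis
    using F f by (simp add: sqnorm_conv)
qed

section \<open>The partial Fourier transform\<close>

text \<open>Functions on \<open>M \<times> \<real>\<close> are transformed in the real variable, with the point of \<open>M\<close> as a parameter.
  The predicate \<open>is_pft\<close> characterises the continuous extension to square-integrable functions, as the limit of
  the transforms of cut-offs. The Fourier integral itself is meaningful for \<open>fibre_integrable\<close> functions.
  With \<open>M\<close> the plane this is the transform in the centre of the Heisenberg group, with \<open>M = \<real>\<close> the one in
  the kernel of the Weyl transform.\<close>

definition partial_fourier :: "('a \<times> real \<Rightarrow> complex) \<Rightarrow> 'a \<times> real \<Rightarrow> complex" where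
  "partial_fourier f z = fourier (\<lambda>t. f (fst z, t)) (snd z)"

definition cutoff :: "nat \<Rightarrow> ('a \<times> real \<Rightarrow> complex) \<Rightarrow> 'a \<times> real \<Rightarrow> complex" where
  "cutoff n f z = of_real (indicator {- real n..real n} (snd z)) * f z"

definition is_pft :: "'a measure \<Rightarrow> ('a \<times> real \<Rightarrow> complex) \<Rightarrow> ('a \<times> real \<Rightarrow> complex) \<Rightarrow> bool" where
  "is_pft M f F \<longleftrightarrow> F \<in> L2 (M \<Otimes>\<^sub>M lborel) \<and>
     (\<lambda>n. L2_norm_sq (M \<Otimes>\<^sub>M lborel) (\<lambda>z. F z - partial_fourier (cutoff n f) z)) \<longlonglongrightarrow> 0"

definition fibre_integrable :: "'a measure \<Rightarrow> ('a \<times> real \<Rightarrow> complex) \<Rightarrow> bool" where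
  "fibre_integrable M f \<longleftrightarrow> f \<in> L2 (M \<Otimes>\<^sub>M lborel) \<and> (AE p in M. integrable lborel (\<lambda>t. f (p, t)))"

lemma measurable_partial_fourier:
  assumes [measurable]: "f \<in> borel_measurable (M \<Otimes>\<^sub>M lborel)"
  shows "partial_fourier f \<in> borel_measurable (M \<Otimes>\<^sub>M lborel)"
  unfolding partial_fourier_def[abs_def] fourier_def by measurable

lemma sqnorm_fibres:
  assumes [measurable]: "f \<in> borel_measurable (M \<Otimes>\<^sub>M lborel)"
  shows "sqnorm (M \<Otimes>\<^sub>M lborel) f = (\<integral>\<^sup>+p. sqnorm lborel (\<lambda>t. f (p, t)) \<partial>M)"
  unfolding sqnorm_def by (subst lborel.nn_integral_fst[symmetric]) auto

lemma L2_fibres: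
  assumes f: "f \<in> L2 (M \<Otimes>\<^sub>M lborel)"
  shows "AE p in M. (\<lambda>t. f (p, t)) \<in> L2 lborel"
proof -
  have m[measurable]: "f \<in> borel_measurable (M \<Otimes>\<^sub>M lborel)"
    using f by (rule L2_measurable)
  have "(\<integral>\<^sup>+p. sqnorm lborel (\<lambda>t. f (p, t)) \<partial>M) \<noteq> \<infinity>"
    using f by (simp add: sqnorm_fibres[OF m, symmetric] L2_iff)
  then have "AE p in M. sqnorm lborel (\<lambda>t. f (p, t)) \<noteq> \<infinity>"
    by (intro nn_integral_PInf_AE) (auto simp: sqnorm_def)
  then show ?thesis
    using AE_space by eventually_elim (auto simp: L2_iff less_top)
qed

text \<open>Plancherel's theorem on almost every fibre, integrated over \<open>M\<close>.\<close>

lemma fibre_integrable_isometry: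
  assumes f: "fibre_integrable M f"
  shows "partial_fourier f \<in> L2 (M \<Otimes>\<^sub>M lborel)"
    and "L2_norm_sq (M \<Otimes>\<^sub>M lborel) (partial_fourier f) = L2_norm_sq (M \<Otimes>\<^sub>M lborel) f"
proof -
  have fL2: "f \<in> L2 (M \<Otimes>\<^sub>M lborel)" and int: "AE p in M. integrable lborel (\<lambda>t. f (p, t))"
    using f by (auto simp: fibre_integrable_def)
  note m = L2_measurable[OF fL2] and m' = measurable_partial_fourier[OF L2_measurable[OF fL2]]
  have "sqnorm (M \<Otimes>\<^sub>M lborel) (partial_fourier f) = (\<integral>\<^sup>+p. sqnorm lborel (fourier (\<lambda>t. f (p, t))) \<partial>M)"
    by (simp add: sqnorm_fibres[OF m'] partial_fourier_def)
  also have "\<dots> = (\<integral>\<^sup>+p. sqnorm lborel (\<lambda>t. f (p, t)) \<partial>M)"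
    by (rule nn_integral_cong_AE, use int L2_fibres[OF fL2] in eventually_elim) (rule Plancherel)
  also have "\<dots> = sqnorm (M \<Otimes>\<^sub>M lborel) f"
    by (rule sqnorm_fibres[OF m, symmetric])
  finally have eq: "sqnorm (M \<Otimes>\<^sub>M lborel) (partial_fourier f) = sqnorm (M \<Otimes>\<^sub>M lborel) f" .
  with fL2 m' show "partial_fourier f \<in> L2 (M \<Otimes>\<^sub>M lborel)"
    by (simp add: L2_iff)
  show "L2_norm_sq (M \<Otimes>\<^sub>M lborel) (partial_fourier f) = L2_norm_sq (M \<Otimes>\<^sub>M lborel) f"
    using eq by (simp add: L2_norm_sq_conv m m')
qed

lemma fibre_integrable_diff:
  assumes "fibre_integrable M f" "fibre_integrable M g"
  shows "fibre_integrable M (\<lambda>z. f z - g z)"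
  using assms by (auto simp: fibre_integrable_def intro: L2_diff)

lemma partial_fourier_diff:
  assumes f: "fibre_integrable M f" and g: "fibre_integrable M g"
  shows "L2_norm_sq (M \<Otimes>\<^sub>M lborel) (\<lambda>z. partial_fourier f z - partial_fourier g z)
    = L2_norm_sq (M \<Otimes>\<^sub>M lborel) (\<lambda>z. f z - g z)"
proof -
  have "L2_norm_sq (M \<Otimes>\<^sub>M lborel) (\<lambda>z. f z - g z)
      = L2_norm_sq (M \<Otimes>\<^sub>M lborel) (partial_fourier (\<lambda>z. f z - g z))"
    by (rule fibre_integrable_isometry(2)[OF fibre_integrable_diff[OF f g], symmetric])
  also have "\<dots> = L2_norm_sq (M \<Otimes>\<^sub>M lborel) (\<lambda>z. partial_fourier f z - partial_fourier g z)"
  proof -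
    note mf = fibre_integrable_isometry(1)[OF f, THEN L2_measurable]
      and mg = fibre_integrable_isometry(1)[OF g, THEN L2_measurable]
      and md = fibre_integrable_isometry(1)[OF fibre_integrable_diff[OF f g], THEN L2_measurable]
    have "AE p in M. integrable lborel (\<lambda>t. f (p, t)) \<and> integrable lborel (\<lambda>t. g (p, t))"
      using f g by (auto simp: fibre_integrable_def)
    then have "AE p in M. sqnorm lborel (\<lambda>t. partial_fourier (\<lambda>z. f z - g z) (p, t))
        = sqnorm lborel (\<lambda>t. partial_fourier f (p, t) - partial_fourier g (p, t))"
      by eventually_elim (simp add: partial_fourier_def fourier_diff)
    then have "sqnorm (M \<Otimes>\<^sub>M lborel) (partial_fourier (\<lambda>z. f z - g z))
        = sqnorm (M \<Otimes>\<^sub>M lborel) (\<lambda>z. partial_fourier f z - partial_fourier g z)"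
      using mf mg by (simp add: sqnorm_fibres[OF md] sqnorm_fibres[OF borel_measurable_diff[OF mf mg]]
            cong: nn_integral_cong_AE)
    then show ?thesis
      using mf mg md by (simp add: L2_norm_sq_conv)
  qed
  finally show ?thesis ..
qed

text \<open>On a set of finite measure, square-integrability implies integrability.\<close>

lemma fibre_integrable_window:
  assumes f: "f \<in> L2 (M \<Otimes>\<^sub>M lborel)" and A: "A \<in> sets (M \<Otimes>\<^sub>M lborel)"
    and fin: "\<And>p. p \<in> space M \<Longrightarrow> emeasure lborel (Pair p -` A) < \<infinity>"
  shows "fibre_integrable M (\<lambda>z. of_real (indicator A z) * f z)"
proof -
  have "(\<lambda>z. of_real (indicator A z) * f z) \<in> L2 (M \<Otimes>\<^sub>M lborel)"
    by (rule L2_dominated[OF _ f]) (use A f in \<open>auto simp: indicator_def dest: L2_measurable\<close>)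
  moreover have "AE p in M. integrable lborel (\<lambda>t. of_real (indicator A (p, t)) * f (p, t))"
    using L2_fibres[OF f] AE_space
  proof eventually_elim
    case (elim p)
    have "(\<lambda>t. complex_of_real (indicator (Pair p -` A) t)) \<in> L2 lborel"
      using A fin[OF elim(2)] by (intro indicator_L2) (auto dest: sets_Pair1)
    from L2_integrable_mult[OF elim(1) this] show ?case
      by (simp add: mult.commute indicator_def)
  qed
  ultimately show ?thesis
    by (simp add: fibre_integrable_def)
qed

lemma strip_measurable:
  "{z \<in> space (M \<Otimes>\<^sub>M (lborel :: real measure)). snd z \<in> {a..b}} \<in> sets (M \<Otimes>\<^sub>M lborel)"
  by measurable

lemma cutoff_approx:
  assumes f: "f \<in> L2 (M \<Otimes>\<^sub>M lborel)"
  shows "fibre_integrable M (cutoff n f)"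
    and "(\<lambda>n. L2_norm_sq (M \<Otimes>\<^sub>M lborel) (\<lambda>z. cutoff n f z - f z)) \<longlonglongrightarrow> 0"
proof -
  define A where "A n = {z \<in> space (M \<Otimes>\<^sub>M (lborel :: real measure)). snd z \<in> {- real n..real n}}" for n
  have A: "A n \<in> sets (M \<Otimes>\<^sub>M lborel)" for n
    unfolding A_def by (rule strip_measurable)
  have cut: "cutoff n f z = of_real (indicator (A n) z) * f z" if "z \<in> space (M \<Otimes>\<^sub>M lborel)" for n z
    using that by (simp add: cutoff_def A_def indicator_def)
  have "fibre_integrable M (\<lambda>z. of_real (indicator (A n) z) * f z)"
  proof (rule fibre_integrable_window[OF f A])
    fix p assume "p \<in> space M"
    then have "Pair p -` A n = {- real n..real n}"
      by (auto simp: A_def space_pair_measure)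
    then show "emeasure lborel (Pair p -` A n) < \<infinity>"
      by simp
  qed
  moreover have "cutoff n f \<in> borel_measurable (M \<Otimes>\<^sub>M lborel)"
    using L2_measurable[OF f] unfolding cutoff_def[abs_def] by measurable
  moreover have "AE p in M. integrable lborel (\<lambda>t. cutoff n f (p, t)) \<longleftrightarrow>
      integrable lborel (\<lambda>t. of_real (indicator (A n) (p, t)) * f (p, t))"
    using AE_space by eventually_elim (simp add: cut space_pair_measure)
  moreover have "sqnorm (M \<Otimes>\<^sub>M lborel) (cutoff n f) = sqnorm (M \<Otimes>\<^sub>M lborel) (\<lambda>z. of_real (indicator (A n) z) * f z)"
    by (intro sqnorm_cong cut)
  ultimately show "fibre_integrable M (cutoff n f)"
    by (auto simp: fibre_integrable_def L2_iff elim: eventually_elim2)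
  have "(\<lambda>n. L2_norm_sq (M \<Otimes>\<^sub>M lborel) (\<lambda>z. of_real (indicator (A n) z) * f z - f z)) \<longlonglongrightarrow> 0"
  proof (rule L2_truncate(2)[OF f A])
    fix z assume z: "z \<in> space (M \<Otimes>\<^sub>M (lborel :: real measure))"
    obtain n0 where n0: "\<bar>snd z\<bar> < real n0"
      using reals_Archimedean2 by blast
    show "\<forall>\<^sub>F n in sequentially. z \<in> A n"
      using eventually_ge_at_top[of n0] by eventually_elim (use n0 z in \<open>auto simp: A_def\<close>)
  qed
  then show "(\<lambda>n. L2_norm_sq (M \<Otimes>\<^sub>M lborel) (\<lambda>z. cutoff n f z - f z)) \<longlonglongrightarrow> 0"
    unfolding L2_norm_sq_def by (simp add: cut cong: Bochner_Integration.integral_cong)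
qed

lemma L2_tendsto_triangle:
  assumes "\<And>n. f n \<in> L2 M" "\<And>n. g n \<in> L2 M" "\<And>n. h n \<in> L2 M"
    and "((\<lambda>n. L2_norm_sq M (\<lambda>x. f n x - g n x)) \<longlongrightarrow> 0) F"
    and "((\<lambda>n. L2_norm_sq M (\<lambda>x. g n x - h n x)) \<longlongrightarrow> 0) F"
  shows "((\<lambda>n. L2_norm_sq M (\<lambda>x. f n x - h n x)) \<longlongrightarrow> 0) F"
proof (rule tendsto_sandwich[OF _ _ tendsto_const])
  show "\<forall>\<^sub>F n in F. L2_norm_sq M (\<lambda>x. f n x - h n x)
      \<le> 2 * L2_norm_sq M (\<lambda>x. f n x - g n x) + 2 * L2_norm_sq M (\<lambda>x. g n x - h n x)"
    using assms by (intro always_eventually allI L2_norm_sq_diff_triangle)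
  have "((\<lambda>n. 2 * L2_norm_sq M (\<lambda>x. f n x - g n x) + 2 * L2_norm_sq M (\<lambda>x. g n x - h n x)) \<longlongrightarrow> 2 * 0 + 2 * 0) F"
    by (intro tendsto_intros assms)
  then show "((\<lambda>n. 2 * L2_norm_sq M (\<lambda>x. f n x - g n x) + 2 * L2_norm_sq M (\<lambda>x. g n x - h n x)) \<longlongrightarrow> 0) F"
    by simp
qed (simp add: L2_norm_sq_nonneg)

text \<open>By the isometry, cut-offs in the definition of the transform may be replaced by any fibrewise
  integrable approximation. This is what makes the transform compatible with maps that do not commute
  with the cut-offs.\<close>

lemma is_pft_approx:
  assumes f: "f \<in> L2 (M \<Otimes>\<^sub>M lborel)" and h: "\<And>n. fibre_integrable M (h n)"
    and hf: "(\<lambda>n. L2_norm_sq (M \<Otimes>\<^sub>M lborel) (\<lambda>z. h n z - f z)) \<longlonglongrightarrow> 0"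
  shows "is_pft M f F \<longleftrightarrow> F \<in> L2 (M \<Otimes>\<^sub>M lborel) \<and>
     (\<lambda>n. L2_norm_sq (M \<Otimes>\<^sub>M lborel) (\<lambda>z. F z - partial_fourier (h n) z)) \<longlonglongrightarrow> 0"
proof -
  have L: "h n \<in> L2 (M \<Otimes>\<^sub>M lborel)" "cutoff n f \<in> L2 (M \<Otimes>\<^sub>M lborel)" for n
    using h cutoff_approx(1)[OF f] by (auto simp: fibre_integrable_def)
  have "(\<lambda>n. L2_norm_sq (M \<Otimes>\<^sub>M lborel) (\<lambda>z. h n z - cutoff n f z)) \<longlonglongrightarrow> 0"
    using cutoff_approx(2)[OF f] hf
    by (intro L2_tendsto_triangle[OF L(1) f L(2)]) (simp_all add: L2_norm_sq_diff_commute[of _ f])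
  then have d: "(\<lambda>n. L2_norm_sq (M \<Otimes>\<^sub>M lborel) (\<lambda>z. partial_fourier (h n) z - partial_fourier (cutoff n f) z)) \<longlonglongrightarrow> 0"
    by (simp add: partial_fourier_diff[OF h cutoff_approx(1)[OF f]])
  then have d': "(\<lambda>n. L2_norm_sq (M \<Otimes>\<^sub>M lborel) (\<lambda>z. partial_fourier (cutoff n f) z - partial_fourier (h n) z)) \<longlonglongrightarrow> 0"
    by (subst L2_norm_sq_diff_commute)
  note P = fibre_integrable_isometry(1)[OF h] fibre_integrable_isometry(1)[OF cutoff_approx(1)[OF f]]
  show ?thesis
    unfolding is_pft_def using L2_tendsto_triangle[of "\<lambda>n. F", OF _ P(1) P(2) _ d]
      L2_tendsto_triangle[of "\<lambda>n. F", OF _ P(2) P(1) _ d']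
    by blast
qed

lemma is_pft_fibre_integrable:
  assumes "fibre_integrable M f"
  shows "is_pft M f (partial_fourier f)"
  using is_pft_approx[of f M "\<lambda>n. f"] assms fibre_integrable_isometry(1)[OF assms]
  by (simp add: fibre_integrable_def)

lemma is_pft_exists:
  assumes f: "f \<in> L2 (M \<Otimes>\<^sub>M lborel)"
  shows "\<exists>F. is_pft M f F"
proof -
  let ?N = "M \<Otimes>\<^sub>M (lborel :: real measure)"
  note c = cutoff_approx[OF f]
  have cL: "cutoff n f \<in> L2 ?N" for n
    using c(1)[of n] by (simp add: fibre_integrable_def)
  have "\<exists>N. \<forall>m\<ge>N. \<forall>n\<ge>N. L2_norm_sq ?N (\<lambda>z. partial_fourier (cutoff m f) z - partial_fourier (cutoff n f) z) < e"
    if "e > 0" for e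
  proof -
    obtain N where N: "\<And>n. n \<ge> N \<Longrightarrow> L2_norm_sq ?N (\<lambda>z. cutoff n f z - f z) < e / 4"
      using order_tendstoD(2)[OF c(2), of "e / 4"] \<open>e > 0\<close> by (auto simp: eventually_sequentially)
    have "L2_norm_sq ?N (\<lambda>z. cutoff m f z - cutoff n f z) < e" if "m \<ge> N" "n \<ge> N" for m n
      using L2_norm_sq_diff_triangle[OF cL[of m] f cL[of n]] N[OF that(1)] N[OF that(2)]
        L2_norm_sq_diff_commute[of ?N f "cutoff n f"] by linarith
    then show ?thesis
      by (auto simp: partial_fourier_diff[OF c(1) c(1)])
  qed
  then obtain F where "F \<in> L2 ?N" "(\<lambda>n. L2_norm_sq ?N (\<lambda>z. partial_fourier (cutoff n f) z - F z)) \<longlonglongrightarrow> 0"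
    using L2_complete[of "\<lambda>n. partial_fourier (cutoff n f)" ?N] fibre_integrable_isometry(1)[OF c(1)] by blast
  then show ?thesis
    by (auto simp: is_pft_def L2_norm_sq_diff_commute[of _ F])
qed

lemma is_pft_isometry:
  assumes f: "f \<in> L2 (M \<Otimes>\<^sub>M lborel)" and F: "is_pft M f F"
  shows "L2_norm_sq (M \<Otimes>\<^sub>M lborel) F = L2_norm_sq (M \<Otimes>\<^sub>M lborel) f"
proof -
  note c = cutoff_approx[OF f]
  have cL: "cutoff n f \<in> L2 (M \<Otimes>\<^sub>M lborel)" for n
    using c(1)[of n] by (simp add: fibre_integrable_def)
  have FL: "F \<in> L2 (M \<Otimes>\<^sub>M lborel)"
    and lim: "(\<lambda>n. L2_norm_sq (M \<Otimes>\<^sub>M lborel) (\<lambda>z. partial_fourier (cutoff n f) z - F z)) \<longlonglongrightarrow> 0"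
    using F by (auto simp: is_pft_def L2_norm_sq_diff_commute[of _ F])
  have "(\<lambda>n. L2_norm_sq (M \<Otimes>\<^sub>M lborel) (partial_fourier (cutoff n f))) \<longlonglongrightarrow> L2_norm_sq (M \<Otimes>\<^sub>M lborel) F"
    by (rule tendsto_L2_norm_sq[OF fibre_integrable_isometry(1)[OF c(1)] FL lim])
  moreover have "(\<lambda>n. L2_norm_sq (M \<Otimes>\<^sub>M lborel) (cutoff n f)) \<longlonglongrightarrow> L2_norm_sq (M \<Otimes>\<^sub>M lborel) f"
    by (rule tendsto_L2_norm_sq[OF cL f c(2)])
  ultimately show ?thesis
    by (simp add: fibre_integrable_isometry(2)[OF c(1)] LIMSEQ_unique)
qed

lemma is_pft_diff:
  assumes f: "f \<in> L2 (M \<Otimes>\<^sub>M lborel)" and g: "g \<in> L2 (M \<Otimes>\<^sub>M lborel)"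
    and F: "is_pft M f F" and G: "is_pft M g G"
  shows "is_pft M (\<lambda>z. f z - g z) (\<lambda>z. F z - G z)"
proof -
  let ?N = "M \<Otimes>\<^sub>M (lborel :: real measure)"
  note cf = cutoff_approx[OF f] and cg = cutoff_approx[OF g] and cd = cutoff_approx[OF L2_diff[OF f g]]
  note P = fibre_integrable_isometry(1)
  have FL: "F \<in> L2 ?N" and GL: "G \<in> L2 ?N"
    using F G by (auto simp: is_pft_def)
  have cut: "(\<lambda>z. cutoff n f z - cutoff n g z) = cutoff n (\<lambda>z. f z - g z)" for n
    by (simp add: cutoff_def right_diff_distrib fun_eq_iff)
  have diff0: "L2_norm_sq ?N (\<lambda>z. (partial_fourier (cutoff n f) z - partial_fourier (cutoff n g) z)
      - partial_fourier (cutoff n (\<lambda>z. f z - g z)) z) = 0" for n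
  proof -
    have "AE p in M. \<forall>t. partial_fourier (cutoff n f) (p, t) - partial_fourier (cutoff n g) (p, t)
        = partial_fourier (cutoff n (\<lambda>z. f z - g z)) (p, t)"
      using cf(1)[of n] cg(1)[of n] unfolding fibre_integrable_def
      by (auto elim!: eventually_elim2 simp: partial_fourier_def fourier_diff[symmetric] cut[symmetric])
    then have "AE p in M. sqnorm lborel (\<lambda>t. (partial_fourier (cutoff n f) (p, t) - partial_fourier (cutoff n g) (p, t))
      - partial_fourier (cutoff n (\<lambda>z. f z - g z)) (p, t)) = 0"
      by eventually_elim simp
    then have "(\<integral>\<^sup>+p. sqnorm lborel (\<lambda>t. (partial_fourier (cutoff n f) (p, t) - partial_fourier (cutoff n g) (p, t))
      - partial_fourier (cutoff n (\<lambda>z. f z - g z)) (p, t)) \<partial>M) = 0"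
      by (simp add: nn_integral_cong_AE[where v="\<lambda>_. 0"])
    moreover have "(\<lambda>z. (partial_fourier (cutoff n f) z - partial_fourier (cutoff n g) z)
      - partial_fourier (cutoff n (\<lambda>z. f z - g z)) z) \<in> borel_measurable ?N"
      by (intro borel_measurable_diff L2_measurable P cf cg cd)
    ultimately show ?thesis
      by (simp add: L2_norm_sq_conv sqnorm_fibres)
  qed
  have "(\<lambda>n. L2_norm_sq ?N (\<lambda>z. (F z - G z) - (partial_fourier (cutoff n f) z - partial_fourier (cutoff n g) z))) \<longlonglongrightarrow> 0"
  proof (rule tendsto_sandwich[OF _ _ tendsto_const])
    have "(\<lambda>n. 2 * L2_norm_sq ?N (\<lambda>z. F z - partial_fourier (cutoff n f) z)
        + 2 * L2_norm_sq ?N (\<lambda>z. G z - partial_fourier (cutoff n g) z)) \<longlonglongrightarrow> 2 * 0 + 2 * 0"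
      using F G unfolding is_pft_def by (intro tendsto_intros) auto
    then show "(\<lambda>n. 2 * L2_norm_sq ?N (\<lambda>z. F z - partial_fourier (cutoff n f) z)
        + 2 * L2_norm_sq ?N (\<lambda>z. G z - partial_fourier (cutoff n g) z)) \<longlonglongrightarrow> 0"
      by simp
    show "\<forall>\<^sub>F n in sequentially. L2_norm_sq ?N (\<lambda>z. (F z - G z) - (partial_fourier (cutoff n f) z - partial_fourier (cutoff n g) z))
      \<le> 2 * L2_norm_sq ?N (\<lambda>z. F z - partial_fourier (cutoff n f) z)
        + 2 * L2_norm_sq ?N (\<lambda>z. G z - partial_fourier (cutoff n g) z)"
    proof (intro always_eventually allI)
      fix n
      have eq: "(\<lambda>z. (F z - G z) - (partial_fourier (cutoff n f) z - partial_fourier (cutoff n g) z))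
        = (\<lambda>z. (F z - partial_fourier (cutoff n f) z) - (G z - partial_fourier (cutoff n g) z))"
        by (simp add: fun_eq_iff)
      show "L2_norm_sq ?N (\<lambda>z. (F z - G z) - (partial_fourier (cutoff n f) z - partial_fourier (cutoff n g) z))
      \<le> 2 * L2_norm_sq ?N (\<lambda>z. F z - partial_fourier (cutoff n f) z)
        + 2 * L2_norm_sq ?N (\<lambda>z. G z - partial_fourier (cutoff n g) z)"
        unfolding eq
        using L2_norm_sq_diff_triangle[OF L2_diff[OF FL P[OF cf(1)[of n]]] L2_zero L2_diff[OF GL P[OF cg(1)[of n]]]]
        by (simp add: L2_norm_sq_diff_commute[of _ G])
    qed
  qed (simp add: L2_norm_sq_nonneg)
  from L2_tendsto_triangle[OF L2_diff[OF FL GL] L2_diff[OF P[OF cf(1)] P[OF cg(1)]] P[OF cd(1)] this]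
  show ?thesis
    using FL GL by (simp add: is_pft_def L2_diff diff0)
qed

lemma is_pft_cmult:
  assumes "is_pft M f F"
  shows "is_pft M (\<lambda>z. c * f z) (\<lambda>z. c * F z)"
proof -
  have "partial_fourier (cutoff n (\<lambda>z. c * f z)) z = c * partial_fourier (cutoff n f) z" for n z
    by (simp add: partial_fourier_def fourier_def cutoff_def mult_ac flip: integral_mult_right_zero)
  then have "L2_norm_sq (M \<Otimes>\<^sub>M lborel) (\<lambda>z. c * F z - partial_fourier (cutoff n (\<lambda>z. c * f z)) z)
      = (cmod c)\<^sup>2 * L2_norm_sq (M \<Otimes>\<^sub>M lborel) (\<lambda>z. F z - partial_fourier (cutoff n f) z)" for n
    by (simp add: L2_norm_sq_cmult flip: right_diff_distrib)
  then show ?thesis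
    using assms by (auto simp: is_pft_def L2_cmult intro: tendsto_mult_right_zero)
qed

lemma is_pft_zero: "is_pft M (\<lambda>z. 0) (\<lambda>z. 0)"
  by (simp add: is_pft_def partial_fourier_def fourier_def cutoff_def)

lemma is_pft_sum:
  assumes "\<And>j. j \<in> J \<Longrightarrow> f j \<in> L2 (M \<Otimes>\<^sub>M lborel)" "\<And>j. j \<in> J \<Longrightarrow> is_pft M (f j) (F j)"
  shows "is_pft M (\<lambda>z. \<Sum>j\<in>J. c j * f j z) (\<lambda>z. \<Sum>j\<in>J. c j * F j z)"
  using assms
proof (induction J rule: infinite_finite_induct)
  case (insert j J)
  have "is_pft M (\<lambda>z. c j * f j z - (- 1) * (\<Sum>j\<in>J. c j * f j z)) (\<lambda>z. c j * F j z - (- 1) * (\<Sum>j\<in>J. c j * F j z))"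
    using insert by (intro is_pft_diff is_pft_cmult L2_cmult L2_sum) auto
  with insert.hyps show ?case
    by simp
qed (simp_all add: is_pft_zero)

lemma is_pft_unique:
  assumes f: "f \<in> L2 (M \<Otimes>\<^sub>M lborel)" and F: "is_pft M f F" and G: "is_pft M f G"
  shows "AE z in M \<Otimes>\<^sub>M lborel. F z = G z"
proof -
  have L: "(\<lambda>z. F z - G z) \<in> L2 (M \<Otimes>\<^sub>M lborel)"
    using F G by (auto simp: is_pft_def L2_diff)
  have "L2_norm_sq (M \<Otimes>\<^sub>M lborel) (\<lambda>z. F z - G z) = L2_norm_sq (M \<Otimes>\<^sub>M lborel) (\<lambda>z. f z - f z)"
    by (rule is_pft_isometry[OF L2_diff[OF f f] is_pft_diff[OF f f F G]])
  then have "sqnorm (M \<Otimes>\<^sub>M lborel) (\<lambda>z. F z - G z) = 0"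
    by (simp add: sqnorm_conv[OF L])
  then show ?thesis
    by (simp add: sqnorm_eq_0_iff[OF L2_measurable[OF L]])
qed

section \<open>Translations on the Heisenberg group and their transforms\<close>

text \<open>Points of the Heisenberg group are nested as \<open>x\<close>, \<open>(y, t)\<close>, whereas a transform in \<open>t\<close> with the
  point of the plane as its parameter needs \<open>(x, y)\<close>, \<open>t\<close>.\<close>

definition regroup :: "(heis \<Rightarrow> 'b) \<Rightarrow> (real \<times> real) \<times> real \<Rightarrow> 'b" where
  "regroup f z = f (fst (fst z), snd (fst z), snd z)"

lemma borel_measurable_fst_snd [measurable]:
  "fst \<in> measurable (borel :: ('a :: topological_space \<times> 'b :: topological_space) measure) borel"
  "snd \<in> measurable (borel :: ('a \<times> 'b) measure) borel"
  by (intro borel_measurable_continuous_onI continuous_intros)+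

lemma nn_integral_lborel_prod:
  fixes h :: "'a :: euclidean_space \<times> 'b :: euclidean_space \<Rightarrow> ennreal"
  assumes "h \<in> borel_measurable borel"
  shows "(\<integral>\<^sup>+x. \<integral>\<^sup>+y. h (x, y) \<partial>lborel \<partial>lborel) = (\<integral>\<^sup>+z. h z \<partial>lborel)"
    and "(\<integral>\<^sup>+y. \<integral>\<^sup>+x. h (x, y) \<partial>lborel \<partial>lborel) = (\<integral>\<^sup>+z. h z \<partial>lborel)"
proof -
  have h: "h \<in> borel_measurable (lborel \<Otimes>\<^sub>M lborel)"
    using assms by (simp add: lborel_prod)
  show "(\<integral>\<^sup>+x. \<integral>\<^sup>+y. h (x, y) \<partial>lborel \<partial>lborel) = (\<integral>\<^sup>+z. h z \<partial>lborel)"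
    "(\<integral>\<^sup>+y. \<integral>\<^sup>+x. h (x, y) \<partial>lborel \<partial>lborel) = (\<integral>\<^sup>+z. h z \<partial>lborel)"
    using lborel.nn_integral_fst[OF h] lborel_pair.nn_integral_snd[OF h]
    by (simp_all add: lborel_prod)
qed

lemma measurable_regroup_iff:
  "regroup f \<in> measurable (lborel \<Otimes>\<^sub>M lborel) N \<longleftrightarrow> f \<in> measurable (lborel :: heis measure) N"
proof
  assume "regroup f \<in> measurable (lborel \<Otimes>\<^sub>M lborel) N"
  then have [measurable]: "regroup f \<in> measurable borel N"
    by (simp add: lborel_prod)
  have "(\<lambda>z. regroup f ((fst z, fst (snd z)), snd (snd z))) \<in> measurable (borel :: heis measure) N"
    by measurable
  then show "f \<in> measurable lborel N"
    by (simp add: regroup_def)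
next
  assume "f \<in> measurable lborel N"
  then have [measurable]: "f \<in> measurable borel N"
    by simp
  have "regroup f \<in> measurable borel N"
    unfolding regroup_def[abs_def] by measurable
  then show "regroup f \<in> measurable (lborel \<Otimes>\<^sub>M lborel) N"
    by (simp add: lborel_prod)
qed

lemma measurable_regroup [measurable]:
  "f \<in> measurable lborel N \<Longrightarrow> regroup f \<in> measurable (lborel \<Otimes>\<^sub>M lborel) N"
  by (simp only: measurable_regroup_iff)

lemma nn_integral_regroup:
  fixes h :: "heis \<Rightarrow> ennreal"
  assumes "h \<in> borel_measurable lborel"
  shows "(\<integral>\<^sup>+z. regroup h z \<partial>(lborel \<Otimes>\<^sub>M lborel)) = (\<integral>\<^sup>+z. h z \<partial>lborel)"
proof -
  have [measurable]: "h \<in> borel_measurable borel"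
    using assms by simp
  have rm: "regroup h \<in> borel_measurable borel"
    using measurable_regroup[OF assms] by (simp add: lborel_prod)
  have "(\<integral>\<^sup>+z. regroup h z \<partial>(lborel \<Otimes>\<^sub>M lborel)) = (\<integral>\<^sup>+p. \<integral>\<^sup>+t. regroup h (p, t) \<partial>lborel \<partial>lborel)"
    by (simp add: nn_integral_lborel_prod[OF rm] lborel_prod)
  also have "\<dots> = (\<integral>\<^sup>+p. (\<lambda>p. \<integral>\<^sup>+t. h (fst p, snd p, t) \<partial>lborel) p \<partial>lborel)"
    by (simp add: regroup_def)
  also have "\<dots> = (\<integral>\<^sup>+x. \<integral>\<^sup>+y. \<integral>\<^sup>+t. h (x, y, t) \<partial>lborel \<partial>lborel \<partial>lborel)"
    by (subst nn_integral_lborel_prod(1)[symmetric]) auto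
  also have "\<dots> = (\<integral>\<^sup>+x. \<integral>\<^sup>+q. h (x, q) \<partial>lborel \<partial>lborel)"
    by (intro nn_integral_cong nn_integral_lborel_prod(1)) measurable
  also have "\<dots> = (\<integral>\<^sup>+z. h z \<partial>lborel)"
    by (rule nn_integral_lborel_prod(1)) measurable
  finally show ?thesis .
qed

lemma sqnorm_regroup:
  assumes [measurable]: "f \<in> borel_measurable lborel"
  shows "sqnorm (lborel \<Otimes>\<^sub>M lborel) (regroup f) = sqnorm lborel f"
  unfolding sqnorm_def using nn_integral_regroup[of "\<lambda>z. ennreal ((cmod (f z))\<^sup>2)"]
  by (simp add: regroup_def)

lemma L2_regroup: "regroup f \<in> L2 (lborel \<Otimes>\<^sub>M lborel) \<longleftrightarrow> f \<in> L2 lborel"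
  unfolding L2_iff measurable_regroup_iff by (auto simp: sqnorm_regroup)

lemma sqnorm_sections:
  fixes f :: "(real \<times> real) \<times> real \<Rightarrow> complex"
  assumes [measurable]: "f \<in> borel_measurable (lborel \<Otimes>\<^sub>M lborel)"
  shows "sqnorm (lborel \<Otimes>\<^sub>M lborel) f = (\<integral>\<^sup>+\<omega>. sqnorm lborel (\<lambda>p. f (p, \<omega>)) \<partial>lborel)"
  unfolding sqnorm_def by (subst lborel_pair.nn_integral_snd[symmetric]) auto

lemma is_partial_ft_iff:
  assumes g: "g \<in> L2 lborel"
  shows "is_partial_ft g F \<longleftrightarrow> is_pft lborel (regroup g) (\<lambda>z. F (snd z) (fst z))"
proof -
  let ?N = "lborel \<Otimes>\<^sub>M lborel :: ((real \<times> real) \<times> real) measure"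
  have gm[measurable]: "g \<in> borel_measurable lborel"
    using g by (rule L2_measurable)
  have rg: "regroup (\<lambda>(x, y, lam). F lam (x, y)) = (\<lambda>z. F (snd z) (fst z))"
    by (simp add: regroup_def fun_eq_iff)
  have trunc: "(\<integral>\<^sup>+(x, y, lam). ennreal ((cmod (F lam (x, y)
            - (LINT t:{- real n..real n}|lborel. g (x, y, t) * cis (2 * pi * lam * t))))\<^sup>2) \<partial>lborel)
      = sqnorm ?N (\<lambda>z. F (snd z) (fst z) - partial_fourier (cutoff n (regroup g)) z)"
    if [measurable]: "(\<lambda>z. F (snd z) (fst z)) \<in> borel_measurable ?N" for n
  proof -
    define h where "h = (\<lambda>(x, y, lam). F lam (x, y)
            - (LINT t:{- real n..real n}|lborel. g (x, y, t) * cis (2 * pi * lam * t)))"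
    have rh: "regroup h = (\<lambda>z. F (snd z) (fst z) - partial_fourier (cutoff n (regroup g)) z)"
      by (simp add: h_def regroup_def fun_eq_iff partial_fourier_def fourier_def cutoff_def
          set_lebesgue_integral_def scaleR_conv_of_real mult.assoc)
    have "partial_fourier (cutoff n (regroup g)) \<in> borel_measurable ?N"
      unfolding cutoff_def[abs_def] by (intro measurable_partial_fourier) measurable
    then have "regroup h \<in> borel_measurable ?N"
      unfolding rh by (intro borel_measurable_diff that)
    then have hm: "h \<in> borel_measurable lborel"
      by (simp only: measurable_regroup_iff)
    show ?thesis
      using sqnorm_regroup[OF hm] unfolding rh by (simp add: sqnorm_def h_def case_prod_unfold)
  qed
  show ?thesis
  proof (cases "(\<lambda>z. F (snd z) (fst z)) \<in> L2 ?N")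
    case True
    have "cutoff n (regroup g) \<in> L2 ?N" for n
      using cutoff_approx(1)[of "regroup g" lborel n] g by (simp add: L2_regroup fibre_integrable_def)
    then have P: "partial_fourier (cutoff n (regroup g)) \<in> L2 ?N" for n
      using cutoff_approx(1)[of "regroup g" lborel n] g
      by (intro fibre_integrable_isometry) (simp_all add: L2_regroup)
    have "(\<lambda>(x, y, lam). F lam (x, y)) \<in> L2 (lborel :: heis measure)"
      using True unfolding rg[symmetric] L2_regroup .
    then show ?thesis
      unfolding is_partial_ft_def is_pft_def
      using True trunc[OF L2_measurable[OF True]]
        sqnorm_tendsto_0_iff[of "\<lambda>n z. F (snd z) (fst z) - partial_fourier (cutoff n (regroup g)) z" ?N sequentially]
        L2_diff[OF True P]
      by simp
  next
    case False
    then have "(\<lambda>(x, y, lam). F lam (x, y)) \<notin> L2 (lborel :: heis measure)"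
      unfolding rg[symmetric] L2_regroup .
    with False show ?thesis
      by (simp add: is_partial_ft_def is_pft_def)
  qed
qed

lemma is_pft_partial_ft:
  assumes g: "g \<in> L2 lborel"
  shows "is_pft lborel (regroup g) (\<lambda>z. partial_ft g (snd z) (fst z))"
proof -
  obtain F where F: "is_pft lborel (regroup g) F"
    using is_pft_exists[of "regroup g" lborel] g by (auto simp: L2_regroup)
  then have "is_partial_ft g (\<lambda>\<omega> p. F (p, \<omega>))"
    using g by (simp add: is_partial_ft_iff)
  then have "is_partial_ft g (partial_ft g)"
    unfolding partial_ft_def by (rule someI[of "is_partial_ft g"])
  then show ?thesis
    using g by (simp add: is_partial_ft_iff)
qed

lemma nn_integral_translate:
  fixes h :: "'a :: euclidean_space \<Rightarrow> ennreal"
  assumes [measurable]: "h \<in> borel_measurable borel"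
  shows "(\<integral>\<^sup>+x. h (x - w) \<partial>lborel) = (\<integral>\<^sup>+x. h x \<partial>lborel)"
proof -
  have "(\<integral>\<^sup>+x. h x \<partial>lborel) = (\<integral>\<^sup>+x. h x \<partial>distr lborel borel ((+) (- w)))"
    by (simp add: lborel_distr_plus)
  also have "\<dots> = (\<integral>\<^sup>+x. h (- w + x) \<partial>lborel)"
    by (rule nn_integral_distr) auto
  finally show ?thesis
    by simp
qed

text \<open>The substitution is a translation of every fibre followed by a translation of the base.\<close>

lemma sqnorm_shear:
  fixes h :: "(real \<times> real) \<times> real \<Rightarrow> complex"
  assumes [measurable]: "h \<in> borel_measurable (lborel \<Otimes>\<^sub>M lborel)" "\<sigma> \<in> borel_measurable borel"
  shows "sqnorm (lborel \<Otimes>\<^sub>M lborel) (\<lambda>z. h (fst z - w, snd z + \<sigma> (fst z))) = sqnorm (lborel \<Otimes>\<^sub>M lborel) h"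
proof -
  have "sqnorm (lborel \<Otimes>\<^sub>M lborel) (\<lambda>z. h (fst z - w, snd z + \<sigma> (fst z)))
      = (\<integral>\<^sup>+p. \<integral>\<^sup>+t. ennreal ((cmod (h (p - w, t - (- \<sigma> p))))\<^sup>2) \<partial>lborel \<partial>lborel)"
    by (subst sqnorm_fibres) (auto simp: sqnorm_def)
  also have "\<dots> = (\<integral>\<^sup>+p. \<integral>\<^sup>+t. ennreal ((cmod (h (p - w, t)))\<^sup>2) \<partial>lborel \<partial>lborel)"
    by (intro nn_integral_cong nn_integral_translate) auto
  also have "\<dots> = (\<integral>\<^sup>+p. sqnorm lborel (\<lambda>t. h (p, t)) \<partial>lborel)"
    unfolding sqnorm_def by (rule nn_integral_translate) auto
  also have "\<dots> = sqnorm (lborel \<Otimes>\<^sub>M lborel) h"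
    by (rule sqnorm_fibres[symmetric]) simp
  finally show ?thesis .
qed

lemma fourier_shift: "fourier (\<lambda>t. h (t + s)) \<omega> = cis (- (2 * pi * \<omega> * s)) * fourier h \<omega>"
proof -
  have "fourier (\<lambda>t. h (t + s)) \<omega> = (LINT t|lborel. h (- s + 1 * t + s) * cis (2 * pi * \<omega> * (- s + 1 * t)))"
    unfolding fourier_def by (subst lborel_integral_real_affine[where c=1 and t="- s"]) auto
  also have "\<dots> = (LINT t|lborel. cis (- (2 * pi * \<omega> * s)) * (h t * cis (2 * pi * \<omega> * t)))"
    by (intro Bochner_Integration.integral_cong refl) (simp add: cis_mult right_diff_distrib algebra_simps)
  finally show ?thesis
    by (simp add: fourier_def)
qed

text \<open>A translation shears the centre and turns cut-offs into windows that move with \<open>p\<close>.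
  The Fourier integral over such a window is the modulated Fourier integral over the fixed one.\<close>

lemma is_pft_shear:
  fixes f F :: "(real \<times> real) \<times> real \<Rightarrow> complex"
  assumes f: "f \<in> L2 (lborel \<Otimes>\<^sub>M lborel)" and F: "is_pft lborel f F"
    and [measurable]: "\<sigma> \<in> borel_measurable borel"
  shows "is_pft lborel (\<lambda>z. f (fst z - w, snd z + \<sigma> (fst z)))
     (\<lambda>z. cis (- (2 * pi * snd z * \<sigma> (fst z))) * F (fst z - w, snd z))"
proof -
  let ?N = "lborel \<Otimes>\<^sub>M lborel :: ((real \<times> real) \<times> real) measure"
  let ?sh = "\<lambda>h z. h (fst z - w, snd z + \<sigma> (fst z)) :: complex"
  have [measurable]: "f \<in> borel_measurable ?N"
    using f by (rule L2_measurable)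
  have FL: "F \<in> L2 ?N"
    using F by (simp add: is_pft_def)
  then have [measurable]: "F \<in> borel_measurable ?N"
    by (rule L2_measurable)
  have shm: "?sh h \<in> borel_measurable ?N" if [measurable]: "h \<in> borel_measurable ?N" for h
    by measurable
  have shL: "?sh h \<in> L2 ?N" if "h \<in> L2 ?N" for h
    using that shm[of h] sqnorm_shear[of h \<sigma> w] by (simp add: L2_iff)
  have cL: "cutoff n f \<in> L2 ?N" for n
    using cutoff_approx(1)[OF f] by (simp add: fibre_integrable_def)
  define A where "A n = {z :: (real \<times> real) \<times> real. snd z + \<sigma> (fst z) \<in> {- real n..real n}}" for n
  have A: "A n \<in> sets ?N" for n
  proof -
    have "{z \<in> space ?N. snd z + \<sigma> (fst z) \<in> {- real n..real n}} \<in> sets ?N"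
      by measurable
    then show ?thesis
      by (simp add: A_def space_pair_measure)
  qed
  have "fibre_integrable lborel (\<lambda>z. of_real (indicator (A n) z) * ?sh f z)" for n
  proof (rule fibre_integrable_window[OF shL[OF f] A])
    fix p :: "real \<times> real"
    have "Pair p -` A n = {- real n - \<sigma> p..real n - \<sigma> p}"
      by (auto simp: A_def)
    then show "emeasure lborel (Pair p -` A n) < \<infinity>"
      by simp
  qed
  moreover have "?sh (cutoff n f) = (\<lambda>z. of_real (indicator (A n) z) * ?sh f z)" for n
    by (simp add: cutoff_def A_def indicator_def fun_eq_iff)
  ultimately have fib: "fibre_integrable lborel (?sh (cutoff n f))" for n
    by simp
  have lim1: "(\<lambda>n. L2_norm_sq ?N (\<lambda>z. ?sh (cutoff n f) z - ?sh f z)) \<longlonglongrightarrow> 0"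
  proof -
    have m: "(\<lambda>z. cutoff n f z - f z) \<in> borel_measurable ?N" for n
      by (intro borel_measurable_diff L2_measurable f cL)
    show ?thesis
      using cutoff_approx(2)[OF f] sqnorm_shear[OF m, where \<sigma>=\<sigma> and w=w] shm[OF m]
      by (simp add: L2_norm_sq_conv m)
  qed
  have pf: "partial_fourier (?sh (cutoff n f)) z
      = cis (- (2 * pi * snd z * \<sigma> (fst z))) * partial_fourier (cutoff n f) (fst z - w, snd z)" for n z
    using fourier_shift[of "\<lambda>t. cutoff n f (fst z - w, t)" "\<sigma> (fst z)" "snd z"]
    by (simp add: partial_fourier_def)
  have dist: "L2_norm_sq ?N (\<lambda>z. cis (- (2 * pi * snd z * \<sigma> (fst z))) * F (fst z - w, snd z)
      - partial_fourier (?sh (cutoff n f)) z) = L2_norm_sq ?N (\<lambda>z. F z - partial_fourier (cutoff n f) z)" for n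
  proof -
    let ?d = "\<lambda>z. F z - partial_fourier (cutoff n f) z"
    have m: "?d \<in> borel_measurable ?N"
      by (intro borel_measurable_diff L2_measurable FL fibre_integrable_isometry(1) cutoff_approx(1) f)
    have "L2_norm_sq ?N (\<lambda>z. cis (- (2 * pi * snd z * \<sigma> (fst z))) * F (fst z - w, snd z)
      - partial_fourier (?sh (cutoff n f)) z) = L2_norm_sq ?N (\<lambda>z. ?d (fst z - w, snd z + 0))"
      unfolding L2_norm_sq_def by (simp add: pf norm_mult flip: right_diff_distrib)
    also have "\<dots> = L2_norm_sq ?N ?d"
      using sqnorm_shear[OF m, of "\<lambda>_. 0" w] measurable_compose[OF _ m, of "\<lambda>z. (fst z - w, snd z + 0)" ?N]
      by (simp add: L2_norm_sq_conv m)
    finally show ?thesis .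
  qed
  have TL: "(\<lambda>z. cis (- (2 * pi * snd z * \<sigma> (fst z))) * F (fst z - w, snd z)) \<in> L2 ?N"
  proof (rule L2_dominated)
    show "(\<lambda>z. F (fst z - w, snd z + 0)) \<in> L2 ?N"
      using FL sqnorm_shear[of F "\<lambda>_. 0" w] by (simp add: L2_iff)
  qed (auto simp: norm_mult)
  have "(\<lambda>n. L2_norm_sq ?N (\<lambda>z. F z - partial_fourier (cutoff n f) z)) \<longlonglongrightarrow> 0"
    using F by (simp add: is_pft_def)
  then show ?thesis
    by (intro is_pft_approx[OF shL[OF f] fib lim1, THEN iffD2] conjI TL) (simp only: dist)
qed

lemma regroup_left_translate:
  "regroup (left_translate (u, v, s) g) z
    = regroup g (fst z - (u, v), snd z + (- s + (u * snd (fst z) - v * fst (fst z)) / 2))"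
  by (simp add: regroup_def left_translate_def algebra_simps)

lemma left_translate_L2:
  assumes "g \<in> L2 lborel"
  shows "left_translate q g \<in> L2 lborel"
proof -
  obtain u v s where q: "q = (u, v, s)"
    by (metis prod_cases3)
  have [measurable]: "regroup g \<in> borel_measurable (lborel \<Otimes>\<^sub>M lborel)"
    using assms by (intro measurable_regroup L2_measurable)
  have [measurable]: "(\<lambda>p. - s + (u * snd p - v * fst p) / 2) \<in> borel_measurable borel"
    by measurable
  have "(\<lambda>z. regroup g (fst z - (u, v), snd z + (- s + (u * snd (fst z) - v * fst (fst z)) / 2)))
      \<in> L2 (lborel \<Otimes>\<^sub>M lborel)"
  proof -
    have "(\<lambda>z. regroup g (fst z - (u, v), snd z + (\<lambda>p. - s + (u * snd p - v * fst p) / 2) (fst z)))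
      \<in> borel_measurable (lborel \<Otimes>\<^sub>M lborel)"
      by measurable
    moreover have "sqnorm (lborel \<Otimes>\<^sub>M lborel) (regroup g) < \<infinity>"
      using assms sqnorm_regroup[OF L2_measurable[OF assms]] by (simp add: L2_iff)
    ultimately show ?thesis
      using sqnorm_shear[of "regroup g" "\<lambda>p. - s + (u * snd p - v * fst p) / 2" "(u, v)"]
      by (simp only: L2_iff) measurable
  qed
  then have "regroup (left_translate q g) \<in> L2 (lborel \<Otimes>\<^sub>M lborel)"
    unfolding q regroup_left_translate[abs_def] .
  then show ?thesis
    by (simp add: L2_regroup)
qed

lemma twisted_translate_eq:
  "twisted_translate \<omega> w F p = cis (pi * \<omega> * (snd w * fst p - fst w * snd p)) * F (p - w)"
  by (cases w; cases p) simp

lemma is_pft_left_translate: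
  assumes g: "g \<in> L2 lborel"
  shows "is_pft lborel (regroup (left_translate (u, v, s) g))
    (\<lambda>z. cis (2 * pi * snd z * s) * twisted_translate (snd z) (u, v) (partial_ft g (snd z)) (fst z))"
proof -
  have \<sigma>: "(\<lambda>p. - s + (u * snd p - v * fst p) / 2) \<in> borel_measurable borel"
    by measurable
  have "regroup g \<in> L2 (lborel \<Otimes>\<^sub>M lborel)"
    using g by (simp add: L2_regroup)
  then have "is_pft lborel (\<lambda>z. regroup g (fst z - (u, v), snd z + (- s + (u * snd (fst z) - v * fst (fst z)) / 2)))
     (\<lambda>z. cis (- (2 * pi * snd z * (- s + (u * snd (fst z) - v * fst (fst z)) / 2)))
        * partial_ft g (snd z) (fst z - (u, v)))"
    using is_pft_shear[OF _ is_pft_partial_ft[OF g] \<sigma>, of "(u, v)"] by simp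
  moreover have "cis (- (2 * pi * snd z * (- s + (u * snd (fst z) - v * fst (fst z)) / 2)))
        * partial_ft g (snd z) (fst z - (u, v))
      = cis (2 * pi * snd z * s) * twisted_translate (snd z) (u, v) (partial_ft g (snd z)) (fst z)"
    for z :: "(real \<times> real) \<times> real"
  proof -
    have "- (2 * pi * snd z * (- s + (u * snd (fst z) - v * fst (fst z)) / 2))
        = 2 * pi * snd z * s + pi * snd z * (v * fst (fst z) - u * snd (fst z))"
      by (simp add: field_simps)
    then show ?thesis
      by (simp only: twisted_translate_eq fst_conv snd_conv mult.assoc[symmetric] cis_mult)
  qed
  ultimately show ?thesis
    by (simp add: regroup_left_translate[abs_def])
qed

lemma measurable_partial_ft:
  assumes "g \<in> L2 lborel"
  shows "(\<lambda>z. partial_ft g (snd z) (fst z)) \<in> borel_measurable (borel :: ((real \<times> real) \<times> real) measure)"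
  using is_pft_partial_ft[OF assms] L2_measurable[of _ "lborel \<Otimes>\<^sub>M lborel"]
  by (auto simp: is_pft_def lborel_prod)

lemma measurable_partial_ft_section:
  assumes "g \<in> L2 lborel"
  shows "partial_ft g \<omega> \<in> borel_measurable borel"
proof -
  have "(\<lambda>p. (\<lambda>z. partial_ft g (snd z) (fst z)) (p, \<omega>)) \<in> borel_measurable borel"
    by (rule measurable_compose[OF _ measurable_partial_ft[OF assms]]) measurable
  then show ?thesis
    by simp
qed

lemma nn_integral_partial_ft:
  assumes g: "g \<in> L2 lborel"
  shows "(\<integral>\<^sup>+\<omega>. sqnorm lborel (partial_ft g \<omega>) \<partial>lborel) = sqnorm lborel g"
proof -
  let ?F = "\<lambda>z. partial_ft g (snd z) (fst z)"
  have F: "?F \<in> L2 (lborel \<Otimes>\<^sub>M lborel)"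
    using is_pft_partial_ft[OF g] by (simp add: is_pft_def)
  have r: "regroup g \<in> L2 (lborel \<Otimes>\<^sub>M lborel)"
    using g by (simp add: L2_regroup)
  have "(\<integral>\<^sup>+\<omega>. sqnorm lborel (partial_ft g \<omega>) \<partial>lborel) = sqnorm (lborel \<Otimes>\<^sub>M lborel) ?F"
    by (subst sqnorm_sections[OF L2_measurable[OF F]]) simp
  also have "\<dots> = sqnorm (lborel \<Otimes>\<^sub>M lborel) (regroup g)"
    using is_pft_isometry[OF r is_pft_partial_ft[OF g]] by (simp add: sqnorm_conv F r)
  also have "\<dots> = sqnorm lborel g"
    by (rule sqnorm_regroup[OF L2_measurable[OF g]])
  finally show ?thesis .
qed

text \<open>Two transforms of the same function agree almost everywhere on \<open>\<real>\<^sup>2 \<times> \<real>\<close>, hence, by Tonelli,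
  almost everywhere on the plane for almost every frequency.\<close>

lemma partial_ft_left_translate:
  assumes g: "g \<in> L2 lborel"
  shows "AE \<omega> in lborel. AE p in lborel. partial_ft (left_translate (u, v, s) g) \<omega> p
    = cis (2 * pi * \<omega> * s) * twisted_translate \<omega> (u, v) (partial_ft g \<omega>) p"
proof -
  let ?F = "\<lambda>z. partial_ft (left_translate (u, v, s) g) (snd z) (fst z)"
  let ?G = "\<lambda>z. cis (2 * pi * snd z * s) * twisted_translate (snd z) (u, v) (partial_ft g (snd z)) (fst z)"
  note Lg = left_translate_L2[OF g, of "(u, v, s)"]
  note F = is_pft_partial_ft[OF Lg] and G = is_pft_left_translate[OF g, of u v s]
  have m: "(\<lambda>z. ?F z - ?G z) \<in> borel_measurable (lborel \<Otimes>\<^sub>M lborel)"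
    using F G by (intro borel_measurable_diff L2_measurable) (auto simp: is_pft_def)
  have "AE z in lborel \<Otimes>\<^sub>M lborel. ?F z = ?G z"
    using Lg by (intro is_pft_unique[OF _ F G]) (simp add: L2_regroup)
  then have "sqnorm (lborel \<Otimes>\<^sub>M lborel) (\<lambda>z. ?F z - ?G z) = 0"
    by (subst sqnorm_eq_0_iff[OF m]) simp
  then have "(\<integral>\<^sup>+\<omega>. sqnorm lborel (\<lambda>p. ?F (p, \<omega>) - ?G (p, \<omega>)) \<partial>lborel) = 0"
    by (simp only: sqnorm_sections[OF m])
  moreover have "(\<lambda>\<omega>. sqnorm lborel (\<lambda>p. ?F (p, \<omega>) - ?G (p, \<omega>))) \<in> borel_measurable lborel"
    using m unfolding sqnorm_def by measurable
  ultimately have "AE \<omega> in lborel. sqnorm lborel (\<lambda>p. ?F (p, \<omega>) - ?G (p, \<omega>)) = 0"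
    by (simp only: nn_integral_0_iff_AE)
  then show ?thesis
  proof eventually_elim
    case (elim \<omega>)
    have "(\<lambda>p. ?F (p, \<omega>) - ?G (p, \<omega>)) \<in> borel_measurable lborel"
      using measurable_compose[OF measurable_Pair2' m, of \<omega>] by simp
    with elim show ?case
      by (simp add: sqnorm_eq_0_iff)
  qed
qed

theorem sqnorm_translate_combination:
  fixes c :: "'i \<Rightarrow> complex" and q :: "'i \<Rightarrow> real \<times> real" and s :: "'i \<Rightarrow> real"
  assumes g: "g \<in> L2 lborel"
  shows "sqnorm lborel (\<lambda>z. \<Sum>j\<in>J. c j * left_translate (fst (q j), snd (q j), s j) g z)
    = (\<integral>\<^sup>+\<omega>. sqnorm lborel (\<lambda>p. \<Sum>j\<in>J. c j * (cis (2 * pi * \<omega> * s j)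
        * twisted_translate \<omega> (q j) (partial_ft g \<omega>) p)) \<partial>lborel)"
proof -
  let ?f = "\<lambda>j. left_translate (fst (q j), snd (q j), s j) g"
  let ?F = "\<lambda>j z. cis (2 * pi * snd z * s j) * twisted_translate (snd z) (q j) (partial_ft g (snd z)) (fst z)"
  have f: "regroup (?f j) \<in> L2 (lborel \<Otimes>\<^sub>M lborel)" for j
    using left_translate_L2[OF g] by (simp add: L2_regroup)
  have F: "is_pft lborel (regroup (?f j)) (?F j)" for j
    using is_pft_left_translate[OF g, of "fst (q j)" "snd (q j)"] by simp
  then have FL: "?F j \<in> L2 (lborel \<Otimes>\<^sub>M lborel)" for j
    by (simp add: is_pft_def)
  have sF: "(\<lambda>z. \<Sum>j\<in>J. c j * ?F j z) \<in> L2 (lborel \<Otimes>\<^sub>M lborel)"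
    and sf: "(\<lambda>z. \<Sum>j\<in>J. c j * regroup (?f j) z) \<in> L2 (lborel \<Otimes>\<^sub>M lborel)"
    by (intro L2_sum L2_cmult FL f)+
  have "sqnorm (lborel \<Otimes>\<^sub>M lborel) (\<lambda>z. \<Sum>j\<in>J. c j * ?F j z)
      = sqnorm (lborel \<Otimes>\<^sub>M lborel) (\<lambda>z. \<Sum>j\<in>J. c j * regroup (?f j) z)"
    using is_pft_isometry[OF sf is_pft_sum[OF f F]] by (simp add: sqnorm_conv sF sf)
  also have "\<dots> = sqnorm (lborel \<Otimes>\<^sub>M lborel) (regroup (\<lambda>z. \<Sum>j\<in>J. c j * ?f j z))"
    by (simp add: regroup_def[abs_def])
  also have "\<dots> = sqnorm lborel (\<lambda>z. \<Sum>j\<in>J. c j * ?f j z)"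
    by (intro sqnorm_regroup L2_measurable[OF L2_sum] L2_cmult left_translate_L2 g)
  finally show ?thesis
    by (simp add: sqnorm_sections[OF L2_measurable[OF sF]])
qed

section \<open>Integral operators and the Hilbert--Schmidt norm\<close>

definition kernel_op :: "(real \<times> real \<Rightarrow> complex) \<Rightarrow> l2op" where
  "kernel_op K \<phi> \<xi> = (LINT \<eta>|lborel. K (\<xi>, \<eta>) * \<phi> \<eta>)"

text \<open>The basis that enters the definition of the Hilbert--Schmidt norm. The norm of an operator only depends
  on its values at these functions, so operators need to be compared only there.\<close>

definition hs_basis :: "nat \<Rightarrow> real \<Rightarrow> complex" where
  "hs_basis = (SOME e. orthonormal_basis e)"

lemma hs_basis: "orthonormal_basis hs_basis"
  unfolding hs_basis_def using orthonormal_basis_exists by (rule someI_ex)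

lemma hs_basis_L2: "hs_basis n \<in> L2 lborel"
  using hs_basis by (simp add: orthonormal_basis_def)

lemma hs_norm_sq_basis: "hs_norm_sq T = (\<Sum>n. sqnorm lborel (T (hs_basis n)))"
  by (simp add: hs_norm_sq_def hs_basis_def[symmetric] sqnorm_def)

lemma hs_norm_sq_cong:
  assumes "\<And>n. AE \<xi> in lborel. S (hs_basis n) \<xi> = T (hs_basis n) \<xi>"
  shows "hs_norm_sq S = hs_norm_sq T"
  unfolding hs_norm_sq_basis using sqnorm_cong_AE[OF assms] by simp

lemma hs_norm_sq_triangle:
  assumes "\<And>n. R (hs_basis n) \<in> borel_measurable lborel" "\<And>n. S (hs_basis n) \<in> borel_measurable lborel"
    "\<And>n. T (hs_basis n) \<in> borel_measurable lborel"
  shows "hs_norm_sq (\<lambda>\<phi> \<xi>. R \<phi> \<xi> - T \<phi> \<xi>)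
    \<le> 2 * hs_norm_sq (\<lambda>\<phi> \<xi>. R \<phi> \<xi> - S \<phi> \<xi>) + 2 * hs_norm_sq (\<lambda>\<phi> \<xi>. S \<phi> \<xi> - T \<phi> \<xi>)"
proof -
  have "hs_norm_sq (\<lambda>\<phi> \<xi>. R \<phi> \<xi> - T \<phi> \<xi>)
    \<le> (\<Sum>n. 2 * sqnorm lborel (\<lambda>\<xi>. R (hs_basis n) \<xi> - S (hs_basis n) \<xi>)
       + 2 * sqnorm lborel (\<lambda>\<xi>. S (hs_basis n) \<xi> - T (hs_basis n) \<xi>))"
    unfolding hs_norm_sq_basis by (intro suminf_le sqnorm_diff_triangle assms) auto
  then show ?thesis
    by (simp add: hs_norm_sq_basis suminf_add[symmetric])
qed

lemma hs_norm_sq_diff_commute: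
  "hs_norm_sq (\<lambda>\<phi> \<xi>. S \<phi> \<xi> - T \<phi> \<xi>) = hs_norm_sq (\<lambda>\<phi> \<xi>. T \<phi> \<xi> - S \<phi> \<xi>)"
  unfolding hs_norm_sq_basis by (subst sqnorm_diff_commute) simp

lemma hs_norm_sq_eq_0D:
  assumes "hs_norm_sq T = 0" "T (hs_basis n) \<in> borel_measurable lborel"
  shows "AE \<xi> in lborel. T (hs_basis n) \<xi> = 0"
proof -
  have "sqnorm lborel (T (hs_basis n)) \<le> hs_norm_sq T"
    unfolding hs_norm_sq_basis using sum_le_suminf[of "\<lambda>n. sqnorm lborel (T (hs_basis n))" "{n}"] by simp
  with assms show ?thesis
    by (simp add: sqnorm_eq_0_iff)
qed

lemma kernel_measurable:
  assumes K: "K \<in> borel_measurable lborel" and \<phi>: "\<phi> \<in> borel_measurable lborel"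
  shows "kernel_op K \<phi> \<in> borel_measurable lborel"
proof -
  have [measurable]: "K \<in> borel_measurable (lborel \<Otimes>\<^sub>M lborel)" "\<phi> \<in> borel_measurable lborel"
    using K \<phi> by (simp_all add: lborel_prod)
  show ?thesis
    unfolding kernel_op_def[abs_def] by measurable
qed

lemma kernel_fibres:
  fixes K :: "real \<times> real \<Rightarrow> complex"
  assumes "K \<in> L2 lborel"
  shows "AE \<xi> in lborel. (\<lambda>\<eta>. K (\<xi>, \<eta>)) \<in> L2 lborel"
  using L2_fibres[of K lborel] assms by (simp add: lborel_prod)

lemma kernel_op_inner: "kernel_op K \<phi> \<xi> = cnj (L2_inner lborel (\<lambda>\<eta>. cnj (K (\<xi>, \<eta>))) \<phi>)"
  unfolding kernel_op_def L2_inner_def using Bochner_Integration.integral_cnj[of lborel "\<lambda>\<eta>. cnj (K (\<xi>, \<eta>)) * cnj (\<phi> \<eta>)"]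
  by simp

lemma sqnorm_kernel_fibres:
  assumes "K \<in> borel_measurable lborel"
  shows "sqnorm lborel K = (\<integral>\<^sup>+\<xi>. sqnorm lborel (\<lambda>\<eta>. K (\<xi>, \<eta>)) \<partial>(lborel :: real measure))"
  using sqnorm_fibres[of K lborel] assms by (simp add: lborel_prod)

lemma kernel_op_L2:
  assumes K: "K \<in> L2 lborel" and \<phi>: "\<phi> \<in> L2 lborel"
  shows "kernel_op K \<phi> \<in> L2 lborel"
    and "L2_norm_sq lborel (kernel_op K \<phi>) \<le> L2_norm_sq lborel K * L2_norm_sq lborel \<phi>"
proof -
  note Km = L2_measurable[OF K] and \<phi>m = L2_measurable[OF \<phi>]
  have [measurable]: "K \<in> borel_measurable (lborel \<Otimes>\<^sub>M lborel)"
    using Km by (simp add: lborel_prod)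
  have "sqnorm lborel (kernel_op K \<phi>) \<le> (\<integral>\<^sup>+\<xi>. sqnorm lborel (\<lambda>\<eta>. K (\<xi>, \<eta>)) * sqnorm lborel \<phi> \<partial>lborel)"
    unfolding sqnorm_def[of lborel "kernel_op K \<phi>"]
  proof (rule nn_integral_mono_AE, use kernel_fibres[OF K] in eventually_elim)
    case (elim \<xi>)
    have "(cmod (kernel_op K \<phi> \<xi>))\<^sup>2 \<le> L2_norm_sq lborel (\<lambda>\<eta>. K (\<xi>, \<eta>)) * L2_norm_sq lborel \<phi>"
      using L2_inner_Cauchy_Schwarz[OF L2_cnj[OF elim] \<phi>] by (simp add: kernel_op_inner L2_norm_sq_def)
    then show ?case
      by (simp add: sqnorm_conv elim \<phi> L2_norm_sq_nonneg flip: ennreal_mult)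
  qed
  also have "\<dots> = sqnorm lborel K * sqnorm lborel \<phi>"
  proof -
    have "(\<lambda>\<xi>. sqnorm lborel (\<lambda>\<eta>. K (\<xi>, \<eta>))) \<in> borel_measurable lborel"
      unfolding sqnorm_def by measurable
    then show ?thesis
      by (subst nn_integral_multc) (simp_all add: sqnorm_kernel_fibres[OF Km])
  qed
  finally have le: "sqnorm lborel (kernel_op K \<phi>) \<le> sqnorm lborel K * sqnorm lborel \<phi>" .
  then show L: "kernel_op K \<phi> \<in> L2 lborel"
    using K \<phi> kernel_measurable[OF Km \<phi>m] by (auto simp: L2_iff ennreal_mult_less_top intro: le_less_trans)
  show "L2_norm_sq lborel (kernel_op K \<phi>) \<le> L2_norm_sq lborel K * L2_norm_sq lborel \<phi>"
    using le by (simp add: sqnorm_conv L K \<phi> L2_norm_sq_nonneg flip: ennreal_mult)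
qed

lemma kernel_integrable:
  fixes K :: "real \<times> real \<Rightarrow> complex"
  assumes K: "K \<in> L2 lborel" and \<phi>: "\<phi> \<in> L2 lborel"
  shows "AE \<xi> in lborel. integrable lborel (\<lambda>\<eta>. K (\<xi>, \<eta>) * \<phi> \<eta>)"
  using kernel_fibres[OF K]
proof eventually_elim
  case (elim \<xi>)
  show ?case
    using L2_integrable_mult[OF elim L2_cnj[OF \<phi>]] by simp
qed

lemma bounded_kernel_op:
  assumes K: "K \<in> L2 lborel"
  shows "bounded_l2op (kernel_op K)"
  unfolding bounded_l2op_def
proof (intro conjI ballI allI)
  fix \<phi> \<psi> :: "real \<Rightarrow> complex" and a b
  assume "\<phi> \<in> L2 lborel" "\<psi> \<in> L2 lborel"
  then show "AE \<xi> in lborel. kernel_op K (\<lambda>x. a * \<phi> x + b * \<psi> x) \<xi> = a * kernel_op K \<phi> \<xi> + b * kernel_op K \<psi> \<xi>"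
    using kernel_integrable[OF K, of \<phi>] kernel_integrable[OF K, of \<psi>]
    by (auto elim!: eventually_elim2 simp: kernel_op_def distrib_left mult.left_commute)
qed (use kernel_op_L2[OF K] in blast)+

lemma kernel_op_lincomb:
  assumes K: "\<And>j. j \<in> J \<Longrightarrow> K j \<in> L2 lborel" and G: "G \<in> L2 lborel" and \<phi>: "\<phi> \<in> L2 lborel" and "finite J"
  shows "AE \<xi> in lborel. kernel_op (\<lambda>z. G z - (\<Sum>j\<in>J. c j * K j z)) \<phi> \<xi>
    = kernel_op G \<phi> \<xi> - (\<Sum>j\<in>J. c j * kernel_op (K j) \<phi> \<xi>)"
proof -
  have "AE \<xi> in lborel. \<forall>j\<in>J. integrable lborel (\<lambda>\<eta>. K j (\<xi>, \<eta>) * \<phi> \<eta>)"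
    using kernel_integrable[OF K \<phi>] \<open>finite J\<close> by (intro AE_finite_allI) auto
  then show ?thesis
    using kernel_integrable[OF G \<phi>]
    by eventually_elim (simp add: kernel_op_def left_diff_distrib sum_distrib_right mult.assoc)
qed

text \<open>Parseval's identity in the second variable of the kernel identifies the Hilbert--Schmidt norm.\<close>

theorem hs_norm_sq_kernel:
  assumes K: "K \<in> L2 lborel"
  shows "hs_norm_sq (kernel_op K) = sqnorm lborel K"
proof -
  note Km = L2_measurable[OF K]
  have [measurable]: "kernel_op K (hs_basis n) \<in> borel_measurable lborel" for n
    using kernel_op_L2(1)[OF K hs_basis_L2] by (rule L2_measurable)
  have "hs_norm_sq (kernel_op K) = (\<integral>\<^sup>+\<xi>. (\<Sum>n. ennreal ((cmod (kernel_op K (hs_basis n) \<xi>))\<^sup>2)) \<partial>lborel)"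
    unfolding hs_norm_sq_basis sqnorm_def by (rule nn_integral_suminf[symmetric]) measurable
  also have "\<dots> = (\<integral>\<^sup>+\<xi>. sqnorm lborel (\<lambda>\<eta>. K (\<xi>, \<eta>)) \<partial>lborel)"
  proof (rule nn_integral_cong_AE, use kernel_fibres[OF K] in eventually_elim)
    case (elim \<xi>)
    have "(\<lambda>n. (cmod (L2_inner lborel (\<lambda>\<eta>. cnj (K (\<xi>, \<eta>))) (hs_basis n)))\<^sup>2)
        sums L2_norm_sq lborel (\<lambda>\<eta>. cnj (K (\<xi>, \<eta>)))"
      using hs_basis by (intro Fourier_expansion(2) L2_cnj elim) (auto simp: orthonormal_basis_def)
    then have "(\<Sum>n. ennreal ((cmod (L2_inner lborel (\<lambda>\<eta>. cnj (K (\<xi>, \<eta>))) (hs_basis n)))\<^sup>2))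
        = ennreal (L2_norm_sq lborel (\<lambda>\<eta>. cnj (K (\<xi>, \<eta>))))"
      by (intro suminf_ennreal_eq) auto
    then show ?case
      by (simp add: kernel_op_inner sqnorm_conv[OF elim]) (simp add: L2_norm_sq_def)
  qed
  also have "\<dots> = sqnorm lborel K"
    by (rule sqnorm_kernel_fibres[OF Km, symmetric])
  finally show ?thesis .
qed

section \<open>The Weyl transform\<close>

text \<open>The Weyl transform integrates out the first variable of \<open>F(x, y)\<close>; \<open>flip\<close> moves it to the second
  place, where \<open>partial_fourier\<close> acts.\<close>

definition flip :: "(real \<times> real \<Rightarrow> complex) \<Rightarrow> real \<times> real \<Rightarrow> complex" where
  "flip F z = F (snd z, fst z)"

text \<open>Substituting \<open>\<eta> = \<xi> + y\<close>, the exponent \<open>x \<xi> + x y / 2\<close> of the Schroedinger representation becomes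
  \<open>x (\<xi> + \<eta>) / 2\<close>. So the integral over \<open>x\<close> is a Fourier integral at the frequency \<open>lam (\<xi> + \<eta>) / 2\<close>.\<close>

definition weyl_kernel :: "real \<Rightarrow> (real \<times> real \<Rightarrow> complex) \<Rightarrow> real \<times> real \<Rightarrow> complex" where
  "weyl_kernel lam \<Phi> z = \<Phi> (snd z - fst z, lam * (fst z + snd z) / 2)"

lemma measurable_flip: "F \<in> borel_measurable lborel \<Longrightarrow> flip F \<in> borel_measurable lborel"
proof -
  assume "F \<in> borel_measurable lborel"
  then have [measurable]: "F \<in> borel_measurable borel"
    by simp
  have "flip F \<in> borel_measurable borel"
    unfolding flip_def[abs_def] by measurable
  then show ?thesis
    by simp
qed

lemma sqnorm_flip:
  assumes "F \<in> borel_measurable lborel"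
  shows "sqnorm lborel (flip F) = sqnorm lborel F"
proof -
  have [measurable]: "F \<in> borel_measurable borel" "flip F \<in> borel_measurable borel"
    using assms measurable_flip by auto
  show ?thesis
    using nn_integral_lborel_prod(2)[of "\<lambda>z. ennreal ((cmod (F z))\<^sup>2)"]
      nn_integral_lborel_prod(1)[of "\<lambda>z. ennreal ((cmod (flip F z))\<^sup>2)"]
    by (simp add: sqnorm_def flip_def)
qed

lemma L2_flip: "F \<in> L2 lborel \<Longrightarrow> flip F \<in> L2 lborel"
  by (simp add: L2_iff sqnorm_flip measurable_flip[simplified])

lemma measurable_weyl_kernel:
  assumes "\<Phi> \<in> borel_measurable lborel"
  shows "weyl_kernel lam \<Phi> \<in> borel_measurable lborel"
proof -
  have [measurable]: "\<Phi> \<in> borel_measurable borel"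
    using assms by simp
  have "weyl_kernel lam \<Phi> \<in> borel_measurable borel"
    unfolding weyl_kernel_def[abs_def] by measurable
  then show ?thesis
    by simp
qed

text \<open>The coordinates \<open>(\<eta> - \<xi>, lam (\<xi> + \<eta>) / 2)\<close> have Jacobian determinant \<open>- lam\<close>. This is the Plancherel factor.\<close>

lemma sqnorm_weyl_kernel:
  assumes "\<Phi> \<in> borel_measurable lborel" "lam \<noteq> 0"
  shows "ennreal \<bar>lam\<bar> * sqnorm lborel (weyl_kernel lam \<Phi>) = sqnorm lborel \<Phi>"
proof -
  have m[measurable]: "\<Phi> \<in> borel_measurable borel" "weyl_kernel lam \<Phi> \<in> borel_measurable borel"
    using assms(1) measurable_weyl_kernel[OF assms(1)] by auto
  define h where "h z = ennreal ((cmod (\<Phi> z))\<^sup>2)" for z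
  have [measurable]: "h \<in> borel_measurable borel"
    unfolding h_def[abs_def] by measurable
  have "sqnorm lborel (weyl_kernel lam \<Phi>) = (\<integral>\<^sup>+\<xi>. \<integral>\<^sup>+\<eta>. h (\<eta> - \<xi>, lam * (\<xi> + \<eta>) / 2) \<partial>lborel \<partial>lborel)"
    unfolding sqnorm_def by (subst nn_integral_lborel_prod(1)[symmetric]) (auto simp: weyl_kernel_def h_def)
  also have "\<dots> = (\<integral>\<^sup>+\<xi>. \<integral>\<^sup>+y. h (y, lam * y / 2 + lam * \<xi>) \<partial>lborel \<partial>lborel)"
  proof (rule nn_integral_cong)
    fix \<xi> :: real
    have "(\<integral>\<^sup>+\<eta>. h (\<eta> - \<xi>, lam * (\<xi> + \<eta>) / 2) \<partial>lborel)
        = (\<integral>\<^sup>+\<eta>. (\<lambda>y. h (y, lam * y / 2 + lam * \<xi>)) (\<eta> - \<xi>) \<partial>lborel)"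
      by (intro nn_integral_cong arg_cong[where f=h]) (simp add: field_simps)
    also have "\<dots> = (\<integral>\<^sup>+y. h (y, lam * y / 2 + lam * \<xi>) \<partial>lborel)"
      by (rule nn_integral_translate) measurable
    finally show "(\<integral>\<^sup>+\<eta>. h (\<eta> - \<xi>, lam * (\<xi> + \<eta>) / 2) \<partial>lborel) = \<dots>" .
  qed
  also have "\<dots> = (\<integral>\<^sup>+y. \<integral>\<^sup>+\<xi>. h (y, lam * y / 2 + lam * \<xi>) \<partial>lborel \<partial>lborel)"
    by (rule lborel_pair.Fubini'[symmetric]) measurable
  finally have "ennreal \<bar>lam\<bar> * sqnorm lborel (weyl_kernel lam \<Phi>)
      = (\<integral>\<^sup>+y. ennreal \<bar>lam\<bar> * (\<integral>\<^sup>+\<xi>. h (y, lam * y / 2 + lam * \<xi>) \<partial>lborel) \<partial>lborel)"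
    by (subst nn_integral_cmult) auto
  also have "\<dots> = (\<integral>\<^sup>+y. \<integral>\<^sup>+\<omega>. h (y, \<omega>) \<partial>lborel \<partial>lborel)"
    by (intro nn_integral_cong nn_integral_real_affine[symmetric] assms(2)) measurable
  also have "\<dots> = sqnorm lborel \<Phi>"
    unfolding sqnorm_def h_def by (rule nn_integral_lborel_prod(1)) measurable
  finally show ?thesis .
qed

lemma L2_weyl_kernel:
  assumes "\<Phi> \<in> L2 lborel" "lam \<noteq> 0"
  shows "weyl_kernel lam \<Phi> \<in> L2 lborel"
proof -
  have "ennreal \<bar>lam\<bar> * sqnorm lborel (weyl_kernel lam \<Phi>) < \<infinity>"
    using assms by (simp add: sqnorm_weyl_kernel L2_iff)
  then show ?thesis
    using assms measurable_weyl_kernel[OF L2_measurable[OF assms(1)]]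
    by (auto simp: L2_iff ennreal_mult_less_top)
qed

lemma fibre_integrable_flip:
  assumes F: "F \<in> L2 lborel" and int: "integrable lborel F"
  shows "fibre_integrable lborel (flip F)"
proof -
  have "integrable (lborel \<Otimes>\<^sub>M lborel) (case_prod (\<lambda>x y. F (x, y)))"
    using int by (simp add: lborel_prod)
  then have "AE y in lborel. integrable lborel (\<lambda>x. F (x, y))"
    by (rule lborel_pair.AE_integrable_snd)
  then show ?thesis
    using L2_flip[OF F] by (simp add: fibre_integrable_def lborel_prod flip_def)
qed

text \<open>For integrable \<open>F\<close>, integrating first in \<open>x\<close> exhibits the Weyl operator as an integral operator. The
  interchange is allowed for almost every \<open>\<xi>\<close>: since \<open>|\<phi>| \<le> 1 + |\<phi>|\<^sup>2\<close>, it suffices that the convolution of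
  \<open>|F|\<close> with the integrable function \<open>|\<phi>|\<^sup>2\<close> is finite almost everywhere.\<close>

lemma weyl_integral_kernel:
  assumes F: "F \<in> L2 lborel" "integrable lborel F" and \<phi>: "\<phi> \<in> L2 lborel"
  shows "AE \<xi> in lborel. weyl_integral lam F \<phi> \<xi> = kernel_op (weyl_kernel lam (partial_fourier (flip F))) \<phi> \<xi>"
proof -
  have [measurable]: "F \<in> borel_measurable borel" "\<phi> \<in> borel_measurable borel"
    using L2_measurable[OF F(1)] L2_measurable[OF \<phi>] by auto
  have "(\<integral>\<^sup>+\<xi>. \<integral>\<^sup>+z. ennreal (cmod (F z)) * ennreal ((cmod (\<phi> (\<xi> + snd z)))\<^sup>2) \<partial>lborel \<partial>lborel)
      = (\<integral>\<^sup>+z. \<integral>\<^sup>+\<xi>. ennreal (cmod (F z)) * ennreal ((cmod (\<phi> (\<xi> + snd z)))\<^sup>2) \<partial>lborel \<partial>lborel)"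
    by (rule lborel_pair.Fubini'[symmetric]) measurable
  also have "\<dots> = (\<integral>\<^sup>+z. ennreal (cmod (F z)) * sqnorm lborel \<phi> \<partial>lborel)"
  proof (rule nn_integral_cong)
    fix z :: "real \<times> real"
    have "(\<integral>\<^sup>+\<xi>. ennreal (cmod (F z)) * ennreal ((cmod (\<phi> (\<xi> + snd z)))\<^sup>2) \<partial>lborel)
      = ennreal (cmod (F z)) * (\<integral>\<^sup>+\<xi>. (\<lambda>\<xi>. ennreal ((cmod (\<phi> \<xi>))\<^sup>2)) (\<xi> - (- snd z)) \<partial>lborel)"
      by (subst nn_integral_cmult) auto
    also have "\<dots> = ennreal (cmod (F z)) * sqnorm lborel \<phi>"
      by (subst nn_integral_translate) (auto simp: sqnorm_def)
    finally show "(\<integral>\<^sup>+\<xi>. ennreal (cmod (F z)) * ennreal ((cmod (\<phi> (\<xi> + snd z)))\<^sup>2) \<partial>lborel) = \<dots>" .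
  qed
  also have "\<dots> = (\<integral>\<^sup>+z. ennreal (cmod (F z)) \<partial>lborel) * sqnorm lborel \<phi>"
    by (rule nn_integral_multc) measurable
  also have "\<dots> < \<infinity>"
    using F(2) \<phi> by (auto simp: integrable_iff_bounded L2_iff ennreal_mult_less_top)
  finally have "AE \<xi> in lborel. (\<integral>\<^sup>+z. ennreal (cmod (F z)) * ennreal ((cmod (\<phi> (\<xi> + snd z)))\<^sup>2) \<partial>lborel) \<noteq> \<infinity>"
    by (intro nn_integral_PInf_AE) auto
  then show ?thesis
  proof eventually_elim
    case (elim \<xi>)
    define h where "h x y = F (x, y) * (cis (2 * pi * lam * (x * \<xi> + x * y / 2)) * \<phi> (\<xi> + y))" for x y
    have "integrable lborel (\<lambda>z. h (fst z) (snd z))"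
      unfolding integrable_iff_bounded
    proof
      have "(\<integral>\<^sup>+z. ennreal (cmod (h (fst z) (snd z))) \<partial>lborel)
        \<le> (\<integral>\<^sup>+z. ennreal (cmod (F z)) + ennreal (cmod (F z)) * ennreal ((cmod (\<phi> (\<xi> + snd z)))\<^sup>2) \<partial>lborel)"
      proof (rule nn_integral_mono)
        fix z :: "real \<times> real"
        have "2 * cmod (\<phi> (\<xi> + snd z)) \<le> 1 + (cmod (\<phi> (\<xi> + snd z)))\<^sup>2"
          using sum_squares_bound[of 1 "cmod (\<phi> (\<xi> + snd z))"] by simp
        then have "cmod (\<phi> (\<xi> + snd z)) \<le> 1 + (cmod (\<phi> (\<xi> + snd z)))\<^sup>2"
          using norm_ge_zero[of "\<phi> (\<xi> + snd z)"] by linarith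
        from mult_left_mono[OF this norm_ge_zero[of "F z"]]
        have "cmod (h (fst z) (snd z)) \<le> cmod (F z) + cmod (F z) * (cmod (\<phi> (\<xi> + snd z)))\<^sup>2"
          by (simp add: h_def norm_mult distrib_left)
        then show "ennreal (cmod (h (fst z) (snd z)))
            \<le> ennreal (cmod (F z)) + ennreal (cmod (F z)) * ennreal ((cmod (\<phi> (\<xi> + snd z)))\<^sup>2)"
          by (simp flip: ennreal_mult ennreal_plus)
      qed
      also have "\<dots> = (\<integral>\<^sup>+z. ennreal (cmod (F z)) \<partial>lborel)
          + (\<integral>\<^sup>+z. ennreal (cmod (F z)) * ennreal ((cmod (\<phi> (\<xi> + snd z)))\<^sup>2) \<partial>lborel)"
        by (rule nn_integral_add) measurable
      also have "\<dots> < \<infinity>"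
        using elim F(2) by (auto simp: integrable_iff_bounded less_top)
      finally show "(\<integral>\<^sup>+z. ennreal (cmod (h (fst z) (snd z))) \<partial>lborel) < \<infinity>" .
      have "(\<lambda>z. h (fst z) (snd z)) \<in> borel_measurable borel"
        unfolding h_def by measurable
      then show "(\<lambda>z. h (fst z) (snd z)) \<in> borel_measurable lborel"
        by simp
    qed
    then have int: "integrable (lborel \<Otimes>\<^sub>M lborel) (case_prod h)"
      by (simp add: lborel_prod case_prod_beta')
    have "weyl_integral lam F \<phi> \<xi> = integral\<^sup>L (lborel \<Otimes>\<^sub>M lborel) (case_prod h)"
      by (simp add: weyl_integral_def h_def lborel_prod case_prod_beta')
    also have "\<dots> = (LINT y|lborel. LINT x|lborel. h x y)"
      by (rule lborel_pair.integral_snd[OF int, symmetric])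
    also have "\<dots> = (LINT y|lborel. partial_fourier (flip F) (y, lam * (\<xi> + y / 2)) * \<phi> (\<xi> + y))"
    proof (rule Bochner_Integration.integral_cong[OF refl])
      fix y :: real
      have "h x y = (F (x, y) * cis (2 * pi * (lam * (\<xi> + y / 2)) * x)) * \<phi> (\<xi> + y)" for x
        by (simp add: h_def algebra_simps)
      then show "(LINT x|lborel. h x y) = partial_fourier (flip F) (y, lam * (\<xi> + y / 2)) * \<phi> (\<xi> + y)"
        by (simp add: partial_fourier_def fourier_def flip_def)
    qed
    also have "\<dots> = kernel_op (weyl_kernel lam (partial_fourier (flip F))) \<phi> \<xi>"
      unfolding kernel_op_def weyl_kernel_def
      by (subst lborel_integral_real_affine[where c=1 and t=\<xi>])
         (auto intro!: Bochner_Integration.integral_cong simp: field_simps)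
    finally show ?case .
  qed
qed


lemma measurable_weyl_integral:
  assumes "F \<in> borel_measurable lborel" "\<phi> \<in> borel_measurable lborel"
  shows "weyl_integral lam F \<phi> \<in> borel_measurable lborel"
proof -
  have [measurable]: "F \<in> borel_measurable borel" "\<phi> \<in> borel_measurable borel"
    using assms by auto
  have "(\<lambda>w. F (snd w) * (cis (2 * pi * lam * (fst (snd w) * fst w + fst (snd w) * snd (snd w) / 2)) * \<phi> (fst w + snd (snd w))))
      \<in> borel_measurable borel"
    by measurable
  then have "(\<lambda>w. F (snd w) * (cis (2 * pi * lam * (fst (snd w) * fst w + fst (snd w) * snd (snd w) / 2)) * \<phi> (fst w + snd (snd w))))
      \<in> borel_measurable (lborel \<Otimes>\<^sub>M lborel)"
    by (simp add: lborel_prod)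
  from lborel.borel_measurable_lebesgue_integral[of "\<lambda>\<xi> z. F z * (cis (2 * pi * lam * (fst z * \<xi> + fst z * snd z / 2)) * \<phi> (\<xi> + snd z))" lborel] this
  show ?thesis
    by (simp add: weyl_integral_def[abs_def] case_prod_beta')
qed

lemma hs_norm_sq_weyl_integral_diff:
  assumes F': "F' \<in> L2 lborel" "integrable lborel F'" and F: "F \<in> L2 lborel"
    and \<Phi>: "is_pft lborel (flip F) \<Phi>" and "lam \<noteq> 0"
  shows "ennreal \<bar>lam\<bar> * hs_norm_sq (\<lambda>\<phi> \<xi>. weyl_integral lam F' \<phi> \<xi> - kernel_op (weyl_kernel lam \<Phi>) \<phi> \<xi>)
    = sqnorm lborel (\<lambda>z. F' z - F z)"
proof -
  let ?\<Phi>' = "partial_fourier (flip F')"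
  have pft': "is_pft lborel (flip F') ?\<Phi>'"
    by (rule is_pft_fibre_integrable[OF fibre_integrable_flip[OF F']])
  have L: "?\<Phi>' \<in> L2 lborel" "\<Phi> \<in> L2 lborel"
    using pft' \<Phi> by (simp_all add: is_pft_def lborel_prod)
  have d: "(\<lambda>z. ?\<Phi>' z - \<Phi> z) \<in> L2 lborel"
    by (rule L2_diff[OF L])
  note K' = L2_weyl_kernel[OF L(1) \<open>lam \<noteq> 0\<close>] and K = L2_weyl_kernel[OF L(2) \<open>lam \<noteq> 0\<close>]
  have "hs_norm_sq (\<lambda>\<phi> \<xi>. weyl_integral lam F' \<phi> \<xi> - kernel_op (weyl_kernel lam \<Phi>) \<phi> \<xi>)
      = hs_norm_sq (kernel_op (weyl_kernel lam (\<lambda>z. ?\<Phi>' z - \<Phi> z)))"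
  proof (rule hs_norm_sq_cong)
    fix n
    show "AE \<xi> in lborel. weyl_integral lam F' (hs_basis n) \<xi> - kernel_op (weyl_kernel lam \<Phi>) (hs_basis n) \<xi>
        = kernel_op (weyl_kernel lam (\<lambda>z. ?\<Phi>' z - \<Phi> z)) (hs_basis n) \<xi>"
      using weyl_integral_kernel[OF F' hs_basis_L2[of n]] kernel_integrable[OF K' hs_basis_L2[of n]]
        kernel_integrable[OF K hs_basis_L2[of n]]
      by eventually_elim (simp add: kernel_op_def weyl_kernel_def left_diff_distrib)
  qed
  also have "\<dots> = sqnorm lborel (weyl_kernel lam (\<lambda>z. ?\<Phi>' z - \<Phi> z))"
    by (rule hs_norm_sq_kernel[OF L2_weyl_kernel[OF d \<open>lam \<noteq> 0\<close>]])
  finally have "ennreal \<bar>lam\<bar> * hs_norm_sq (\<lambda>\<phi> \<xi>. weyl_integral lam F' \<phi> \<xi> - kernel_op (weyl_kernel lam \<Phi>) \<phi> \<xi>)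
      = sqnorm lborel (\<lambda>z. ?\<Phi>' z - \<Phi> z)"
    using sqnorm_weyl_kernel[OF L2_measurable[OF d] \<open>lam \<noteq> 0\<close>] by simp
  also have "\<dots> = sqnorm lborel (\<lambda>z. flip F' z - flip F z)"
    using is_pft_isometry[OF _ is_pft_diff[OF _ _ pft' \<Phi>]] L2_flip[OF F'(1)] L2_flip[OF F]
    by (simp add: sqnorm_conv d L2_diff lborel_prod)
  also have "\<dots> = sqnorm lborel (\<lambda>z. F' z - F z)"
    using sqnorm_flip[OF L2_measurable[OF L2_diff[OF F'(1) F]]] by (simp add: flip_def[abs_def])
  finally show ?thesis .
qed

lemma is_weyl_transform_kernel:
  assumes F: "F \<in> L2 lborel" and \<Phi>: "is_pft lborel (flip F) \<Phi>" and "lam \<noteq> 0"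
  shows "is_weyl_transform lam F (kernel_op (weyl_kernel lam \<Phi>))"
proof -
  define Fs where "Fs n z = of_real (indicator (cball 0 (real n)) z) * F z" for n and z :: "real \<times> real"
  have ev: "\<forall>\<^sub>F n in sequentially. z \<in> cball 0 (real n)" for z :: "real \<times> real"
  proof -
    obtain n0 where "norm z < real n0"
      using reals_Archimedean2 by blast
    then show ?thesis
      by (intro eventually_mono[OF eventually_ge_at_top[of n0]]) auto
  qed
  have Fs: "Fs n \<in> L2 lborel" "(\<lambda>n. L2_norm_sq lborel (\<lambda>z. Fs n z - F z)) \<longlonglongrightarrow> 0" for n
    unfolding Fs_def[abs_def] using L2_truncate[OF F, of "\<lambda>n. cball 0 (real n)"] ev by auto
  have int: "integrable lborel (Fs n)" for n
  proof -
    have "(\<lambda>z. complex_of_real (indicator (cball 0 (real n)) z)) \<in> L2 (lborel :: (real \<times> real) measure)"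
      using emeasure_lborel_cball_finite[of "0 :: real \<times> real" "real n"]
      by (intro indicator_L2) (auto simp: less_top)
    from L2_integrable_mult[OF F this] show ?thesis
      by (simp add: Fs_def[abs_def] mult.commute)
  qed
  let ?hs = "\<lambda>n. hs_norm_sq (\<lambda>\<phi> \<xi>. weyl_integral lam (Fs n) \<phi> \<xi> - kernel_op (weyl_kernel lam \<Phi>) \<phi> \<xi>)"
  have "(\<lambda>n. sqnorm lborel (\<lambda>z. Fs n z - F z)) \<longlonglongrightarrow> 0"
    using Fs(2) by (subst sqnorm_tendsto_0_iff) (auto intro: L2_diff Fs F)
  then have "(\<lambda>n. ennreal (1 / \<bar>lam\<bar>) * sqnorm lborel (\<lambda>z. Fs n z - F z)) \<longlonglongrightarrow> ennreal (1 / \<bar>lam\<bar>) * 0"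
    by (intro ennreal_tendsto_cmult) auto
  moreover have "ennreal (1 / \<bar>lam\<bar>) * sqnorm lborel (\<lambda>z. Fs n z - F z) = ?hs n" for n
    unfolding hs_norm_sq_weyl_integral_diff[OF Fs(1) int F \<Phi> \<open>lam \<noteq> 0\<close>, symmetric]
    using \<open>lam \<noteq> 0\<close> by (simp add: mult.assoc[symmetric] flip: ennreal_mult)
  ultimately have "?hs \<longlonglongrightarrow> 0"
    by simp
  moreover have "\<Phi> \<in> L2 lborel"
    using \<Phi> by (simp add: is_pft_def lborel_prod)
  ultimately show ?thesis
    unfolding is_weyl_transform_def using F Fs int \<open>lam \<noteq> 0\<close>
    by (intro conjI bounded_kernel_op L2_weyl_kernel exI[of _ Fs]) auto
qed

lemma bounded_l2op_measurable: "bounded_l2op T \<Longrightarrow> T (hs_basis n) \<in> borel_measurable lborel"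
  unfolding bounded_l2op_def using hs_basis_L2 L2_measurable by blast

text \<open>The approximating functions in \<open>is_weyl_transform\<close> are arbitrary. Their Weyl integrals converge to \<open>T\<close>
  by assumption, and to the integral operator by \<open>hs_norm_sq_weyl_integral_diff\<close>.\<close>

lemma is_weyl_transform_unique:
  assumes T: "is_weyl_transform lam F T" and \<Phi>: "is_pft lborel (flip F) \<Phi>" and "lam \<noteq> 0"
  shows "AE \<xi> in lborel. T (hs_basis n) \<xi> = kernel_op (weyl_kernel lam \<Phi>) (hs_basis n) \<xi>"
proof -
  let ?K = "kernel_op (weyl_kernel lam \<Phi>)"
  obtain Fs where Fs: "\<And>n. Fs n \<in> L2 lborel" "\<And>n. integrable lborel (Fs n)"
      "(\<lambda>n. L2_norm_sq lborel (\<lambda>p. Fs n p - F p)) \<longlonglongrightarrow> 0"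
      "(\<lambda>n. hs_norm_sq (\<lambda>\<phi> \<xi>. weyl_integral lam (Fs n) \<phi> \<xi> - T \<phi> \<xi>)) \<longlonglongrightarrow> 0"
    and F: "F \<in> L2 lborel" and b: "bounded_l2op T"
    using T unfolding is_weyl_transform_def by blast
  have \<Phi>L: "\<Phi> \<in> L2 lborel"
    using \<Phi> by (simp add: is_pft_def lborel_prod)
  note Kb = bounded_kernel_op[OF L2_weyl_kernel[OF \<Phi>L \<open>lam \<noteq> 0\<close>]]
  have "(\<lambda>n. sqnorm lborel (\<lambda>z. Fs n z - F z)) \<longlonglongrightarrow> 0"
    using Fs(3) by (subst sqnorm_tendsto_0_iff) (auto intro: L2_diff Fs F)
  then have "(\<lambda>n. ennreal (2 / \<bar>lam\<bar>) * sqnorm lborel (\<lambda>z. Fs n z - F z)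
      + 2 * hs_norm_sq (\<lambda>\<phi> \<xi>. weyl_integral lam (Fs n) \<phi> \<xi> - T \<phi> \<xi>)) \<longlonglongrightarrow> ennreal (2 / \<bar>lam\<bar>) * 0 + 2 * 0"
    using Fs(4) by (intro tendsto_add ennreal_tendsto_cmult) auto
  moreover have "hs_norm_sq (\<lambda>\<phi> \<xi>. ?K \<phi> \<xi> - T \<phi> \<xi>) \<le> ennreal (2 / \<bar>lam\<bar>) * sqnorm lborel (\<lambda>z. Fs n z - F z)
      + 2 * hs_norm_sq (\<lambda>\<phi> \<xi>. weyl_integral lam (Fs n) \<phi> \<xi> - T \<phi> \<xi>)" for n
  proof -
    have "ennreal (2 / \<bar>lam\<bar>) * sqnorm lborel (\<lambda>z. Fs n z - F z)
        = 2 * hs_norm_sq (\<lambda>\<phi> \<xi>. weyl_integral lam (Fs n) \<phi> \<xi> - ?K \<phi> \<xi>)"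
      unfolding hs_norm_sq_weyl_integral_diff[OF Fs(1,2) F \<Phi> \<open>lam \<noteq> 0\<close>, symmetric]
      using \<open>lam \<noteq> 0\<close> by (simp add: mult.assoc[symmetric] flip: ennreal_mult)
    moreover have "weyl_integral lam (Fs n) (hs_basis m) \<in> borel_measurable lborel" for m
      by (intro measurable_weyl_integral L2_measurable Fs hs_basis_L2)
    ultimately show ?thesis
      using hs_norm_sq_triangle[of ?K "weyl_integral lam (Fs n)" T] bounded_l2op_measurable[OF b]
        bounded_l2op_measurable[OF Kb] hs_norm_sq_diff_commute[of ?K "weyl_integral lam (Fs n)"]
      by simp
  qed
  ultimately have "hs_norm_sq (\<lambda>\<phi> \<xi>. ?K \<phi> \<xi> - T \<phi> \<xi>) \<le> 0"
    by (intro LIMSEQ_le_const) auto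
  then have "AE \<xi> in lborel. ?K (hs_basis n) \<xi> - T (hs_basis n) \<xi> = 0"
    using bounded_l2op_measurable[OF b] bounded_l2op_measurable[OF Kb]
    by (intro hs_norm_sq_eq_0D[of "\<lambda>\<phi> \<xi>. ?K \<phi> \<xi> - T \<phi> \<xi>"]) auto
  then show ?thesis
    by eventually_elim simp
qed

definition weyl_op :: "real \<Rightarrow> (real \<times> real \<Rightarrow> complex) \<Rightarrow> l2op" where
  "weyl_op lam F = (SOME T. is_weyl_transform lam F T)"

lemma is_pft_flip_exists:
  assumes "F \<in> L2 lborel"
  obtains \<Phi> where "is_pft lborel (flip F) \<Phi>" "\<Phi> \<in> L2 lborel"
  using is_pft_exists[of "flip F" lborel] L2_flip[OF assms] by (auto simp: lborel_prod is_pft_def)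

lemma is_weyl_transform_weyl_op:
  assumes "F \<in> L2 lborel" "lam \<noteq> 0"
  shows "is_weyl_transform lam F (weyl_op lam F)"
proof -
  obtain \<Phi> where "is_pft lborel (flip F) \<Phi>"
    using is_pft_flip_exists[OF assms(1)] by blast
  then have "is_weyl_transform lam F (kernel_op (weyl_kernel lam \<Phi>))"
    using assms by (intro is_weyl_transform_kernel)
  then show ?thesis
    unfolding weyl_op_def by (rule someI[of "is_weyl_transform lam F"])
qed

lemma bounded_weyl_op: "F \<in> L2 lborel \<Longrightarrow> lam \<noteq> 0 \<Longrightarrow> bounded_l2op (weyl_op lam F)"
  using is_weyl_transform_weyl_op[of F lam] by (simp add: is_weyl_transform_def)

text \<open>The Plancherel formula for the Weyl transform, in a form that yields both the isometry and
  its linearity: the operators \<open>weyl_op\<close> are chosen separately for each function, so a linear combination of them is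
  only known through its distance to another such operator.\<close>

theorem hs_norm_sq_weyl_lincomb:
  assumes G: "G \<in> L2 lborel" and F: "\<And>j. j \<in> J \<Longrightarrow> F j \<in> L2 lborel" and "finite J" "lam \<noteq> 0"
  shows "hs_norm_sq (\<lambda>\<phi> \<xi>. of_real (sqrt \<bar>lam\<bar>) * weyl_op lam G \<phi> \<xi>
      - (\<Sum>j\<in>J. c j * (of_real (sqrt \<bar>lam\<bar>) * weyl_op lam (F j) \<phi> \<xi>)))
    = sqnorm lborel (\<lambda>z. G z - (\<Sum>j\<in>J. c j * F j z))"
proof -
  obtain \<Gamma> where \<Gamma>: "is_pft lborel (flip G) \<Gamma>" "\<Gamma> \<in> L2 lborel"
    using is_pft_flip_exists[OF G] by blast
  have "\<forall>j\<in>J. \<exists>\<Phi>. is_pft lborel (flip (F j)) \<Phi> \<and> \<Phi> \<in> L2 lborel"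
    using is_pft_flip_exists[OF F] by metis
  then obtain \<Phi> where \<Phi>: "\<And>j. j \<in> J \<Longrightarrow> is_pft lborel (flip (F j)) (\<Phi> j)" "\<And>j. j \<in> J \<Longrightarrow> \<Phi> j \<in> L2 lborel"
    by metis
  define \<Psi> where "\<Psi> z = \<Gamma> z - (\<Sum>j\<in>J. c j * \<Phi> j z)" for z
  have \<Psi>: "\<Psi> \<in> L2 lborel"
    unfolding \<Psi>_def[abs_def] by (intro L2_diff L2_sum L2_cmult \<Gamma> \<Phi>)
  have eq: "AE \<xi> in lborel. of_real (sqrt \<bar>lam\<bar>) * weyl_op lam G (hs_basis n) \<xi>
      - (\<Sum>j\<in>J. c j * (of_real (sqrt \<bar>lam\<bar>) * weyl_op lam (F j) (hs_basis n) \<xi>))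
      = of_real (sqrt \<bar>lam\<bar>) * kernel_op (weyl_kernel lam \<Psi>) (hs_basis n) \<xi>" for n
  proof -
    have K: "(\<lambda>z. weyl_kernel lam \<Gamma> z - (\<Sum>j\<in>J. c j * weyl_kernel lam (\<Phi> j) z)) = weyl_kernel lam \<Psi>"
      by (simp add: weyl_kernel_def \<Psi>_def fun_eq_iff)
    have "AE \<xi> in lborel. \<forall>j\<in>J. weyl_op lam (F j) (hs_basis n) \<xi> = kernel_op (weyl_kernel lam (\<Phi> j)) (hs_basis n) \<xi>"
      using is_weyl_transform_unique[OF is_weyl_transform_weyl_op[OF F \<open>lam \<noteq> 0\<close>] \<Phi>(1) \<open>lam \<noteq> 0\<close>] \<open>finite J\<close>
      by (intro AE_finite_allI) auto
    moreover have "AE \<xi> in lborel. weyl_op lam G (hs_basis n) \<xi> = kernel_op (weyl_kernel lam \<Gamma>) (hs_basis n) \<xi>"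
      by (rule is_weyl_transform_unique[OF is_weyl_transform_weyl_op[OF G \<open>lam \<noteq> 0\<close>] \<Gamma>(1) \<open>lam \<noteq> 0\<close>])
    moreover have "AE \<xi> in lborel. kernel_op (\<lambda>z. weyl_kernel lam \<Gamma> z - (\<Sum>j\<in>J. c j * weyl_kernel lam (\<Phi> j) z)) (hs_basis n) \<xi>
        = kernel_op (weyl_kernel lam \<Gamma>) (hs_basis n) \<xi> - (\<Sum>j\<in>J. c j * kernel_op (weyl_kernel lam (\<Phi> j)) (hs_basis n) \<xi>)"
      using \<open>finite J\<close> \<open>lam \<noteq> 0\<close> by (intro kernel_op_lincomb L2_weyl_kernel \<Gamma> \<Phi> hs_basis_L2)
    ultimately show ?thesis
      unfolding K by eventually_elim (simp add: right_diff_distrib sum_distrib_left mult.left_commute)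
  qed
  have "hs_norm_sq (\<lambda>\<phi> \<xi>. of_real (sqrt \<bar>lam\<bar>) * weyl_op lam G \<phi> \<xi>
      - (\<Sum>j\<in>J. c j * (of_real (sqrt \<bar>lam\<bar>) * weyl_op lam (F j) \<phi> \<xi>)))
      = hs_norm_sq (\<lambda>\<phi> \<xi>. of_real (sqrt \<bar>lam\<bar>) * kernel_op (weyl_kernel lam \<Psi>) \<phi> \<xi>)"
    by (rule hs_norm_sq_cong) (rule eq)
  also have "\<dots> = ennreal \<bar>lam\<bar> * hs_norm_sq (kernel_op (weyl_kernel lam \<Psi>))"
    using bounded_l2op_measurable[OF bounded_kernel_op[OF L2_weyl_kernel[OF \<Psi> \<open>lam \<noteq> 0\<close>]]]
    by (simp add: hs_norm_sq_basis sqnorm_cmult ennreal_suminf_cmult)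
  also have "\<dots> = sqnorm lborel \<Psi>"
    by (simp only: hs_norm_sq_kernel[OF L2_weyl_kernel[OF \<Psi> \<open>lam \<noteq> 0\<close>]]
        sqnorm_weyl_kernel[OF L2_measurable[OF \<Psi>] \<open>lam \<noteq> 0\<close>])
  also have "\<dots> = sqnorm lborel (\<lambda>z. flip G z - (\<Sum>j\<in>J. c j * flip (F j) z))"
  proof -
    have "is_pft lborel (\<lambda>z. flip G z - (\<Sum>j\<in>J. c j * flip (F j) z)) \<Psi>"
      unfolding \<Psi>_def[abs_def] using L2_flip[OF G] L2_flip[OF F]
      by (intro is_pft_diff is_pft_sum \<Gamma> \<Phi> L2_sum L2_cmult) (auto simp: lborel_prod)
    moreover have "(\<lambda>z. flip G z - (\<Sum>j\<in>J. c j * flip (F j) z)) \<in> L2 lborel"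
      by (intro L2_diff L2_sum L2_cmult L2_flip G F)
    ultimately show ?thesis
      using is_pft_isometry[of "\<lambda>z. flip G z - (\<Sum>j\<in>J. c j * flip (F j) z)" lborel \<Psi>] \<Psi>
      by (simp add: sqnorm_conv lborel_prod)
  qed
  also have "\<dots> = sqnorm lborel (\<lambda>z. G z - (\<Sum>j\<in>J. c j * F j z))"
    using sqnorm_flip[OF L2_measurable[OF L2_diff[OF G L2_sum[of J "\<lambda>j z. c j * F j z"]]]] F
    by (simp add: flip_def[abs_def] L2_cmult)
  finally show ?thesis .
qed

section \<open>The fibre space over a frequency\<close>

lemma infsum_count_space:
  fixes f :: "int \<Rightarrow> ennreal"
  shows "(\<Sum>\<^sub>\<infinity>r. f r) = (\<integral>\<^sup>+r. f r \<partial>count_space UNIV)"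
proof -
  have bij: "bij (from_nat_into (UNIV :: int set))"
    by (intro bij_betw_from_nat_into) (auto simp: infinite_UNIV_int)
  have "(\<Sum>\<^sub>\<infinity>r. f r) = (\<Sum>\<^sub>\<infinity>n. f (from_nat_into UNIV n))"
    by (rule infsum_reindex_bij_betw[OF bij, symmetric])
  also have "\<dots> = (\<Sum>n. f (from_nat_into UNIV n))"
    using has_sum_infsum[OF nonneg_summable_on_complete[of UNIV "\<lambda>n. f (from_nat_into UNIV n)"]]
    by (intro sums_unique has_sum_imp_sums) auto
  also have "\<dots> = (\<integral>\<^sup>+r. f r \<partial>count_space UNIV)"
    by (simp add: nn_integral_bij_count_space[OF bij, symmetric] nn_integral_count_space_nat)
  finally show ?thesis .
qed

lemma measurable_nn_integral_count_space:
  fixes h :: "'a \<Rightarrow> int \<Rightarrow> ennreal"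
  assumes [measurable]: "\<And>r. (\<lambda>x. h x r) \<in> borel_measurable M"
  shows "(\<lambda>x. \<integral>\<^sup>+r. h x r \<partial>count_space UNIV) \<in> borel_measurable M"
proof -
  have bij: "bij (from_nat_into (UNIV :: int set))"
    by (intro bij_betw_from_nat_into) (auto simp: infinite_UNIV_int)
  have "(\<lambda>x. \<integral>\<^sup>+r. h x r \<partial>count_space UNIV) = (\<lambda>x. \<Sum>n. h x (from_nat_into UNIV n))"
    by (simp add: nn_integral_bij_count_space[OF bij, symmetric] nn_integral_count_space_nat)
  then show ?thesis
    by simp
qed

lemma has_sum_integral_count_space:
  fixes f :: "'i \<Rightarrow> complex"
  assumes "integrable (count_space UNIV) f"
  shows "(f has_sum (LINT i|count_space UNIV. f i)) UNIV"
proof -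
  have abs: "Infinite_Set_Sum.abs_summable_on f UNIV"
    using assms by (simp add: Infinite_Set_Sum.abs_summable_on_def)
  then have "f summable_on UNIV"
    using abs_summable_equivalent abs_summable_summable by blast
  then have "(f has_sum infsum f UNIV) UNIV"
    by (rule has_sum_infsum)
  then show ?thesis
    using infsetsum_infsum[OF abs] by (simp add: infsetsum_def)
qed

text \<open>Square-summable families \<open>(s\<^sub>r)\<close> of functions on the plane are square-integrable functions \<open>s (r, p)\<close> on
  \<open>\<int> \<times> \<real>\<^sup>2\<close>, so the fibre is again an \<open>L\<^sup>2\<close> space.\<close>

abbreviation fibre_measure :: "(int \<times> real \<times> real) measure" where
  "fibre_measure \<equiv> count_space UNIV \<Otimes>\<^sub>M lborel"

lemma measurable_fibre_measure:
  "(\<And>r. (\<lambda>p. f (r, p)) \<in> measurable lborel N) \<Longrightarrow> f \<in> measurable fibre_measure N"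
  by (rule measurable_pair_measure_countable1) auto

lemma measurable_fibre_section:
  "f \<in> measurable fibre_measure N \<Longrightarrow> (\<lambda>p. f (r, p)) \<in> measurable lborel N"
  by (rule measurable_compose[OF measurable_Pair1']) auto

lemma sqnorm_fibre_measure:
  assumes "f \<in> borel_measurable fibre_measure"
  shows "sqnorm fibre_measure f = (\<integral>\<^sup>+r. sqnorm lborel (\<lambda>p. f (r, p)) \<partial>count_space UNIV)"
  unfolding sqnorm_def using assms by (subst lborel.nn_integral_fst[symmetric]) auto

lemma L2_fibre_section:
  assumes "f \<in> L2 fibre_measure"
  shows "(\<lambda>p. f (r, p)) \<in> L2 lborel"
proof -
  have "sqnorm lborel (\<lambda>p. f (r, p)) \<le> sqnorm fibre_measure f"
    unfolding sqnorm_fibre_measure[OF L2_measurable[OF assms]] by (rule nn_integral_ge_point) simp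
  then show ?thesis
    using assms measurable_fibre_section[of f borel r] by (auto simp: L2_iff intro: le_less_trans)
qed

lemma has_sum_L2_inner_fibres:
  assumes f: "f \<in> L2 fibre_measure" and h: "h \<in> L2 fibre_measure"
  shows "((\<lambda>r. L2_inner lborel (\<lambda>p. f (r, p)) (\<lambda>p. h (r, p))) has_sum L2_inner fibre_measure f h) UNIV"
proof -
  interpret pair_sigma_finite "count_space UNIV :: int measure" "lborel :: (real \<times> real) measure"
    by (intro pair_sigma_finite.intro sigma_finite_lborel sigma_finite_measure_count_space)
  have int: "integrable fibre_measure (\<lambda>z. f z * cnj (h z))"
    by (rule L2_integrable_mult[OF f h])
  then have "integrable (count_space UNIV) (\<lambda>r. L2_inner lborel (\<lambda>p. f (r, p)) (\<lambda>p. h (r, p)))"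
    unfolding L2_inner_def by (rule integrable_fst')
  moreover have "(LINT r|count_space UNIV. L2_inner lborel (\<lambda>p. f (r, p)) (\<lambda>p. h (r, p))) = L2_inner fibre_measure f h"
    unfolding L2_inner_def by (rule integral_fst'[OF int])
  ultimately show ?thesis
    using has_sum_integral_count_space by fastforce
qed

definition fibre_translate :: "(heis \<Rightarrow> complex) \<Rightarrow> real \<Rightarrow> int \<times> int \<Rightarrow> int \<times> real \<times> real \<Rightarrow> complex" where
  "fibre_translate g lam j z = twisted_translate (lam - of_int (fst z)) (of_int (2 * fst j), of_int (snd j))
     (partial_ft g (lam - of_int (fst z))) (snd z)"

text \<open>These conditions hold for almost every frequency in \<open>(0, 1]\<close>. For such a frequency all shifted values
  \<open>lam - r\<close> are nonzero, so the Weyl transform is available there, \<open>g\<close> has a fibre of finite norm,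
  and the separately chosen transforms of the translates of \<open>g\<close> are the twisted translates of the transform of \<open>g\<close>.\<close>

definition good_frequency :: "(heis \<Rightarrow> complex) \<Rightarrow> real \<Rightarrow> bool" where
  "good_frequency g lam \<longleftrightarrow> (\<forall>r::int. lam - of_int r \<noteq> 0) \<and>
     (\<integral>\<^sup>+r. sqnorm lborel (partial_ft g (lam - of_int r)) \<partial>count_space (UNIV :: int set)) < \<infinity> \<and>
     (\<forall>j r. AE p in lborel. partial_ft (left_translate (2 * of_int (fst j), of_int (snd j), 0) g) (lam - of_int r) p
        = fibre_translate g lam j (r, p))"

lemma measurable_twisted_translate:
  assumes "F \<in> borel_measurable borel"
  shows "twisted_translate \<omega> w F \<in> borel_measurable borel"
  using assms unfolding twisted_translate_eq[abs_def] by measurable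

lemma sqnorm_twisted_translate:
  assumes "F \<in> borel_measurable borel"
  shows "sqnorm lborel (twisted_translate \<omega> w F) = sqnorm lborel F"
proof -
  have "sqnorm lborel (twisted_translate \<omega> w F) = (\<integral>\<^sup>+p. (\<lambda>p. ennreal ((cmod (F p))\<^sup>2)) (p - w) \<partial>lborel)"
    by (simp add: sqnorm_def twisted_translate_eq norm_mult)
  also have "\<dots> = sqnorm lborel F"
    unfolding sqnorm_def using assms by (intro nn_integral_translate) measurable
  finally show ?thesis .
qed

text \<open>What holds for almost every frequency holds, for almost every frequency, at all its integer translates.
  The square sums over the fibre are finite almost everywhere because they integrate to \<open>\<parallel>g\<parallel>\<^sup>2\<close> over one period.\<close>

lemma AE_good_frequency:
  assumes g: "g \<in> L2 lborel"
  shows "AE lam in lborel. lam \<in> {0<..1} \<longrightarrow> good_frequency g lam"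
proof -
  have "AE lam :: real in lborel. \<forall>r::int. lam - of_int r \<noteq> 0"
    by (rule AE_fold) (rule AE_lborel_singleton)
  moreover have "AE lam in lborel. lam \<in> {0<..1} \<longrightarrow>
      (\<integral>\<^sup>+r. sqnorm lborel (partial_ft g (lam - of_int r)) \<partial>count_space (UNIV :: int set)) < \<infinity>"
  proof -
    define h where "h \<omega> = sqnorm lborel (partial_ft g \<omega>)" for \<omega>
    have hm[measurable]: "h \<in> borel_measurable borel"
    proof -
      have "(\<lambda>z. partial_ft g (snd z) (fst z)) \<in> borel_measurable borel"
        by (rule measurable_partial_ft[OF g])
      then have [measurable]: "(\<lambda>z. partial_ft g (fst z) (snd z)) \<in> borel_measurable (lborel \<Otimes>\<^sub>M lborel)"
        using measurable_compose[of "\<lambda>z. (snd z, fst z)" borel borel "\<lambda>z. partial_ft g (snd z) (fst z)"]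
        by (simp add: lborel_prod)
      have "(\<lambda>\<omega>. \<integral>\<^sup>+p. ennreal ((cmod ((\<lambda>z. partial_ft g (fst z) (snd z)) (\<omega>, p)))\<^sup>2) \<partial>lborel) \<in> borel_measurable lborel"
        by measurable
      then show ?thesis
        by (simp add: h_def[abs_def] sqnorm_def)
    qed
    have "(\<integral>\<^sup>+lam. indicator {0<..1} lam * (\<integral>\<^sup>+r. h (lam - of_int r) \<partial>count_space (UNIV :: int set)) \<partial>lborel)
        = sqnorm lborel g"
      using nn_integral_fold[OF hm, of 1] nn_integral_partial_ft[OF g] by (simp add: h_def)
    moreover have "(\<lambda>lam. indicator {0<..1} lam * (\<integral>\<^sup>+r. h (lam - of_int r) \<partial>count_space (UNIV :: int set)))
        \<in> borel_measurable lborel"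
    proof -
      have [measurable]: "(\<lambda>lam. \<integral>\<^sup>+r. h (lam - of_int r) \<partial>count_space (UNIV :: int set)) \<in> borel_measurable lborel"
        by (rule measurable_nn_integral_count_space) measurable
      show ?thesis
        by measurable
    qed
    ultimately have "AE lam in lborel. indicator {0<..1} lam * (\<integral>\<^sup>+r. h (lam - of_int r) \<partial>count_space (UNIV :: int set)) \<noteq> \<infinity>"
      using g by (intro nn_integral_PInf_AE) (auto simp: L2_iff)
    then show ?thesis
      by eventually_elim (auto simp: h_def less_top)
  qed
  moreover have "AE lam in lborel. \<forall>j::int \<times> int. \<forall>r::int. AE p in lborel.
      partial_ft (left_translate (2 * of_int (fst j), of_int (snd j), 0) g) (lam - of_int r) p
        = fibre_translate g lam j (r, p)"
  proof (subst AE_all_countable, rule allI)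
    fix j :: "int \<times> int"
    show "AE lam in lborel. \<forall>r::int. AE p in lborel.
      partial_ft (left_translate (2 * of_int (fst j), of_int (snd j), 0) g) (lam - of_int r) p
        = fibre_translate g lam j (r, p)"
      using AE_fold[OF partial_ft_left_translate[OF g, of "2 * of_int (fst j)" "of_int (snd j)" 0]]
      by (simp add: fibre_translate_def)
  qed
  ultimately show ?thesis
    by eventually_elim (auto simp: good_frequency_def)
qed

lemma fibre_translate_L2:
  assumes g: "g \<in> L2 lborel" and "good_frequency g lam"
  shows "fibre_translate g lam j \<in> L2 fibre_measure"
proof -
  note m = measurable_partial_ft_section[OF g]
  have sec: "(\<lambda>p. fibre_translate g lam j (r, p)) \<in> borel_measurable borel" for r
    using measurable_twisted_translate[OF m] by (simp add: fibre_translate_def)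
  then have "fibre_translate g lam j \<in> borel_measurable fibre_measure"
    by (intro measurable_fibre_measure) simp
  moreover from this have "sqnorm fibre_measure (fibre_translate g lam j)
      = (\<integral>\<^sup>+r. sqnorm lborel (partial_ft g (lam - of_int r)) \<partial>count_space UNIV)"
    by (subst sqnorm_fibre_measure) (simp_all add: fibre_translate_def sqnorm_twisted_translate[OF m])
  ultimately show ?thesis
    using assms by (simp add: L2_iff good_frequency_def)
qed

text \<open>Substituting \<open>p + w'\<close> for \<open>p\<close> moves both translations into one and leaves the symplectic phase.\<close>

lemma inner_twisted_translate:
  assumes F: "F \<in> borel_measurable borel"
  shows "L2_inner lborel (twisted_translate \<omega> w F) (twisted_translate \<omega> w' F)
    = cis (pi * \<omega> * (snd w * fst w' - fst w * snd w'))
      * L2_inner lborel (twisted_translate \<omega> (w - w') F) F"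
proof -
  let ?h = "\<lambda>p. twisted_translate \<omega> w F p * cnj (twisted_translate \<omega> w' F p)"
  have "L2_inner lborel (twisted_translate \<omega> w F) (twisted_translate \<omega> w' F) = (LINT p|lborel. ?h (w' + p))"
  proof -
    have [measurable]: "?h \<in> borel_measurable borel"
      using measurable_twisted_translate[OF F] by measurable
    have "(LINT p|lborel. ?h p) = (LINT p|distr lborel borel ((+) w'). ?h p)"
      by (simp add: lborel_distr_plus)
    also have "\<dots> = (LINT p|lborel. ?h (w' + p))"
      by (rule integral_distr) measurable
    finally show ?thesis
      by (simp add: L2_inner_def)
  qed
  also have "\<dots> = (LINT p|lborel. cis (pi * \<omega> * (snd w * fst w' - fst w * snd w'))
      * (twisted_translate \<omega> (w - w') F p * cnj (F p)))"
  proof (intro Bochner_Integration.integral_cong refl)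
    fix p :: "real \<times> real"
    have phase: "cis (pi * \<omega> * (snd w * fst (w' + p) - fst w * snd (w' + p)))
        * cnj (cis (pi * \<omega> * (snd w' * fst (w' + p) - fst w' * snd (w' + p))))
      = cis (pi * \<omega> * (snd w * fst w' - fst w * snd w')) * cis (pi * \<omega> * (snd (w - w') * fst p - fst (w - w') * snd p))"
      unfolding cis_cnj cis_mult by (rule arg_cong[where f=cis]) (simp add: algebra_simps)
    have shift: "w' + p - w = p - (w - w')"
      by simp
    have "?h (w' + p) = (cis (pi * \<omega> * (snd w * fst (w' + p) - fst w * snd (w' + p)))
        * cnj (cis (pi * \<omega> * (snd w' * fst (w' + p) - fst w' * snd (w' + p)))))
        * (F (w' + p - w) * cnj (F (w' + p - w')))"
      by (simp only: twisted_translate_eq complex_cnj_mult mult_ac)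
    also have "\<dots> = cis (pi * \<omega> * (snd w * fst w' - fst w * snd w'))
      * (twisted_translate \<omega> (w - w') F p * cnj (F p))"
      unfolding phase shift add_diff_cancel_left' twisted_translate_eq by (simp only: mult.assoc)
    finally show "?h (w' + p) = \<dots>" .
  qed
  finally show ?thesis
    by (simp add: L2_inner_def)
qed

lemma gramian_summand_eq:
  assumes g: "g \<in> L2 lborel"
  shows "gramian_summand g lam c j j' r
    = c j * cnj (c j') * L2_inner lborel (\<lambda>p. fibre_translate g lam j (r, p)) (\<lambda>p. fibre_translate g lam j' (r, p))"
proof -
  obtain k l k' l' where j: "j = (k, l)" "j' = (k', l')"
    by fastforce
  have "2 * pi * (lam - of_int r) * of_int (l * k' - k * l')
      = pi * (lam - of_int r) * (of_int l * of_int (2 * k') - of_int (2 * k) * of_int l')"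
    by (simp add: algebra_simps)
  then show ?thesis
    unfolding j gramian_summand_def fibre_translate_def fst_conv snd_conv
    by (subst inner_twisted_translate[OF measurable_partial_ft_section[OF g]]) (simp add: mult.assoc algebra_simps)
qed


section \<open>Synthesis operators\<close>

lemma ell2_hs_norm_sq_conv: "ell2_hs_norm_sq S = (\<integral>\<^sup>+r. hs_norm_sq (S r) \<partial>count_space UNIV)"
  by (simp add: ell2_hs_norm_sq_def infsum_count_space)

lemma ell2_hs_norm_sq_triangle:
  assumes "\<And>r n. R r (hs_basis n) \<in> borel_measurable lborel" "\<And>r n. S r (hs_basis n) \<in> borel_measurable lborel"
    "\<And>r n. T r (hs_basis n) \<in> borel_measurable lborel"
  shows "ell2_hs_norm_sq (\<lambda>r \<phi> \<xi>. R r \<phi> \<xi> - T r \<phi> \<xi>)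
    \<le> 2 * ell2_hs_norm_sq (\<lambda>r \<phi> \<xi>. R r \<phi> \<xi> - S r \<phi> \<xi>) + 2 * ell2_hs_norm_sq (\<lambda>r \<phi> \<xi>. S r \<phi> \<xi> - T r \<phi> \<xi>)"
proof -
  have "ell2_hs_norm_sq (\<lambda>r \<phi> \<xi>. R r \<phi> \<xi> - T r \<phi> \<xi>)
    \<le> (\<integral>\<^sup>+r. 2 * hs_norm_sq (\<lambda>\<phi> \<xi>. R r \<phi> \<xi> - S r \<phi> \<xi>) + 2 * hs_norm_sq (\<lambda>\<phi> \<xi>. S r \<phi> \<xi> - T r \<phi> \<xi>) \<partial>count_space UNIV)"
    unfolding ell2_hs_norm_sq_conv by (intro nn_integral_mono hs_norm_sq_triangle assms)
  then show ?thesis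
    by (simp add: ell2_hs_norm_sq_conv nn_integral_add nn_integral_cmult)
qed

lemma ell2_hs_norm_sq_diff_commute:
  "ell2_hs_norm_sq (\<lambda>r \<phi> \<xi>. S r \<phi> \<xi> - T r \<phi> \<xi>) = ell2_hs_norm_sq (\<lambda>r \<phi> \<xi>. T r \<phi> \<xi> - S r \<phi> \<xi>)"
  unfolding ell2_hs_norm_sq_conv by (subst hs_norm_sq_diff_commute) simp

lemma ell2_hs_norm_sq_diff_0:
  assumes "ell2_hs_norm_sq (\<lambda>r \<phi> \<xi>. S r \<phi> \<xi> - T r \<phi> \<xi>) = 0"
    and "\<And>r n. S r (hs_basis n) \<in> borel_measurable lborel" "\<And>r n. T r (hs_basis n) \<in> borel_measurable lborel"
  shows "ell2_hs_norm_sq S = ell2_hs_norm_sq T"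
proof -
  have "hs_norm_sq (S r) = hs_norm_sq (T r)" for r
  proof (rule hs_norm_sq_cong)
    fix n
    have "hs_norm_sq (\<lambda>\<phi> \<xi>. S r \<phi> \<xi> - T r \<phi> \<xi>) \<le> 0"
      unfolding assms(1)[symmetric] ell2_hs_norm_sq_conv by (rule nn_integral_ge_point) simp
    then have "AE \<xi> in lborel. S r (hs_basis n) \<xi> - T r (hs_basis n) \<xi> = 0"
      using assms(2,3) by (intro hs_norm_sq_eq_0D[of "\<lambda>\<phi> \<xi>. S r \<phi> \<xi> - T r \<phi> \<xi>"]) auto
    then show "AE \<xi> in lborel. S r (hs_basis n) \<xi> = T r (hs_basis n) \<xi>"
      by eventually_elim simp
  qed
  then show ?thesis
    by (simp add: ell2_hs_norm_sq_conv)
qed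

lemma bounded_l2op_cmult:
  assumes "bounded_l2op T"
  shows "bounded_l2op (\<lambda>\<phi> \<xi>. c * T \<phi> \<xi>)"
  unfolding bounded_l2op_def
proof (intro conjI ballI allI)
  fix \<phi> :: "real \<Rightarrow> complex" assume "\<phi> \<in> L2 lborel"
  then show "(\<lambda>\<xi>. c * T \<phi> \<xi>) \<in> L2 lborel"
    using assms by (auto simp: bounded_l2op_def intro: L2_cmult)
next
  fix \<phi> \<psi> :: "real \<Rightarrow> complex" and a b
  assume "\<phi> \<in> L2 lborel" "\<psi> \<in> L2 lborel"
  then have "AE \<xi> in lborel. T (\<lambda>x. a * \<phi> x + b * \<psi> x) \<xi> = a * T \<phi> \<xi> + b * T \<psi> \<xi>"
    using assms by (auto simp: bounded_l2op_def)
  then show "AE \<xi> in lborel. c * T (\<lambda>x. a * \<phi> x + b * \<psi> x) \<xi> = a * (c * T \<phi> \<xi>) + b * (c * T \<psi> \<xi>)"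
    by eventually_elim (simp add: algebra_simps)
next
  obtain C where C: "\<And>\<phi>. \<phi> \<in> L2 lborel \<Longrightarrow> L2_norm_sq lborel (T \<phi>) \<le> C * L2_norm_sq lborel \<phi>"
    using assms unfolding bounded_l2op_def by blast
  have "L2_norm_sq lborel (\<lambda>\<xi>. c * T \<phi> \<xi>) \<le> ((cmod c)\<^sup>2 * C) * L2_norm_sq lborel \<phi>" if "\<phi> \<in> L2 lborel" for \<phi>
    using mult_left_mono[OF C[OF that], of "(cmod c)\<^sup>2"] by (simp add: L2_norm_sq_cmult mult.assoc)
  then show "\<exists>C. \<forall>\<phi>\<in>L2 lborel. L2_norm_sq lborel (\<lambda>\<xi>. c * T \<phi> \<xi>) \<le> C * L2_norm_sq lborel \<phi>"
    by blast
qed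

text \<open>The factor \<open>sqrt |lam - r|\<close> compensates the Jacobian in \<open>sqnorm_weyl_kernel\<close>.\<close>

definition weyl_family :: "real \<Rightarrow> (int \<times> real \<times> real \<Rightarrow> complex) \<Rightarrow> int \<Rightarrow> l2op" where
  "weyl_family lam s r = (\<lambda>\<phi> \<xi>. of_real (sqrt \<bar>lam - of_int r\<bar>) * weyl_op (lam - of_int r) (\<lambda>p. s (r, p)) \<phi> \<xi>)"

lemma bounded_weyl_family:
  assumes "good_frequency g lam" "s \<in> L2 fibre_measure"
  shows "bounded_l2op (weyl_family lam s r)"
  unfolding weyl_family_def using assms
  by (intro bounded_l2op_cmult bounded_weyl_op L2_fibre_section) (auto simp: good_frequency_def)

lemma tau_weyl_op:
  "tau f lam r = (\<lambda>\<phi> \<xi>. of_real (sqrt \<bar>lam - of_int r\<bar>) * weyl_op (lam - of_int r) (partial_ft f (lam - of_int r)) \<phi> \<xi>)"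
  by (simp add: tau_def group_ft_def weyl_op_def)

definition tau_translate :: "(heis \<Rightarrow> complex) \<Rightarrow> real \<Rightarrow> int \<times> int \<Rightarrow> int \<Rightarrow> l2op" where
  "tau_translate g lam j = tau (left_translate (2 * of_int (fst j), of_int (snd j), 0) g) lam"

context
  fixes g :: "heis \<Rightarrow> complex" and lam :: real
  assumes g: "g \<in> L2 lborel" and good: "good_frequency g lam"
begin

lemma partial_ft_translate_L2:
  "partial_ft (left_translate (2 * of_int (fst j), of_int (snd j), 0) g) (lam - of_int r) \<in> L2 lborel"
proof -
  let ?f = "partial_ft (left_translate (2 * of_int (fst j), of_int (snd j), 0) g) (lam - of_int r)"
  have v: "(\<lambda>p. fibre_translate g lam j (r, p)) \<in> L2 lborel"
    by (rule L2_fibre_section[OF fibre_translate_L2[OF g good]])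
  have "?f \<in> borel_measurable lborel"
    using measurable_partial_ft_section[OF left_translate_L2[OF g]] by simp
  moreover have "sqnorm lborel ?f = sqnorm lborel (\<lambda>p. fibre_translate g lam j (r, p))"
    using good unfolding good_frequency_def by (intro sqnorm_cong_AE) blast
  ultimately show ?thesis
    using v by (simp add: L2_iff)
qed

lemma tau_translate_measurable: "tau_translate g lam j r (hs_basis n) \<in> borel_measurable lborel"
proof -
  have "bounded_l2op (tau_translate g lam j r)"
    unfolding tau_translate_def tau_weyl_op using good
    by (intro bounded_l2op_cmult bounded_weyl_op partial_ft_translate_L2) (simp add: good_frequency_def)
  then show ?thesis
    by (rule bounded_l2op_measurable)
qed

text \<open>The Weyl transform carries the fibre isometrically into square-summable families of
  Hilbert--Schmidt operators, and the translates of \<open>g\<close> to their images under \<open>\<tau>\<close>.\<close>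

proposition ell2_hs_norm_sq_weyl_family:
  assumes s: "s \<in> L2 fibre_measure" and "finite K"
  shows "ell2_hs_norm_sq (\<lambda>r \<phi> \<xi>. weyl_family lam s r \<phi> \<xi> - (\<Sum>j\<in>K. c j * tau_translate g lam j r \<phi> \<xi>))
    = ennreal (L2_norm_sq fibre_measure (\<lambda>z. s z - (\<Sum>j\<in>K. c j * fibre_translate g lam j z)))"
proof -
  let ?f = "\<lambda>j r. partial_ft (left_translate (2 * of_int (fst j), of_int (snd j), 0) g) (lam - of_int r)"
  let ?d = "\<lambda>z. s z - (\<Sum>j\<in>K. c j * fibre_translate g lam j z)"
  have d: "?d \<in> L2 fibre_measure"
    by (intro L2_diff L2_sum L2_cmult s fibre_translate_L2[OF g good])
  have "hs_norm_sq (\<lambda>\<phi> \<xi>. weyl_family lam s r \<phi> \<xi> - (\<Sum>j\<in>K. c j * tau_translate g lam j r \<phi> \<xi>))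
      = sqnorm lborel (\<lambda>p. ?d (r, p))" for r
  proof -
    have "hs_norm_sq (\<lambda>\<phi> \<xi>. weyl_family lam s r \<phi> \<xi> - (\<Sum>j\<in>K. c j * tau_translate g lam j r \<phi> \<xi>))
        = sqnorm lborel (\<lambda>p. s (r, p) - (\<Sum>j\<in>K. c j * ?f j r p))"
      unfolding weyl_family_def tau_translate_def tau_weyl_op using good
      by (intro hs_norm_sq_weyl_lincomb L2_fibre_section[OF s] partial_ft_translate_L2 \<open>finite K\<close>)
         (simp add: good_frequency_def)
    also have "\<dots> = sqnorm lborel (\<lambda>p. ?d (r, p))"
    proof (rule sqnorm_cong_AE)
      have "AE p in lborel. \<forall>j\<in>K. ?f j r p = fibre_translate g lam j (r, p)"
        using good \<open>finite K\<close> unfolding good_frequency_def by (intro AE_finite_allI) blast+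
      then show "AE p in lborel. s (r, p) - (\<Sum>j\<in>K. c j * ?f j r p) = ?d (r, p)"
        by eventually_elim simp
    qed
    finally show ?thesis .
  qed
  then show ?thesis
    by (simp add: ell2_hs_norm_sq_conv sqnorm_conv[OF d, symmetric] sqnorm_fibre_measure[OF L2_measurable[OF d]])
qed

lemma ell2_hs_norm_sq_weyl_family_0:
  "s \<in> L2 fibre_measure \<Longrightarrow> ell2_hs_norm_sq (weyl_family lam s) = ennreal (L2_norm_sq fibre_measure s)"
  using ell2_hs_norm_sq_weyl_family[of s "{}"] by simp

lemma has_synthesis_conv:
  "has_synthesis g lam c S \<longleftrightarrow> (\<forall>r. bounded_l2op (S r)) \<and> ell2_hs_norm_sq S < \<infinity> \<and>
     ((\<lambda>K. ell2_hs_norm_sq (\<lambda>r \<phi> \<xi>. S r \<phi> \<xi> - (\<Sum>j\<in>K. c j * tau_translate g lam j r \<phi> \<xi>)))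
       \<longlongrightarrow> 0) (finite_subsets_at_top UNIV)"
  unfolding has_synthesis_def tau_translate_def case_prod_beta by simp

text \<open>A synthesis \<open>S\<close> need not be a priori of the form \<open>weyl_family lam s\<close>. But its partial sums are, so they form
  a Cauchy net in the fibre; \<open>S\<close> agrees with the Weyl transform of the limit.\<close>

theorem has_gramian_form_iff:
  "has_gramian_form g lam c q \<longleftrightarrow> (\<exists>s\<in>L2 fibre_measure.
     ((\<lambda>K. L2_norm_sq fibre_measure (\<lambda>z. s z - (\<Sum>j\<in>K. c j * fibre_translate g lam j z))) \<longlongrightarrow> 0)
       (finite_subsets_at_top UNIV) \<and> q = L2_norm_sq fibre_measure s)"
proof
  let ?v = "\<lambda>K z. \<Sum>j\<in>K. c j * fibre_translate g lam j z"
  let ?t = "\<lambda>K r \<phi> \<xi>. \<Sum>j\<in>K. c j * tau_translate g lam j r \<phi> \<xi>"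
  have v: "?v K \<in> L2 fibre_measure" for K
    by (intro L2_sum L2_cmult fibre_translate_L2[OF g good])
  have tm: "?t K r (hs_basis n) \<in> borel_measurable lborel" for K r n
    using tau_translate_measurable by measurable
  have wm: "weyl_family lam s r (hs_basis n) \<in> borel_measurable lborel" if "s \<in> L2 fibre_measure" for s r n
    using bounded_weyl_family[OF good that] by (rule bounded_l2op_measurable)
  {
    assume "\<exists>s\<in>L2 fibre_measure. ((\<lambda>K. L2_norm_sq fibre_measure (\<lambda>z. s z - ?v K z)) \<longlongrightarrow> 0)
        (finite_subsets_at_top UNIV) \<and> q = L2_norm_sq fibre_measure s"
    then obtain s where s: "s \<in> L2 fibre_measure" and q: "q = L2_norm_sq fibre_measure s"
      and lim: "((\<lambda>K. L2_norm_sq fibre_measure (\<lambda>z. s z - ?v K z)) \<longlongrightarrow> 0) (finite_subsets_at_top UNIV)"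
      by blast
    have "((\<lambda>K. ennreal (L2_norm_sq fibre_measure (\<lambda>z. s z - ?v K z))) \<longlongrightarrow> 0) (finite_subsets_at_top UNIV)"
      using tendsto_ennrealI[OF lim] by simp
    then have "((\<lambda>K. ell2_hs_norm_sq (\<lambda>r \<phi> \<xi>. weyl_family lam s r \<phi> \<xi> - ?t K r \<phi> \<xi>)) \<longlongrightarrow> 0) (finite_subsets_at_top UNIV)"
      by (rule Lim_transform_eventually)
         (auto intro!: eventually_mono[OF eventually_finite_subsets_at_top_weakI] simp: ell2_hs_norm_sq_weyl_family[OF s])
    then have "has_synthesis g lam c (weyl_family lam s)"
      unfolding has_synthesis_conv using bounded_weyl_family[OF good s]
      by (simp add: ell2_hs_norm_sq_weyl_family_0[OF s])
    then show "has_gramian_form g lam c q"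
      unfolding has_gramian_form_def q using ell2_hs_norm_sq_weyl_family_0[OF s] L2_norm_sq_nonneg by blast
  }
  assume "has_gramian_form g lam c q"
  then obtain S where "0 \<le> q" and S: "has_synthesis g lam c S" "ell2_hs_norm_sq S = ennreal q"
    unfolding has_gramian_form_def by blast
  have Sm: "S r (hs_basis n) \<in> borel_measurable lborel" for r n
    using S(1) bounded_l2op_measurable unfolding has_synthesis_conv by blast
  have lim: "((\<lambda>K. ell2_hs_norm_sq (\<lambda>r \<phi> \<xi>. S r \<phi> \<xi> - ?t K r \<phi> \<xi>)) \<longlongrightarrow> 0) (finite_subsets_at_top UNIV)"
    using S(1) unfolding has_synthesis_conv by blast
  have "\<exists>X. finite X \<and> (\<forall>K. finite K \<longrightarrow> X \<subseteq> K \<longrightarrow> L2_norm_sq fibre_measure (\<lambda>z. ?v K z - ?v X z) < e)"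
    if "e > 0" for e :: real
  proof -
    \<comment> \<open>Two applications of the quadratic triangle inequality cost the factors \<open>4\<close> and \<open>2\<close>, with \<open>4 + 2 < 8\<close>.\<close>
    have "\<forall>\<^sub>F K in finite_subsets_at_top UNIV. ell2_hs_norm_sq (\<lambda>r \<phi> \<xi>. S r \<phi> \<xi> - ?t K r \<phi> \<xi>) < ennreal (e / 8)"
      using lim \<open>e > 0\<close> by (intro order_tendstoD) auto
    then obtain X where X: "finite X" "\<And>K. finite K \<Longrightarrow> X \<subseteq> K \<Longrightarrow>
        ell2_hs_norm_sq (\<lambda>r \<phi> \<xi>. S r \<phi> \<xi> - ?t K r \<phi> \<xi>) < ennreal (e / 8)"
      by (auto simp: eventually_finite_subsets_at_top)
    have "L2_norm_sq fibre_measure (\<lambda>z. ?v K z - ?v X z) < e" if K: "finite K" "X \<subseteq> K" for K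
    proof -
      have "ell2_hs_norm_sq (\<lambda>r \<phi> \<xi>. weyl_family lam (?v K) r \<phi> \<xi> - ?t K r \<phi> \<xi>) = 0"
        by (simp add: ell2_hs_norm_sq_weyl_family[OF v K(1)])
      then have "ell2_hs_norm_sq (\<lambda>r \<phi> \<xi>. weyl_family lam (?v K) r \<phi> \<xi> - S r \<phi> \<xi>)
          \<le> 2 * ell2_hs_norm_sq (\<lambda>r \<phi> \<xi>. S r \<phi> \<xi> - ?t K r \<phi> \<xi>)"
        using ell2_hs_norm_sq_triangle[of "weyl_family lam (?v K)" "?t K" S] wm[OF v] tm Sm
          ell2_hs_norm_sq_diff_commute[of "?t K" S] by simp
      also have "\<dots> \<le> 2 * ennreal (e / 8)"
        by (intro mult_left_mono less_imp_le X(2) K) simp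
      finally have 1: "ell2_hs_norm_sq (\<lambda>r \<phi> \<xi>. weyl_family lam (?v K) r \<phi> \<xi> - S r \<phi> \<xi>) \<le> 2 * ennreal (e / 8)" .
      have "ennreal (L2_norm_sq fibre_measure (\<lambda>z. ?v K z - ?v X z))
          = ell2_hs_norm_sq (\<lambda>r \<phi> \<xi>. weyl_family lam (?v K) r \<phi> \<xi> - ?t X r \<phi> \<xi>)"
        by (rule ell2_hs_norm_sq_weyl_family[OF v X(1), symmetric])
      also have "\<dots> \<le> 2 * ell2_hs_norm_sq (\<lambda>r \<phi> \<xi>. weyl_family lam (?v K) r \<phi> \<xi> - S r \<phi> \<xi>)
          + 2 * ell2_hs_norm_sq (\<lambda>r \<phi> \<xi>. S r \<phi> \<xi> - ?t X r \<phi> \<xi>)"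
        by (intro ell2_hs_norm_sq_triangle wm[OF v] tm Sm)
      also have "\<dots> \<le> 2 * (2 * ennreal (e / 8)) + 2 * ennreal (e / 8)"
        by (intro add_mono mult_left_mono 1 less_imp_le[OF X(2)] X(1) order_refl) simp_all
      also have "\<dots> = ennreal (6 * (e / 8))"
        using \<open>e > 0\<close> by (simp add: ennreal_mult'[symmetric] flip: ennreal_plus ennreal_numeral)
      finally have "L2_norm_sq fibre_measure (\<lambda>z. ?v K z - ?v X z) \<le> 6 * (e / 8)"
        using \<open>e > 0\<close> by (subst (asm) ennreal_le_iff) auto
      then show ?thesis
        using \<open>e > 0\<close> by linarith
    qed
    with X(1) show ?thesis
      by blast
  qed
  then obtain s where s: "s \<in> L2 fibre_measure"
    and lim_s: "((\<lambda>K. L2_norm_sq fibre_measure (\<lambda>z. s z - ?v K z)) \<longlongrightarrow> 0) (finite_subsets_at_top UNIV)"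
    using L2_net_complete[of ?v fibre_measure] v by blast
  have "ell2_hs_norm_sq (\<lambda>r \<phi> \<xi>. S r \<phi> \<xi> - weyl_family lam s r \<phi> \<xi>) \<le> 0"
  proof (rule tendsto_lowerbound)
    have "((\<lambda>K. 2 * ell2_hs_norm_sq (\<lambda>r \<phi> \<xi>. S r \<phi> \<xi> - ?t K r \<phi> \<xi>)
        + 2 * ennreal (L2_norm_sq fibre_measure (\<lambda>z. s z - ?v K z))) \<longlongrightarrow> 2 * 0 + 2 * ennreal 0) (finite_subsets_at_top UNIV)"
      by (intro tendsto_add ennreal_tendsto_cmult lim tendsto_ennrealI lim_s) auto
    then show "((\<lambda>K. 2 * ell2_hs_norm_sq (\<lambda>r \<phi> \<xi>. S r \<phi> \<xi> - ?t K r \<phi> \<xi>)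
        + 2 * ennreal (L2_norm_sq fibre_measure (\<lambda>z. s z - ?v K z))) \<longlongrightarrow> 0) (finite_subsets_at_top UNIV)"
      by simp
    show "\<forall>\<^sub>F K in finite_subsets_at_top UNIV. ell2_hs_norm_sq (\<lambda>r \<phi> \<xi>. S r \<phi> \<xi> - weyl_family lam s r \<phi> \<xi>)
        \<le> 2 * ell2_hs_norm_sq (\<lambda>r \<phi> \<xi>. S r \<phi> \<xi> - ?t K r \<phi> \<xi>)
        + 2 * ennreal (L2_norm_sq fibre_measure (\<lambda>z. s z - ?v K z))"
    proof (rule eventually_finite_subsets_at_top_weakI)
      fix K :: "(int \<times> int) set" assume "finite K"
      then show "ell2_hs_norm_sq (\<lambda>r \<phi> \<xi>. S r \<phi> \<xi> - weyl_family lam s r \<phi> \<xi>)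
        \<le> 2 * ell2_hs_norm_sq (\<lambda>r \<phi> \<xi>. S r \<phi> \<xi> - ?t K r \<phi> \<xi>)
        + 2 * ennreal (L2_norm_sq fibre_measure (\<lambda>z. s z - ?v K z))"
        using ell2_hs_norm_sq_triangle[of S "?t K" "weyl_family lam s"] wm[OF s] tm Sm
          ell2_hs_norm_sq_diff_commute[of "?t K" "weyl_family lam s"]
        by (simp add: ell2_hs_norm_sq_weyl_family[OF s])
    qed
  qed simp
  then have "ell2_hs_norm_sq S = ell2_hs_norm_sq (weyl_family lam s)"
    using Sm wm[OF s] by (intro ell2_hs_norm_sq_diff_0) auto
  then have "q = L2_norm_sq fibre_measure s"
    using S(2) \<open>0 \<le> q\<close> by (simp add: ell2_hs_norm_sq_weyl_family_0[OF s] L2_norm_sq_nonneg)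
  with s lim_s show "\<exists>s\<in>L2 fibre_measure. ((\<lambda>K. L2_norm_sq fibre_measure (\<lambda>z. s z - ?v K z)) \<longlongrightarrow> 0)
      (finite_subsets_at_top UNIV) \<and> q = L2_norm_sq fibre_measure s"
    by blast
qed

proposition has_gramian_form_imp_expanded:
  assumes "has_gramian_form g lam c q"
  shows "has_expanded_form g lam c q"
proof -
  let ?v = "fibre_translate g lam"
  obtain s where s: "s \<in> L2 fibre_measure" and q: "q = L2_norm_sq fibre_measure s"
    and lim: "((\<lambda>K. L2_norm_sq fibre_measure (\<lambda>z. s z - (\<Sum>j\<in>K. c j * ?v j z))) \<longlongrightarrow> 0) (finite_subsets_at_top UNIV)"
    using assms unfolding has_gramian_form_iff by blast
  note v = fibre_translate_L2[OF g good]
  have "(gramian_summand g lam c j j' has_sum (c j * cnj (c j') * L2_inner fibre_measure (?v j) (?v j'))) UNIV" for j j'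
    using has_sum_cmult_right[OF has_sum_L2_inner_fibres[OF v v]] by (simp add: gramian_summand_eq[OF g, abs_def])
  then show ?thesis
    unfolding has_expanded_form_def q using Gram_expansion[OF v s lim]
    by (intro exI[of _ "\<lambda>j j'. c j * cnj (c j') * L2_inner fibre_measure (?v j) (?v j')"]
          exI[of _ "\<lambda>j'. cnj (c j') * L2_inner fibre_measure s (?v j')"]) blast
qed

text \<open>For finitely supported coefficients the net of partial sums is eventually constant.\<close>

lemma has_gramian_form_finite:
  assumes "finite K" "\<And>j. j \<notin> K \<Longrightarrow> c j = 0"
  shows "has_gramian_form g lam c q \<longleftrightarrow> q = L2_norm_sq fibre_measure (\<lambda>z. \<Sum>j\<in>K. c j * fibre_translate g lam j z)"
proof -
  let ?v = "\<lambda>K z. \<Sum>j\<in>K. c j * fibre_translate g lam j z"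
  have v: "?v K \<in> L2 fibre_measure" for K
    by (intro L2_sum L2_cmult fibre_translate_L2[OF g good])
  have ev: "\<forall>\<^sub>F X in finite_subsets_at_top UNIV. ?v X = ?v K"
    unfolding eventually_finite_subsets_at_top
  proof (intro exI[of _ K] conjI allI impI)
    fix X assume X: "finite X \<and> K \<subseteq> X \<and> X \<subseteq> UNIV"
    then show "?v X = ?v K"
      using assms(2) by (intro ext sum.mono_neutral_right) auto
  qed (use assms in auto)
  have lim: "((\<lambda>X. L2_norm_sq fibre_measure (\<lambda>z. s z - ?v X z)) \<longlongrightarrow> L2_norm_sq fibre_measure (\<lambda>z. s z - ?v K z))
      (finite_subsets_at_top UNIV)" for s
    by (rule tendsto_eventually) (use ev in eventually_elim, metis)
  show ?thesis
    unfolding has_gramian_form_iff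
  proof
    assume "\<exists>s\<in>L2 fibre_measure. ((\<lambda>X. L2_norm_sq fibre_measure (\<lambda>z. s z - ?v X z)) \<longlongrightarrow> 0)
       (finite_subsets_at_top UNIV) \<and> q = L2_norm_sq fibre_measure s"
    then obtain s where s: "s \<in> L2 fibre_measure" and q: "q = L2_norm_sq fibre_measure s"
      and lim0: "((\<lambda>X. L2_norm_sq fibre_measure (\<lambda>z. s z - ?v X z)) \<longlongrightarrow> 0) (finite_subsets_at_top UNIV)"
      by blast
    have "L2_norm_sq fibre_measure (\<lambda>z. s z - ?v K z) = 0"
      using lim lim0 by (rule tendsto_unique[rotated]) simp
    then show "q = L2_norm_sq fibre_measure (?v K)"
      using L2_norm_triangle_diff[OF s v[of K]] by (simp add: q L2_norm_sq_nonneg)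
  next
    assume "q = L2_norm_sq fibre_measure (?v K)"
    then show "\<exists>s\<in>L2 fibre_measure. ((\<lambda>X. L2_norm_sq fibre_measure (\<lambda>z. s z - ?v X z)) \<longlongrightarrow> 0)
       (finite_subsets_at_top UNIV) \<and> q = L2_norm_sq fibre_measure s"
      using lim[of "?v K"] v[of K] by auto
  qed
qed

text \<open>The upper bound makes the partial sums converge, and both bounds pass to the limit.\<close>

proposition gramian_bounds:
  assumes "B > 0"
    and bounds: "\<And>K d. finite K \<Longrightarrow>
      A * (\<Sum>j\<in>K. (cmod (d j))\<^sup>2) \<le> L2_norm_sq fibre_measure (\<lambda>z. \<Sum>j\<in>K. d j * fibre_translate g lam j z) \<and>
      L2_norm_sq fibre_measure (\<lambda>z. \<Sum>j\<in>K. d j * fibre_translate g lam j z) \<le> B * (\<Sum>j\<in>K. (cmod (d j))\<^sup>2)"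
    and c: "c \<in> ell2"
  shows "\<exists>q. has_gramian_form g lam c q \<and> A * ell2_norm_sq c \<le> q \<and> q \<le> B * ell2_norm_sq c"
proof -
  let ?v = "\<lambda>K z. \<Sum>j\<in>K. c j * fibre_translate g lam j z"
  note v = fibre_translate_L2[OF g good]
  have vK: "?v K \<in> L2 fibre_measure" for K
    by (intro L2_sum L2_cmult v)
  obtain s where s: "s \<in> L2 fibre_measure"
    and lim: "((\<lambda>K. L2_norm_sq fibre_measure (\<lambda>z. s z - ?v K z)) \<longlongrightarrow> 0) (finite_subsets_at_top UNIV)"
    using Bessel_synthesis[of "fibre_translate g lam" fibre_measure B c, OF v conjunct2[OF bounds] \<open>B > 0\<close> c]
    by blast
  have normlim: "((\<lambda>K. L2_norm_sq fibre_measure (?v K)) \<longlongrightarrow> L2_norm_sq fibre_measure s) (finite_subsets_at_top UNIV)"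
    using lim by (intro tendsto_L2_norm_sq vK s) (subst L2_norm_sq_diff_commute)
  have clim: "((\<lambda>K. a * (\<Sum>j\<in>K. (cmod (c j))\<^sup>2)) \<longlongrightarrow> a * ell2_norm_sq c) (finite_subsets_at_top UNIV)" for a
    by (intro tendsto_intros ell2_norm_sq_tendsto c)
  have "A * ell2_norm_sq c \<le> L2_norm_sq fibre_measure s"
    by (rule tendsto_le[OF _ normlim clim]) (auto intro!: eventually_finite_subsets_at_top_weakI simp: bounds)
  moreover have "L2_norm_sq fibre_measure s \<le> B * ell2_norm_sq c"
    by (rule tendsto_le[OF _ clim normlim]) (auto intro!: eventually_finite_subsets_at_top_weakI simp: bounds)
  moreover have "has_gramian_form g lam c (L2_norm_sq fibre_measure s)"
    unfolding has_gramian_form_iff using s lim by blast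
  ultimately show ?thesis
    by blast
qed

end

section \<open>Localisation in the frequency\<close>

definition trig_window :: "int set \<Rightarrow> (int \<Rightarrow> complex) \<Rightarrow> real \<Rightarrow> complex" where
  "trig_window I b x = of_real (indicator {0<..1} x) * (\<Sum>n\<in>I. b n * cis (2 * pi * of_int n * x))"

lemma trig_window_trig_fun: "trig_window I b x = (\<Sum>n\<in>I. b n * trig_fun 0 1 (n, 0) x)"
  by (simp add: trig_window_def trig_fun_def sum_distrib_left mult_ac)

lemma trig_window_L2: "trig_window I b \<in> L2 lborel"
  unfolding trig_window_trig_fun[abs_def] by (intro L2_sum L2_cmult trig_fun_L2) simp

lemma sqnorm_trig_window: "sqnorm lborel (trig_window I b) = ennreal (\<Sum>n\<in>I. (cmod (b n))\<^sup>2)"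
proof -
  have "L2_norm_sq lborel (trig_window I b) = (\<Sum>n\<in>I. (cmod (b n))\<^sup>2)"
    unfolding trig_window_trig_fun[abs_def]
    by (rule L2_norm_sq_lincomb) (auto simp: trig_fun_L2 trig_fun_orthonormal)
  then show ?thesis
    by (simp add: sqnorm_conv[OF trig_window_L2])
qed

lemma sqnorm_density:
  fixes Q :: "real \<Rightarrow> ennreal" and f :: "real \<Rightarrow> complex"
  assumes [measurable]: "Q \<in> borel_measurable lborel" "f \<in> borel_measurable lborel"
  shows "sqnorm (density lborel Q) f = (\<integral>\<^sup>+x. Q x * ennreal ((cmod (f x))\<^sup>2) \<partial>lborel)"
  unfolding sqnorm_def by (rule nn_integral_density) measurable

text \<open>Squares of trigonometric polynomials approximate indicator functions. Fatou's lemma gives the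
  upper bound for \<open>Q\<close>; once \<open>Q\<close> is bounded, the approximation also holds in the weighted space, which gives
  the lower bound.\<close>

theorem localise_bounds:
  fixes Q :: "real \<Rightarrow> ennreal" and \<alpha> \<beta> :: real
  assumes Q: "Q \<in> borel_measurable lborel"
    and lower: "\<And>I b. finite I \<Longrightarrow> ennreal \<alpha> * sqnorm lborel (trig_window I b) \<le> sqnorm (density lborel Q) (trig_window I b)"
    and upper: "\<And>I b. finite I \<Longrightarrow> sqnorm (density lborel Q) (trig_window I b) \<le> ennreal \<beta> * sqnorm lborel (trig_window I b)"
  shows "AE x in lborel. x \<in> {0<..1} \<longrightarrow> ennreal \<alpha> \<le> Q x \<and> Q x \<le> ennreal \<beta>"
proof -
  have [measurable]: "Q \<in> borel_measurable borel"
    using Q by simp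
  let ?\<nu> = "density lborel Q"
  have m: "f \<in> borel_measurable lborel \<Longrightarrow> f \<in> borel_measurable ?\<nu>" for f :: "real \<Rightarrow> complex"
    by simp
  \<comment> \<open>Multiplication by an infinite value of \<open>Q\<close> is not continuous at \<open>0\<close>; the constant polynomial excludes such values.\<close>
  have fin: "AE x in lborel. x \<in> {0<..1} \<longrightarrow> Q x \<noteq> \<infinity>"
  proof -
    have "(\<integral>\<^sup>+x. Q x * ennreal ((cmod (trig_window {0} (\<lambda>_. 1) x))\<^sup>2) \<partial>lborel) \<le> ennreal \<beta> * ennreal 1"
      using upper[of "{0}" "\<lambda>_. 1"] by (simp add: sqnorm_trig_window sqnorm_density[OF Q L2_measurable[OF trig_window_L2]])
    also have "\<dots> < \<infinity>"
      by simp
    finally have "AE x in lborel. Q x * ennreal ((cmod (trig_window {0} (\<lambda>_. 1) x))\<^sup>2) \<noteq> \<infinity>"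
      using L2_measurable[OF trig_window_L2] by (intro nn_integral_PInf_AE) auto
    then show ?thesis
      by eventually_elim (auto simp: trig_window_def)
  qed
  have approx: "\<exists>P. (\<forall>k. P k \<in> L2 lborel \<and> (\<forall>x. x \<notin> {0<..1} \<longrightarrow> P k x = 0)
        \<and> ennreal \<alpha> * sqnorm lborel (P k) \<le> sqnorm ?\<nu> (P k)
        \<and> sqnorm ?\<nu> (P k) \<le> ennreal \<beta> * sqnorm lborel (P k))
      \<and> (\<lambda>k. L2_norm_sq lborel (\<lambda>x. P k x - of_real (indicator E x))) \<longlonglongrightarrow> 0
      \<and> (\<lambda>k::nat. sqnorm lborel (P k)) \<longlonglongrightarrow> emeasure lborel E \<and> (\<lambda>x. complex_of_real (indicator E x)) \<in> L2 lborel"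
    if E: "E \<in> sets borel" "E \<subseteq> {0<..1}" for E :: "real set"
  proof -
    obtain b I where fI: "\<And>k. finite (I k)" and lim: "(\<lambda>k. L2_norm_sq lborel (\<lambda>x. of_real (indicator {0<..1} x)
        * (\<Sum>n\<in>I k. b n * cis (2 * pi * of_int n * x)) - of_real (indicator E x))) \<longlonglongrightarrow> 0"
      by (rule trig_density[OF E]) (rule that)
    have "emeasure lborel E \<le> emeasure lborel {0<..1::real}"
      using E by (intro emeasure_mono) auto
    then have "emeasure lborel E < \<infinity>"
      by (rule le_less_trans) simp
    then have f: "(\<lambda>x. complex_of_real (indicator E x)) \<in> L2 lborel"
      using E by (intro indicator_L2) auto
    have lim': "(\<lambda>k. L2_norm_sq lborel (\<lambda>x. trig_window (I k) b x - of_real (indicator E x))) \<longlonglongrightarrow> 0"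
      using lim by (simp add: trig_window_def)
    have "(\<lambda>k. ennreal (L2_norm_sq lborel (trig_window (I k) b)))
        \<longlonglongrightarrow> ennreal (L2_norm_sq lborel (\<lambda>x. complex_of_real (indicator E x)))"
      by (intro tendsto_ennrealI tendsto_L2_norm_sq[OF trig_window_L2 f lim'])
    then have "(\<lambda>k. sqnorm lborel (trig_window (I k) b)) \<longlonglongrightarrow> emeasure lborel E"
      using E by (simp add: sqnorm_conv[symmetric] trig_window_L2 f sqnorm_indicator)
    moreover have "trig_window (I k) b x = 0" if "x \<notin> {0<..1}" for k x
      using that by (simp add: trig_window_def)
    ultimately show ?thesis
      by (intro exI[of _ "\<lambda>k. trig_window (I k) b"] conjI allI impI lim' f trig_window_L2
            lower[OF fI] upper[OF fI])
  qed
  have up: "AE x in lborel. x \<in> {0<..1} \<longrightarrow> Q x \<le> ennreal \<beta>"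
  proof -
    define E where "E = {x \<in> {0<..1}. Q x > ennreal \<beta>}"
    have E: "E \<in> sets borel" "E \<subseteq> {0<..1}"
    proof -
      have "{x \<in> space borel. x \<in> {0<..1} \<and> Q x > ennreal \<beta>} \<in> sets borel"
        by measurable
      then show "E \<in> sets borel"
        by (simp add: E_def)
    qed (auto simp: E_def)
    have [measurable]: "E \<in> sets borel"
      by (rule E)
    obtain P where P: "\<And>k. P k \<in> L2 lborel" "\<And>k x. x \<notin> {0<..1} \<Longrightarrow> P k x = 0"
        "\<And>k. sqnorm ?\<nu> (P k) \<le> ennreal \<beta> * sqnorm lborel (P k)"
      and lim: "(\<lambda>k. L2_norm_sq lborel (\<lambda>x. P k x - of_real (indicator E x))) \<longlonglongrightarrow> 0"
      and lim_sq: "(\<lambda>k::nat. sqnorm lborel (P k)) \<longlonglongrightarrow> emeasure lborel E"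
      and f: "(\<lambda>x. complex_of_real (indicator E x)) \<in> L2 lborel"
      using approx[OF E] by blast
    have [measurable]: "P k \<in> borel_measurable borel" for k
      using L2_measurable[OF P(1)] by simp
    obtain r where r: "strict_mono r" and AE: "AE x in lborel. (\<lambda>i. P (r i) x) \<longlonglongrightarrow> of_real (indicator E x)"
      using L2_AE_subseq[OF P(1) f lim] by blast
    have "(\<integral>\<^sup>+x. Q x * indicator E x \<partial>lborel) \<le> (\<integral>\<^sup>+x. liminf (\<lambda>i. Q x * ennreal ((cmod (P (r i) x))\<^sup>2)) \<partial>lborel)"
    proof (rule nn_integral_mono_AE, use AE fin in eventually_elim)
      case (elim x)
      show ?case
      proof (cases "x \<in> {0<..1}")
        case True
        have "(\<lambda>i. ennreal ((cmod (P (r i) x))\<^sup>2)) \<longlonglongrightarrow> ennreal ((cmod (complex_of_real (indicator E x)))\<^sup>2)"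
          by (intro tendsto_intros elim(1))
        then have "(\<lambda>i. Q x * ennreal ((cmod (P (r i) x))\<^sup>2)) \<longlonglongrightarrow> Q x * ennreal ((cmod (complex_of_real (indicator E x)))\<^sup>2)"
          using elim(2) True by (intro ennreal_tendsto_cmult) (auto simp: less_top)
        from lim_imp_Liminf[OF trivial_limit_sequentially this] show ?thesis
          by (auto simp: indicator_def)
      qed (use E in \<open>auto simp: indicator_def\<close>)
    qed
    also have "\<dots> \<le> liminf (\<lambda>i. sqnorm ?\<nu> (P (r i)))"
      using sqnorm_density[OF Q] by (simp add: nn_integral_liminf)
    also have "\<dots> \<le> liminf (\<lambda>i. ennreal \<beta> * sqnorm lborel (P (r i)))"
      by (intro Liminf_mono always_eventually allI P)
    also have "\<dots> = ennreal \<beta> * emeasure lborel E"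
      using LIMSEQ_subseq_LIMSEQ[OF lim_sq r]
      by (intro lim_imp_Liminf ennreal_tendsto_cmult) (auto simp: o_def)
    also have "\<dots> = (\<integral>\<^sup>+x. ennreal \<beta> * indicator E x \<partial>lborel)"
      by (simp add: nn_integral_cmult_indicator)
    finally have le: "(\<integral>\<^sup>+x. Q x * indicator E x \<partial>lborel) \<le> (\<integral>\<^sup>+x. ennreal \<beta> * indicator E x \<partial>lborel)" .
    have "AE x in lborel. Q x * indicator E x \<le> ennreal \<beta> * indicator E x"
    proof (rule ccontr)
      assume n: "\<not> ?thesis"
      have "(\<integral>\<^sup>+x. ennreal \<beta> * indicator E x \<partial>lborel) \<noteq> \<infinity>"
        using f E sqnorm_indicator[of E lborel]
        by (auto simp: nn_integral_cmult_indicator L2_iff ennreal_mult_eq_top_iff)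
      then have "(\<integral>\<^sup>+x. ennreal \<beta> * indicator E x \<partial>lborel) < (\<integral>\<^sup>+x. Q x * indicator E x \<partial>lborel)"
        using n by (intro nn_integral_less) (auto simp: E_def indicator_def)
      with le show False
        by simp
    qed
    then show ?thesis
    proof eventually_elim
      case (elim x)
      show ?case
      proof (intro impI, rule ccontr)
        assume "x \<in> {0<..1}" "\<not> Q x \<le> ennreal \<beta>"
        then have "x \<in> E"
          by (simp add: E_def)
        with elim \<open>\<not> Q x \<le> ennreal \<beta>\<close> show False
          by simp
      qed
    qed
  qed
  have weighted: "sqnorm ?\<nu> h \<le> ennreal \<beta> * sqnorm lborel h"
    if h: "h \<in> borel_measurable lborel" and off: "\<And>x. x \<notin> {0<..1} \<Longrightarrow> h x = 0" for h
  proof -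
    have [measurable]: "h \<in> borel_measurable borel"
      using h by simp
    have "sqnorm ?\<nu> h \<le> (\<integral>\<^sup>+x. ennreal \<beta> * ennreal ((cmod (h x))\<^sup>2) \<partial>lborel)"
      unfolding sqnorm_density[OF Q h]
    proof (rule nn_integral_mono_AE, use up in eventually_elim)
      case (elim x)
      then show ?case
        using off[of x] by (cases "x \<in> {0<..1}") (auto intro: mult_right_mono)
    qed
    then show ?thesis
      by (simp add: sqnorm_def nn_integral_cmult)
  qed
  have "AE x in lborel. x \<in> {0<..1} \<longrightarrow> ennreal \<alpha> \<le> Q x"
  proof -
    define E where "E = {x \<in> {0<..1}. Q x < ennreal \<alpha>}"
    have E: "E \<in> sets borel" "E \<subseteq> {0<..1}"
    proof -
      have "{x \<in> space borel. x \<in> {0<..1} \<and> Q x < ennreal \<alpha>} \<in> sets borel"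
        by measurable
      then show "E \<in> sets borel"
        by (simp add: E_def)
    qed (auto simp: E_def)
    have [measurable]: "E \<in> sets borel"
      by (rule E)
    obtain P where P: "\<And>k. P k \<in> L2 lborel" "\<And>k x. x \<notin> {0<..1} \<Longrightarrow> P k x = 0"
        "\<And>k. ennreal \<alpha> * sqnorm lborel (P k) \<le> sqnorm ?\<nu> (P k)"
      and lim: "(\<lambda>k. L2_norm_sq lborel (\<lambda>x. P k x - of_real (indicator E x))) \<longlonglongrightarrow> 0"
      and lim_sq: "(\<lambda>k::nat. sqnorm lborel (P k)) \<longlonglongrightarrow> emeasure lborel E"
      and f: "(\<lambda>x. complex_of_real (indicator E x)) \<in> L2 lborel"
      using approx[OF E] by blast
    have offf: "complex_of_real (indicator E x) = 0" if "x \<notin> {0<..1}" for x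
      using that E(2) by (auto simp: indicator_def)
    have \<nu>L2: "h \<in> L2 ?\<nu>" if "h \<in> L2 lborel" "\<And>x. x \<notin> {0<..1} \<Longrightarrow> h x = 0" for h
      using weighted[OF L2_measurable[OF that(1)] that(2)] that(1)
      by (auto simp: L2_iff ennreal_mult_less_top intro: le_less_trans)
    have P\<nu>: "P k \<in> L2 ?\<nu>" for k
      using P(1,2) by (rule \<nu>L2)
    have f\<nu>: "(\<lambda>x. complex_of_real (indicator E x)) \<in> L2 ?\<nu>"
      using f offf by (rule \<nu>L2)
    have "(\<lambda>k. sqnorm ?\<nu> (\<lambda>x. P k x - of_real (indicator E x))) \<longlonglongrightarrow> 0"
    proof (rule tendsto_sandwich[OF _ _ tendsto_const])
      show "\<forall>\<^sub>F k in sequentially. sqnorm ?\<nu> (\<lambda>x. P k x - of_real (indicator E x))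
          \<le> ennreal \<beta> * sqnorm lborel (\<lambda>x. P k x - of_real (indicator E x))"
        by (intro always_eventually allI weighted L2_measurable[OF L2_diff[OF P(1) f]]) (simp add: P(2) offf)
      have "(\<lambda>k. ennreal \<beta> * sqnorm lborel (\<lambda>x. P k x - of_real (indicator E x))) \<longlonglongrightarrow> ennreal \<beta> * 0"
        using lim by (intro ennreal_tendsto_cmult) (auto simp: sqnorm_tendsto_0_iff L2_diff P f)
      then show "(\<lambda>k. ennreal \<beta> * sqnorm lborel (\<lambda>x. P k x - of_real (indicator E x))) \<longlonglongrightarrow> 0"
        by simp
    qed simp
    then have "(\<lambda>k. L2_norm_sq ?\<nu> (\<lambda>x. P k x - of_real (indicator E x))) \<longlonglongrightarrow> 0"
      by (subst sqnorm_tendsto_0_iff[symmetric]) (intro L2_diff P\<nu> f\<nu>)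
    then have "(\<lambda>k. ennreal (L2_norm_sq ?\<nu> (P k))) \<longlonglongrightarrow> ennreal (L2_norm_sq ?\<nu> (\<lambda>x. of_real (indicator E x)))"
      by (intro tendsto_ennrealI tendsto_L2_norm_sq P\<nu> f\<nu>)
    then have lim\<nu>: "(\<lambda>k. sqnorm ?\<nu> (P k)) \<longlonglongrightarrow> sqnorm ?\<nu> (\<lambda>x. of_real (indicator E x))"
      by (simp only: sqnorm_conv[OF P\<nu>] sqnorm_conv[OF f\<nu>])
    have lim\<alpha>: "(\<lambda>k. ennreal \<alpha> * sqnorm lborel (P k)) \<longlonglongrightarrow> ennreal \<alpha> * emeasure lborel E"
      by (intro ennreal_tendsto_cmult lim_sq) simp
    have "(\<integral>\<^sup>+x. ennreal \<alpha> * indicator E x \<partial>lborel) = ennreal \<alpha> * emeasure lborel E"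
      by (simp add: nn_integral_cmult_indicator)
    also have "\<dots> \<le> sqnorm ?\<nu> (\<lambda>x. of_real (indicator E x))"
      by (rule LIMSEQ_le[OF lim\<alpha> lim\<nu>]) (use P(3) in auto)
    also have "\<dots> = (\<integral>\<^sup>+x. Q x * indicator E x \<partial>lborel)"
      unfolding sqnorm_density[OF Q L2_measurable[OF f]]
      by (rule nn_integral_cong) (auto simp: indicator_def)
    finally have le: "(\<integral>\<^sup>+x. ennreal \<alpha> * indicator E x \<partial>lborel) \<le> (\<integral>\<^sup>+x. Q x * indicator E x \<partial>lborel)" .
    have "AE x in lborel. ennreal \<alpha> * indicator E x \<le> Q x * indicator E x"
    proof (rule ccontr)
      assume n: "\<not> ?thesis"
      have "(\<integral>\<^sup>+x. Q x * indicator E x \<partial>lborel) \<le> (\<integral>\<^sup>+x. ennreal \<alpha> * indicator E x \<partial>lborel)"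
        by (intro nn_integral_mono) (auto simp: E_def indicator_def)
      also have "\<dots> < \<infinity>"
        using f E sqnorm_indicator[of E lborel] by (auto simp: nn_integral_cmult_indicator L2_iff ennreal_mult_less_top)
      finally have "(\<integral>\<^sup>+x. Q x * indicator E x \<partial>lborel) \<noteq> \<infinity>"
        by simp
      then have "(\<integral>\<^sup>+x. Q x * indicator E x \<partial>lborel) < (\<integral>\<^sup>+x. ennreal \<alpha> * indicator E x \<partial>lborel)"
        using n by (intro nn_integral_less) (auto simp: E_def indicator_def)
      with le show False
        by simp
    qed
    then show ?thesis
    proof eventually_elim
      case (elim x)
      show ?case
      proof (intro impI, rule ccontr)
        assume "x \<in> {0<..1}" "\<not> ennreal \<alpha> \<le> Q x"
        then have "x \<in> E"
          by (simp add: E_def)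
        with elim \<open>\<not> ennreal \<alpha> \<le> Q x\<close> show False
          by simp
      qed
    qed
  qed
  with up show ?thesis
    by eventually_elim auto
qed

section \<open>Periodisation of the norm of a combination of translates\<close>

definition fibre_sqnorm :: "(heis \<Rightarrow> complex) \<Rightarrow> (int \<times> int) set \<Rightarrow> (int \<times> int \<Rightarrow> complex) \<Rightarrow> real \<Rightarrow> ennreal" where
  "fibre_sqnorm g K d lam = sqnorm fibre_measure (\<lambda>z. \<Sum>j\<in>K. d j * fibre_translate g lam j z)"

lemma measurable_twisted_partial_ft:
  assumes g: "g \<in> L2 lborel"
  shows "(\<lambda>z. twisted_translate (fst z) w (partial_ft g (fst z)) (snd z)) \<in> borel_measurable (borel :: (real \<times> real \<times> real) measure)"
proof -
  have "(\<lambda>z. (\<lambda>z. partial_ft g (snd z) (fst z)) (snd z - w, fst z)) \<in> borel_measurable (borel :: (real \<times> real \<times> real) measure)"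
    by (rule measurable_compose[OF _ measurable_partial_ft[OF g]]) measurable
  then have [measurable]: "(\<lambda>z. partial_ft g (fst z) (snd z - w)) \<in> borel_measurable (borel :: (real \<times> real \<times> real) measure)"
    by simp
  show ?thesis
    unfolding twisted_translate_eq by measurable
qed

lemma measurable_sqnorm_section:
  fixes F :: "real \<times> real \<times> real \<Rightarrow> complex"
  assumes "F \<in> borel_measurable borel"
  shows "(\<lambda>\<omega>. sqnorm lborel (\<lambda>p. F (\<omega>, p))) \<in> borel_measurable borel"
proof -
  have [measurable]: "F \<in> borel_measurable (lborel \<Otimes>\<^sub>M lborel)"
    using assms by (simp add: lborel_prod)
  have "(\<lambda>\<omega>. \<integral>\<^sup>+p. ennreal ((cmod (F (\<omega>, p)))\<^sup>2) \<partial>lborel) \<in> borel_measurable lborel"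
    by measurable
  then show ?thesis
    by (simp add: sqnorm_def)
qed

lemma fibre_sqnorm_sections:
  assumes g: "g \<in> L2 lborel"
  shows "fibre_sqnorm g K d lam = (\<integral>\<^sup>+r. sqnorm lborel (\<lambda>p. \<Sum>j\<in>K. d j *
     twisted_translate (lam - of_int r) (of_int (2 * fst j), of_int (snd j)) (partial_ft g (lam - of_int r)) p)
     \<partial>count_space (UNIV :: int set))"
proof -
  have "(\<lambda>p. fibre_translate g lam j (r, p)) \<in> borel_measurable lborel" for j r
    using measurable_twisted_translate[OF measurable_partial_ft_section[OF g]]
    by (simp add: fibre_translate_def)
  then have "(\<lambda>z. \<Sum>j\<in>K. d j * fibre_translate g lam j z) \<in> borel_measurable fibre_measure"
    by (intro measurable_fibre_measure borel_measurable_sum borel_measurable_times borel_measurable_const)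
  then show ?thesis
    by (simp add: fibre_sqnorm_def sqnorm_fibre_measure fibre_translate_def)
qed

lemma measurable_fibre_sqnorm:
  assumes g: "g \<in> L2 lborel"
  shows "fibre_sqnorm g K d \<in> borel_measurable lborel"
proof -
  define h where "h \<omega> = sqnorm lborel (\<lambda>p. \<Sum>j\<in>K. d j *
     twisted_translate \<omega> (of_int (2 * fst j), of_int (snd j)) (partial_ft g \<omega>) p)" for \<omega>
  have [measurable]: "h \<in> borel_measurable borel"
    unfolding h_def[abs_def]
    using measurable_sqnorm_section[of "\<lambda>z. \<Sum>j\<in>K. d j *
       twisted_translate (fst z) (of_int (2 * fst j), of_int (snd j)) (partial_ft g (fst z)) (snd z)"]
      measurable_twisted_partial_ft[OF g]
    by (simp add: borel_measurable_sum borel_measurable_times)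
  have "(\<lambda>lam. \<integral>\<^sup>+r. h (lam - of_int r) \<partial>count_space (UNIV :: int set)) \<in> borel_measurable lborel"
    by (rule measurable_nn_integral_count_space) measurable
  then show ?thesis
    by (simp add: fibre_sqnorm_sections[OF g, abs_def] h_def)
qed

lemma fibre_sqnorm_cmult:
  assumes g: "g \<in> L2 lborel"
  shows "fibre_sqnorm g K (\<lambda>j. d j * a) lam = ennreal ((cmod a)\<^sup>2) * fibre_sqnorm g K d lam"
proof -
  have "(\<lambda>p. fibre_translate g lam j (r, p)) \<in> borel_measurable lborel" for j r
    using measurable_twisted_translate[OF measurable_partial_ft_section[OF g]]
    by (simp add: fibre_translate_def)
  then have m: "(\<lambda>z. \<Sum>j\<in>K. d j * fibre_translate g lam j z) \<in> borel_measurable fibre_measure"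
    by (intro measurable_fibre_measure borel_measurable_sum borel_measurable_times borel_measurable_const)
  show ?thesis
    using sqnorm_cmult[OF m, of a] by (simp add: fibre_sqnorm_def sum_distrib_left mult_ac)
qed

text \<open>On the transform side, translation by \<open>m\<close> in the centre is multiplication by a character that is
  periodic in the frequency. Folding the frequency axis onto one period therefore collects these translations
  into trigonometric polynomials.\<close>

proposition sqnorm_translates_periodised:
  assumes g: "g \<in> L2 lborel" and "finite K" "finite I"
  shows "sqnorm lborel (\<lambda>z. \<Sum>j\<in>K. \<Sum>m\<in>I. c j m * left_translate (2 * of_int (fst j), of_int (snd j), of_int m) g z)
    = (\<integral>\<^sup>+lam. indicator {0<..1} lam * fibre_sqnorm g K (\<lambda>j. \<Sum>m\<in>I. c j m * cis (2 * pi * of_int m * lam)) lam \<partial>lborel)"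
proof -
  define h where "h \<omega> = sqnorm lborel (\<lambda>p. \<Sum>j\<in>K. (\<Sum>m\<in>I. c j m * cis (2 * pi * of_int m * \<omega>)) *
     twisted_translate \<omega> (of_int (2 * fst j), of_int (snd j)) (partial_ft g \<omega>) p)" for \<omega>
  define q :: "(int \<times> int) \<times> int \<Rightarrow> real \<times> real"
    where "q i = (of_int (2 * fst (fst i)), of_int (snd (fst i)))" for i
  have hm: "h \<in> borel_measurable borel"
  proof -
    have [measurable]: "(\<lambda>z. twisted_translate (fst z) w (partial_ft g (fst z)) (snd z)) \<in> borel_measurable (borel :: (real \<times> real \<times> real) measure)" for w
      by (rule measurable_twisted_partial_ft[OF g])
    have "(\<lambda>z :: real \<times> real \<times> real. \<Sum>j\<in>K. (\<Sum>m\<in>I. c j m * cis (2 * pi * of_int m * fst z)) *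
       twisted_translate (fst z) (of_int (2 * fst j), of_int (snd j)) (partial_ft g (fst z)) (snd z)) \<in> borel_measurable borel"
      by measurable
    from measurable_sqnorm_section[OF this] show ?thesis
      by (simp add: h_def[abs_def])
  qed
  have "sqnorm lborel (\<lambda>z. \<Sum>j\<in>K. \<Sum>m\<in>I. c j m * left_translate (2 * of_int (fst j), of_int (snd j), of_int m) g z)
    = sqnorm lborel (\<lambda>z. \<Sum>i\<in>K \<times> I. c (fst i) (snd i) * left_translate (fst (q i), snd (q i), of_int (snd i)) g z)"
    by (simp add: q_def sum.cartesian_product case_prod_beta)
  also have "\<dots> = (\<integral>\<^sup>+\<omega>. sqnorm lborel (\<lambda>p. \<Sum>i\<in>K \<times> I. c (fst i) (snd i) * (cis (2 * pi * \<omega> * of_int (snd i))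
        * twisted_translate \<omega> (q i) (partial_ft g \<omega>) p)) \<partial>lborel)"
    by (rule sqnorm_translate_combination[OF g])
  also have "\<dots> = (\<integral>\<^sup>+\<omega>. h \<omega> \<partial>lborel)"
    unfolding h_def
    by (intro nn_integral_cong sqnorm_cong, simp only: sum_distrib_right sum.cartesian_product case_prod_beta)
       (intro sum.cong refl, auto simp: q_def mult_ac)
  also have "\<dots> = (\<integral>\<^sup>+lam. indicator {0<..1} lam * (\<integral>\<^sup>+r. h (lam - of_int r) \<partial>count_space (UNIV :: int set)) \<partial>lborel)"
    using nn_integral_fold[OF hm, of 1] by simp
  also have "\<dots> = (\<integral>\<^sup>+lam. indicator {0<..1} lam * fibre_sqnorm g K (\<lambda>j. \<Sum>m\<in>I. c j m * cis (2 * pi * of_int m * lam)) lam \<partial>lborel)"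
  proof -
    have "cis (2 * pi * of_int m * (lam - of_int r)) = cis (2 * pi * of_int m * lam)" for m r :: int and lam
    proof -
      have "2 * pi * of_int m * (lam - of_int r) = 2 * pi * of_int m * lam + 2 * pi * of_int (- m * r)"
        by (simp add: algebra_simps)
      then show ?thesis
        by (simp only: cis_mult[symmetric] cis_multiple_2pi[OF Ints_of_int] mult_1_right)
    qed
    then show ?thesis
      by (simp add: fibre_sqnorm_sections[OF g] h_def)
  qed
  finally show ?thesis .
qed

abbreviation lattice_translate :: "(heis \<Rightarrow> complex) \<Rightarrow> int \<times> int \<times> int \<Rightarrow> heis \<Rightarrow> complex" where
  "lattice_translate g \<equiv> (\<lambda>(k, l, m). left_translate (2 * of_int k, of_int l, of_int m) g)"

text \<open>The support of \<open>c\<close> is enlarged to a box, so that the sum over the central index \<open>m\<close> can be split off as a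
  trigonometric polynomial.\<close>

lemma riesz_box:
  fixes c :: "int \<times> int \<times> int \<Rightarrow> complex"
  assumes g: "g \<in> L2 lborel" and "finite K" "finite I"
    and sub: "{j. c j \<noteq> 0} \<subseteq> (\<lambda>(j, m). (fst j, snd j, m)) ` (K \<times> I)"
  shows "ennreal (L2_norm_sq lborel (\<lambda>x. \<Sum>j | c j \<noteq> 0. c j *
      lattice_translate g j x))
    = (\<integral>\<^sup>+lam. indicator {0<..1} lam *
        fibre_sqnorm g K (\<lambda>j. \<Sum>m\<in>I. c (fst j, snd j, m) * cis (2 * pi * of_int m * lam)) lam \<partial>lborel)"
    and "ell2_norm_sq c = (\<Sum>j\<in>K. \<Sum>m\<in>I. (cmod (c (fst j, snd j, m)))\<^sup>2)"
proof -
  let ?f = "lattice_translate g"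
  let ?\<iota> = "\<lambda>(j, m). (fst j, snd j, m) :: int \<times> int \<times> int"
  have inj: "inj_on ?\<iota> (K \<times> I)"
    by (auto simp: inj_on_def prod_eq_iff)
  have fin: "finite (?\<iota> ` (K \<times> I))"
    using assms by simp
  have box: "(\<Sum>i\<in>?\<iota> ` (K \<times> I). u i) = (\<Sum>j\<in>K. \<Sum>m\<in>I. u (fst j, snd j, m))" for u :: "int \<times> int \<times> int \<Rightarrow> 'b :: comm_monoid_add"
    by (subst sum.reindex[OF inj]) (simp add: sum.cartesian_product case_prod_beta)
  have eq: "(\<Sum>j | c j \<noteq> 0. c j * ?f j x)
      = (\<Sum>j\<in>K. \<Sum>m\<in>I. c (fst j, snd j, m) * left_translate (2 * of_int (fst j), of_int (snd j), of_int m) g x)" for x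
  proof -
    have "(\<Sum>j | c j \<noteq> 0. c j * ?f j x) = (\<Sum>j\<in>?\<iota> ` (K \<times> I). c j * ?f j x)"
      using sub fin by (intro sum.mono_neutral_left) auto
    then show ?thesis
      by (simp add: box)
  qed
  have "(\<lambda>x. \<Sum>j\<in>K. \<Sum>m\<in>I. c (fst j, snd j, m) * left_translate (2 * of_int (fst j), of_int (snd j), of_int m) g x) \<in> L2 lborel"
    by (intro L2_sum L2_cmult left_translate_L2 g)
  from sqnorm_conv[OF this] show "ennreal (L2_norm_sq lborel (\<lambda>x. \<Sum>j | c j \<noteq> 0. c j * ?f j x))
    = (\<integral>\<^sup>+lam. indicator {0<..1} lam *
        fibre_sqnorm g K (\<lambda>j. \<Sum>m\<in>I. c (fst j, snd j, m) * cis (2 * pi * of_int m * lam)) lam \<partial>lborel)"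
    using sqnorm_translates_periodised[OF assms(1-3), of "\<lambda>j m. c (fst j, snd j, m)"] by (simp only: eq)
  have "ell2_norm_sq c = (\<Sum>i\<in>?\<iota> ` (K \<times> I). (cmod (c i))\<^sup>2)"
    using sub by (intro ell2_finite_support fin) auto
  then show "ell2_norm_sq c = (\<Sum>j\<in>K. \<Sum>m\<in>I. (cmod (c (fst j, snd j, m)))\<^sup>2)"
    by (simp only: box)
qed

lemma tendsto_L2_norm_sq_lincomb:
  assumes v: "\<And>j. j \<in> K \<Longrightarrow> v j \<in> L2 M" and d: "\<And>j. j \<in> K \<Longrightarrow> (\<lambda>n. d n j) \<longlonglongrightarrow> d' j"
  shows "(\<lambda>n. L2_norm_sq M (\<lambda>x. \<Sum>j\<in>K. d n j * v j x)) \<longlonglongrightarrow> L2_norm_sq M (\<lambda>x. \<Sum>j\<in>K. d' j * v j x)"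
proof -
  have expand: "complex_of_real (L2_norm_sq M (\<lambda>x. \<Sum>j\<in>K. c j * v j x))
      = (\<Sum>i\<in>K. \<Sum>j\<in>K. c i * cnj (c j) * L2_inner M (v i) (v j))" for c
    using v
    by (simp add: L2_inner_self[symmetric] L2_inner_sum_left L2_inner_sum_right L2_sum L2_cmult
          L2_inner_cmult_left L2_inner_cmult_right sum_distrib_left mult.assoc)
  have "(\<lambda>n. complex_of_real (L2_norm_sq M (\<lambda>x. \<Sum>j\<in>K. d n j * v j x)))
      \<longlonglongrightarrow> complex_of_real (L2_norm_sq M (\<lambda>x. \<Sum>j\<in>K. d' j * v j x))"
    unfolding expand by (intro tendsto_intros d)
  then show ?thesis
    by (simp only: tendsto_of_real_iff)
qed

section \<open>The characterisation of Riesz sequences\<close>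

text \<open>The exceptional null set must not depend on the coefficients. It is chosen for the countably many
  finite sequences with values in a countable dense set; the bounds pass to limits of coefficients.\<close>

lemma AE_uniform_bounds:
  assumes g: "g \<in> L2 lborel"
    and each: "\<And>K d. finite K \<Longrightarrow> AE lam in lborel. lam \<in> {0<..1} \<longrightarrow>
      ennreal (A * (\<Sum>j\<in>K. (cmod (d j))\<^sup>2)) \<le> fibre_sqnorm g K d lam \<and>
      fibre_sqnorm g K d lam \<le> ennreal (B * (\<Sum>j\<in>K. (cmod (d j))\<^sup>2))"
    and "A > 0" "B > 0"
  shows "AE lam in lborel. lam \<in> {0<..1} \<longrightarrow> (\<forall>K d. finite K \<longrightarrow>
      A * (\<Sum>j\<in>K. (cmod (d j))\<^sup>2) \<le> L2_norm_sq fibre_measure (\<lambda>z. \<Sum>j\<in>K. d j * fibre_translate g lam j z) \<and>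
      L2_norm_sq fibre_measure (\<lambda>z. \<Sum>j\<in>K. d j * fibre_translate g lam j z) \<le> B * (\<Sum>j\<in>K. (cmod (d j))\<^sup>2))"
proof -
  obtain D :: "complex set" where D: "countable D" "\<And>X. open X \<Longrightarrow> X \<noteq> {} \<Longrightarrow> \<exists>d\<in>D. d \<in> X"
    using countable_dense_setE by blast
  define Z where "Z = (SIGMA K:{K :: (int \<times> int) set. finite K}. PiE K (\<lambda>_. D))"
  have "countable Z"
    unfolding Z_def using D(1) by (intro countable_SIGMA countable_Collect_finite countable_PiE) auto
  have "AE lam in lborel. \<forall>(K, d)\<in>Z. lam \<in> {0<..1} \<longrightarrow>
      ennreal (A * (\<Sum>j\<in>K. (cmod (d j))\<^sup>2)) \<le> fibre_sqnorm g K d lam \<and>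
      fibre_sqnorm g K d lam \<le> ennreal (B * (\<Sum>j\<in>K. (cmod (d j))\<^sup>2))"
    using \<open>countable Z\<close> each by (subst AE_ball_countable) (auto simp: Z_def)
  with AE_good_frequency[OF g] show ?thesis
  proof eventually_elim
    case (elim lam)
    show ?case
    proof (intro impI allI)
      fix K :: "(int \<times> int) set" and d :: "int \<times> int \<Rightarrow> complex"
      assume lam: "lam \<in> {0<..1}" and "finite K"
      note v = fibre_translate_L2[OF g]
      have good: "good_frequency g lam"
        using elim(1) lam by blast
      have "\<exists>z\<in>D. z \<in> ball (d j) (1 / Suc n)" for n j
        by (rule D(2)) auto
      then have "\<forall>n j. \<exists>z. z \<in> D \<and> dist (d j) z < 1 / Suc n"
        by (auto simp: Bex_def)
      then obtain e where e: "\<And>n j. e n j \<in> D" "\<And>n j. dist (d j) (e n j) < 1 / Suc n"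
        by metis
      define e' where "e' n = restrict (e n) K" for n
      have e'Z: "(K, e' n) \<in> Z" for n
        using e(1) \<open>finite K\<close> by (auto simp: Z_def e'_def)
      have conv: "(\<lambda>n. e' n j) \<longlonglongrightarrow> d j" if "j \<in> K" for j
      proof (rule metric_LIMSEQ_I)
        fix r :: real assume "r > 0"
        then obtain N where N: "1 / Suc N < r"
          using nat_approx_posE by metis
        have "dist (e' n j) (d j) < r" if "n \<ge> N" for n
        proof -
          have "1 / real (Suc n) \<le> 1 / Suc N"
            using that by (simp add: frac_le)
          then show ?thesis
            using e(2)[of j n] N \<open>j \<in> K\<close> by (simp add: e'_def dist_commute)
        qed
        then show "\<exists>no. \<forall>n\<ge>no. dist (e' n j) (d j) < r"
          by blast
      qed
      let ?N = "\<lambda>d. L2_norm_sq fibre_measure (\<lambda>z. \<Sum>j\<in>K. d j * fibre_translate g lam j z)"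
      have L: "(\<lambda>z. \<Sum>j\<in>K. c j * fibre_translate g lam j z) \<in> L2 fibre_measure" for c
        by (intro L2_sum L2_cmult v good)
      have bd: "A * (\<Sum>j\<in>K. (cmod (e' n j))\<^sup>2) \<le> ?N (e' n) \<and> ?N (e' n) \<le> B * (\<Sum>j\<in>K. (cmod (e' n j))\<^sup>2)" for n
      proof -
        have "ennreal (A * (\<Sum>j\<in>K. (cmod (e' n j))\<^sup>2)) \<le> ennreal (?N (e' n)) \<and>
            ennreal (?N (e' n)) \<le> ennreal (B * (\<Sum>j\<in>K. (cmod (e' n j))\<^sup>2))"
          using bspec[OF elim(2) e'Z[of n]] lam
          by (simp only: prod.case fibre_sqnorm_def sqnorm_conv[OF L] simp_thms)
        moreover have "0 \<le> B * (\<Sum>j\<in>K. (cmod (e' n j))\<^sup>2)"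
          using \<open>B > 0\<close> by (simp add: sum_nonneg)
        ultimately show ?thesis
          by (simp add: L2_norm_sq_nonneg)
      qed
      have limN: "(\<lambda>n. ?N (e' n)) \<longlonglongrightarrow> ?N d"
        by (intro tendsto_L2_norm_sq_lincomb v good conv)
      have limS: "(\<lambda>n. a * (\<Sum>j\<in>K. (cmod (e' n j))\<^sup>2)) \<longlonglongrightarrow> a * (\<Sum>j\<in>K. (cmod (d j))\<^sup>2)" for a
        by (intro tendsto_intros conv)
      show "A * (\<Sum>j\<in>K. (cmod (d j))\<^sup>2) \<le> ?N d \<and> ?N d \<le> B * (\<Sum>j\<in>K. (cmod (d j))\<^sup>2)"
        using LIMSEQ_le[OF limS limN] LIMSEQ_le[OF limN limS] bd by blast
    qed
  qed
qed

text \<open>Coefficients of the form \<open>c\<^sub>k\<^sub>l\<^sub>m = d\<^sub>k\<^sub>l b\<^sub>m\<close> produce the integral of \<open>\<parallel>\<Sum>d\<^sub>j v\<^sub>j\<parallel>\<^sup>2\<close> against the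
  squared modulus of the trigonometric polynomial with coefficients \<open>b\<close>, and \<open>\<parallel>c\<parallel>\<^sup>2 = \<parallel>d\<parallel>\<^sup>2 \<parallel>b\<parallel>\<^sup>2\<close>.\<close>

lemma riesz_imp_fibre_bounds:
  assumes g: "g \<in> L2 lborel" and "finite K" and "A > 0" "B > 0"
    and riesz: "\<And>c. finite {j. c j \<noteq> 0} \<Longrightarrow>
        A * ell2_norm_sq c \<le> L2_norm_sq lborel (\<lambda>x. \<Sum>j | c j \<noteq> 0. c j *
          lattice_translate g j x) \<and>
        L2_norm_sq lborel (\<lambda>x. \<Sum>j | c j \<noteq> 0. c j *
          lattice_translate g j x) \<le> B * ell2_norm_sq c"
  shows "AE lam in lborel. lam \<in> {0<..1} \<longrightarrow>
      ennreal (A * (\<Sum>j\<in>K. (cmod (d j))\<^sup>2)) \<le> fibre_sqnorm g K d lam \<and>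
      fibre_sqnorm g K d lam \<le> ennreal (B * (\<Sum>j\<in>K. (cmod (d j))\<^sup>2))"
proof -
  define S where "S = (\<Sum>j\<in>K. (cmod (d j))\<^sup>2)"
  have "S \<ge> 0"
    by (simp add: S_def sum_nonneg)
  have key: "ennreal (A * S) * sqnorm lborel (trig_window I b) \<le> sqnorm (density lborel (fibre_sqnorm g K d)) (trig_window I b)
     \<and> sqnorm (density lborel (fibre_sqnorm g K d)) (trig_window I b) \<le> ennreal (B * S) * sqnorm lborel (trig_window I b)"
    if "finite I" for I b
  proof -
    define c where "c = (\<lambda>(k, l, m). if (k, l) \<in> K \<and> m \<in> I then d (k, l) * b m else 0)"
    let ?N = "L2_norm_sq lborel (\<lambda>x. \<Sum>j | c j \<noteq> 0. c j *
          lattice_translate g j x)"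
    have supp: "{j. c j \<noteq> 0} \<subseteq> (\<lambda>(j, m). (fst j, snd j, m)) ` (K \<times> I)"
    proof
      fix i assume "i \<in> {j. c j \<noteq> 0}"
      then show "i \<in> (\<lambda>(j, m). (fst j, snd j, m)) ` (K \<times> I)"
        by (intro image_eqI[of _ _ "((fst i, fst (snd i)), snd (snd i))"])
           (auto simp: c_def case_prod_beta split: if_splits)
    qed
    then have fin: "finite {j. c j \<noteq> 0}"
      by (rule finite_subset) (use \<open>finite K\<close> \<open>finite I\<close> in simp)
    have cI: "c (fst j, snd j, m) = d j * b m" if "j \<in> K" "m \<in> I" for j m
      using that by (simp add: c_def)
    note box = riesz_box[of g K I c, OF g \<open>finite K\<close> \<open>finite I\<close> supp]
    have ell: "ell2_norm_sq c = S * (\<Sum>m\<in>I. (cmod (b m))\<^sup>2)"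
      unfolding box(2) S_def sum_product by (intro sum.cong refl) (simp add: cI norm_mult power_mult_distrib)
    have "ennreal ?N = (\<integral>\<^sup>+lam. fibre_sqnorm g K d lam * ennreal ((cmod (trig_window I b lam))\<^sup>2) \<partial>lborel)"
      unfolding box(1)
    proof (rule nn_integral_cong)
      fix lam
      have "fibre_sqnorm g K (\<lambda>j. \<Sum>m\<in>I. c (fst j, snd j, m) * cis (2 * pi * of_int m * lam)) lam
          = fibre_sqnorm g K (\<lambda>j. d j * (\<Sum>m\<in>I. b m * cis (2 * pi * of_int m * lam))) lam"
        unfolding fibre_sqnorm_def
        by (intro sqnorm_cong sum.cong refl) (simp add: cI sum_distrib_left mult.assoc)
      then show "indicator {0<..1} lam * fibre_sqnorm g K (\<lambda>j. \<Sum>m\<in>I. c (fst j, snd j, m) * cis (2 * pi * of_int m * lam)) lam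
          = fibre_sqnorm g K d lam * ennreal ((cmod (trig_window I b lam))\<^sup>2)"
        by (simp add: fibre_sqnorm_cmult[OF g] trig_window_def indicator_def mult.commute)
    qed
    also have "\<dots> = sqnorm (density lborel (fibre_sqnorm g K d)) (trig_window I b)"
      by (rule sqnorm_density[OF measurable_fibre_sqnorm[OF g] L2_measurable[OF trig_window_L2], symmetric])
    finally have N: "ennreal ?N = sqnorm (density lborel (fibre_sqnorm g K d)) (trig_window I b)" .
    have "ennreal (a * S) * sqnorm lborel (trig_window I b) = ennreal (a * ell2_norm_sq c)" if "a > 0" for a
      using that \<open>S \<ge> 0\<close> by (simp add: sqnorm_trig_window ell mult.assoc sum_nonneg flip: ennreal_mult)
    then show ?thesis
      using riesz[OF fin] \<open>A > 0\<close> \<open>B > 0\<close> by (simp add: N[symmetric] ennreal_leI)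
  qed
  show ?thesis
    using localise_bounds[OF measurable_fibre_sqnorm[OF g], of "A * S" K d "B * S"] key
    by (simp add: S_def)
qed

text \<open>The bounds are applied to the coefficients \<open>P\<^sub>j (lam)\<close> and integrated over one period; there
  \<open>\<Sum>|P\<^sub>j|\<^sup>2\<close> integrates to \<open>\<parallel>c\<parallel>\<^sup>2\<close> by orthonormality of the exponentials.\<close>

lemma fibre_bounds_imp_riesz:
  assumes g: "g \<in> L2 lborel" and "A > 0" "B > 0"
    and bounds: "AE lam in lborel. lam \<in> {0<..1} \<longrightarrow> (\<forall>K d. finite K \<longrightarrow>
      ennreal (A * (\<Sum>j\<in>K. (cmod (d j))\<^sup>2)) \<le> fibre_sqnorm g K d lam \<and>
      fibre_sqnorm g K d lam \<le> ennreal (B * (\<Sum>j\<in>K. (cmod (d j))\<^sup>2)))"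
    and fin: "finite {j. c j \<noteq> 0}"
  shows "A * ell2_norm_sq c \<le> L2_norm_sq lborel (\<lambda>x. \<Sum>j | c j \<noteq> 0. c j *
          lattice_translate g j x) \<and>
        L2_norm_sq lborel (\<lambda>x. \<Sum>j | c j \<noteq> 0. c j *
          lattice_translate g j x) \<le> B * ell2_norm_sq c"
proof -
  define K where "K = (\<lambda>(k, l, m). (k, l)) ` {j. c j \<noteq> 0}"
  define I where "I = (\<lambda>(k, l, m). m) ` {j. c j \<noteq> 0}"
  have KI: "finite K" "finite I"
    using fin by (simp_all add: K_def I_def)
  have supp: "{j. c j \<noteq> 0} \<subseteq> (\<lambda>(j, m). (fst j, snd j, m)) ` (K \<times> I)"
  proof
    fix i assume "i \<in> {j. c j \<noteq> 0}"
    then show "i \<in> (\<lambda>(j, m). (fst j, snd j, m)) ` (K \<times> I)"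
      by (intro image_eqI[of _ _ "((fst i, fst (snd i)), snd (snd i))"])
         (auto simp: K_def I_def case_prod_beta intro!: image_eqI[of _ _ i])
  qed
  let ?N = "L2_norm_sq lborel (\<lambda>x. \<Sum>j | c j \<noteq> 0. c j *
          lattice_translate g j x)"
  let ?p = "\<lambda>lam j. \<Sum>m\<in>I. c (fst j, snd j, m) * cis (2 * pi * of_int m * lam)"
  note box = riesz_box[of g K I c, OF g KI supp]
  have ell: "(\<integral>\<^sup>+lam. indicator {0<..1} lam * ennreal (a * (\<Sum>j\<in>K. (cmod (?p lam j))\<^sup>2)) \<partial>lborel) = ennreal (a * ell2_norm_sq c)"
    if "a > 0" for a
  proof -
    have [measurable]: "trig_window I b \<in> borel_measurable borel" for b
      using L2_measurable[OF trig_window_L2] by simp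
    have "(\<integral>\<^sup>+lam. indicator {0<..1} lam * ennreal (a * (\<Sum>j\<in>K. (cmod (?p lam j))\<^sup>2)) \<partial>lborel)
      = (\<integral>\<^sup>+lam. ennreal a * (\<Sum>j\<in>K. ennreal ((cmod (trig_window I (\<lambda>m. c (fst j, snd j, m)) lam))\<^sup>2)) \<partial>lborel)"
      using that by (intro nn_integral_cong)
        (auto simp: trig_window_def indicator_def sum_nonneg ennreal_mult sum_ennreal)
    also have "\<dots> = ennreal a * (\<Sum>j\<in>K. sqnorm lborel (trig_window I (\<lambda>m. c (fst j, snd j, m))))"
      by (simp add: nn_integral_cmult nn_integral_sum sqnorm_def del: sum_ennreal)
    also have "\<dots> = ennreal (a * ell2_norm_sq c)"
      using that by (simp add: sqnorm_trig_window box(2) sum_ennreal sum_nonneg ennreal_mult)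
    finally show ?thesis .
  qed
  have "ennreal (A * ell2_norm_sq c) \<le> ennreal ?N"
    unfolding ell[OF \<open>A > 0\<close>, symmetric] box(1)
  proof (rule nn_integral_mono_AE, use bounds in eventually_elim)
    case (elim lam)
    then show ?case
      using KI by (cases "lam \<in> {0<..1}") auto
  qed
  moreover have "ennreal ?N \<le> ennreal (B * ell2_norm_sq c)"
    unfolding ell[OF \<open>B > 0\<close>, symmetric] box(1)
  proof (rule nn_integral_mono_AE, use bounds in eventually_elim)
    case (elim lam)
    then show ?case
      using KI by (cases "lam \<in> {0<..1}") auto
  qed
  moreover have "0 \<le> B * ell2_norm_sq c"
    using \<open>B > 0\<close> by (simp add: ell2_norm_sq_nonneg)
  ultimately show ?thesis
    by (simp add: L2_norm_sq_nonneg)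
qed

theorem theorem3p2:
  fixes g :: "heis \<Rightarrow> complex"
  assumes "g \<in> L2 lborel"
  shows
    "(riesz_sequence lborel
        (\<lambda>(k :: int, l :: int, m :: int). left_translate (2 * of_int k, of_int l, of_int m) g)
      \<longleftrightarrow>
      (\<exists>A>0. \<exists>B>0. AE lam in lborel. lam \<in> {0<..1} \<longrightarrow>
         (\<forall>c\<in>ell2. \<exists>q. has_gramian_form g lam c q \<and> has_expanded_form g lam c q \<and>
            A * ell2_norm_sq c \<le> q \<and> q \<le> B * ell2_norm_sq c)))
     \<and>
     (AE lam in lborel. lam \<in> {0<..1} \<longrightarrow>
        (\<forall>c\<in>ell2. \<forall>q. has_gramian_form g lam c q \<longrightarrow> has_expanded_form g lam c q))"
proof (intro conjI iffI)
  note g = assms and good = AE_good_frequency[OF assms]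
  let ?f = "\<lambda>(k :: int, l :: int, m :: int). left_translate (2 * of_int k, of_int l, of_int m) g"
  show "AE lam in lborel. lam \<in> {0<..1} \<longrightarrow>
        (\<forall>c\<in>ell2. \<forall>q. has_gramian_form g lam c q \<longrightarrow> has_expanded_form g lam c q)"
    using good by eventually_elim (use has_gramian_form_imp_expanded[OF g] in blast)
  {
    assume "riesz_sequence lborel ?f"
    then obtain A B where AB: "A > 0" "B > 0" and riesz: "\<And>c. finite {j. c j \<noteq> 0} \<Longrightarrow>
        A * ell2_norm_sq c \<le> L2_norm_sq lborel (\<lambda>x. \<Sum>j | c j \<noteq> 0. c j * ?f j x) \<and>
        L2_norm_sq lborel (\<lambda>x. \<Sum>j | c j \<noteq> 0. c j * ?f j x) \<le> B * ell2_norm_sq c"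
      unfolding riesz_sequence_def by blast
    have "AE lam in lborel. lam \<in> {0<..1} \<longrightarrow> (\<forall>K d. finite K \<longrightarrow>
      A * (\<Sum>j\<in>K. (cmod (d j))\<^sup>2) \<le> L2_norm_sq fibre_measure (\<lambda>z. \<Sum>j\<in>K. d j * fibre_translate g lam j z) \<and>
      L2_norm_sq fibre_measure (\<lambda>z. \<Sum>j\<in>K. d j * fibre_translate g lam j z) \<le> B * (\<Sum>j\<in>K. (cmod (d j))\<^sup>2))"
      by (intro AE_uniform_bounds[OF g riesz_imp_fibre_bounds[OF g _ AB riesz]] AB)
    with good have "AE lam in lborel. lam \<in> {0<..1} \<longrightarrow>
         (\<forall>c\<in>ell2. \<exists>q. has_gramian_form g lam c q \<and> has_expanded_form g lam c q \<and>
            A * ell2_norm_sq c \<le> q \<and> q \<le> B * ell2_norm_sq c)"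
    proof eventually_elim
      case (elim lam)
      show ?case
      proof (intro impI ballI)
        fix c :: "int \<times> int \<Rightarrow> complex" assume lam: "lam \<in> {0<..1}" and c: "c \<in> ell2"
        have gd: "good_frequency g lam"
          using elim(1) lam by blast
        have "\<exists>q. has_gramian_form g lam c q \<and> A * ell2_norm_sq c \<le> q \<and> q \<le> B * ell2_norm_sq c"
          using elim(2) lam by (intro gramian_bounds[OF g gd AB(2) _ c]) blast
        then show "\<exists>q. has_gramian_form g lam c q \<and> has_expanded_form g lam c q \<and>
            A * ell2_norm_sq c \<le> q \<and> q \<le> B * ell2_norm_sq c"
          using has_gramian_form_imp_expanded[OF g gd] by blast
      qed
    qed
    with AB show "\<exists>A>0. \<exists>B>0. AE lam in lborel. lam \<in> {0<..1} \<longrightarrow>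
         (\<forall>c\<in>ell2. \<exists>q. has_gramian_form g lam c q \<and> has_expanded_form g lam c q \<and>
            A * ell2_norm_sq c \<le> q \<and> q \<le> B * ell2_norm_sq c)"
      by blast
  }
  assume "\<exists>A>0. \<exists>B>0. AE lam in lborel. lam \<in> {0<..1} \<longrightarrow>
         (\<forall>c\<in>ell2. \<exists>q. has_gramian_form g lam c q \<and> has_expanded_form g lam c q \<and>
            A * ell2_norm_sq c \<le> q \<and> q \<le> B * ell2_norm_sq c)"
  then obtain A B where AB: "A > 0" "B > 0" and gram: "AE lam in lborel. lam \<in> {0<..1} \<longrightarrow>
         (\<forall>c\<in>ell2. \<exists>q. has_gramian_form g lam c q \<and> has_expanded_form g lam c q \<and>
            A * ell2_norm_sq c \<le> q \<and> q \<le> B * ell2_norm_sq c)"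
    by blast
  from good gram have "AE lam in lborel. lam \<in> {0<..1} \<longrightarrow> (\<forall>K d. finite K \<longrightarrow>
      ennreal (A * (\<Sum>j\<in>K. (cmod (d j))\<^sup>2)) \<le> fibre_sqnorm g K d lam \<and>
      fibre_sqnorm g K d lam \<le> ennreal (B * (\<Sum>j\<in>K. (cmod (d j))\<^sup>2)))"
  proof eventually_elim
    case (elim lam)
    show ?case
    proof (intro impI allI)
      fix K :: "(int \<times> int) set" and d :: "int \<times> int \<Rightarrow> complex"
      assume lam: "lam \<in> {0<..1}" and K: "finite K"
      have gd: "good_frequency g lam"
        using elim(1) lam by blast
      define c where "c j = (if j \<in> K then d j else 0)" for j
      have c0: "\<And>j. j \<notin> K \<Longrightarrow> c j = 0"
        by (simp add: c_def)
      have c_ell2: "c \<in> ell2" "ell2_norm_sq c = (\<Sum>j\<in>K. (cmod (c j))\<^sup>2)"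
        using ell2_finite_support[of K c] K c0 by blast+
      obtain q where q: "has_gramian_form g lam c q" "A * ell2_norm_sq c \<le> q" "q \<le> B * ell2_norm_sq c"
        using bspec[OF mp[OF elim(2) lam] c_ell2(1)] by blast
      have "q = L2_norm_sq fibre_measure (\<lambda>z. \<Sum>j\<in>K. c j * fibre_translate g lam j z)"
        using q(1) has_gramian_form_finite[of g lam K c q, OF g gd K] c0 by blast
      also have "\<dots> = L2_norm_sq fibre_measure (\<lambda>z. \<Sum>j\<in>K. d j * fibre_translate g lam j z)"
        by (simp add: c_def)
      finally have "ennreal q = fibre_sqnorm g K d lam"
        unfolding fibre_sqnorm_def
        by (simp add: sqnorm_conv L2_sum L2_cmult fibre_translate_L2[OF g gd])
      moreover have "ell2_norm_sq c = (\<Sum>j\<in>K. (cmod (d j))\<^sup>2)"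
        unfolding c_ell2(2) by (simp add: c_def)
      ultimately show "ennreal (A * (\<Sum>j\<in>K. (cmod (d j))\<^sup>2)) \<le> fibre_sqnorm g K d lam \<and>
        fibre_sqnorm g K d lam \<le> ennreal (B * (\<Sum>j\<in>K. (cmod (d j))\<^sup>2))"
        using q(2,3) by (metis ennreal_leI)
    qed
  qed
  note bounds = fibre_bounds_imp_riesz[OF g AB this]
  show "riesz_sequence lborel ?f"
    unfolding riesz_sequence_def
  proof (intro conjI)
    show "\<forall>j. ?f j \<in> L2 lborel"
      by (simp add: left_translate_L2[OF g])
    show "\<exists>A>0. \<exists>B>0. \<forall>c. finite {j. c j \<noteq> 0} \<longrightarrow>
        A * ell2_norm_sq c \<le> L2_norm_sq lborel (\<lambda>x. \<Sum>j | c j \<noteq> 0. c j * ?f j x) \<and>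
        L2_norm_sq lborel (\<lambda>x. \<Sum>j | c j \<noteq> 0. c j * ?f j x) \<le> B * ell2_norm_sq c"
      by (rule exI[of _ A], rule conjI, rule AB, rule exI[of _ B], rule conjI, rule AB, intro allI impI, rule bounds)
  qed
qed

end
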